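(* Let $G,\mathbf N$ be as in the context with $Z^D(G)\ne 0$. For each black-white pairing $\rho$ of $\mathbf N$ and planar pairing $\sigma$ of $\mathbf N$, define the integer $$\mathcal Q^{(DD)}_{\sigma,\rho}=\mathrm{sign}_{OE}(\sigma)\,\mathrm{sign}_{BW}(\rho)\,\mathcal P_{\sigma,\rho},$$ where $\mathcal P_{\sigma,\rho}$ is the coefficient of $\sigma$ when $\rho$ is written as a formal integer linear combination of planar pairings by repeatedly applying the rule: if $\{a,c\},\{b,d\}$ are pairs with $a<b<c<d$, replace the pairing $\{a,c\},\{b,d\},\text{rest}$ by $-\big(\{a,b\},\{c,d\},\text{rest}\big)-\big(\{a,d\},\{b,c\},\text{rest}\big)$. Then for every planar pairing $\sigma$, $$\frac{Z^{DD}_\sigma(G,\mathbf N)}{(Z^D(G))^2}=\sum_{\rho\ \text{black-white pairing}}\mathcal Q^{(DD)}_{\sigma,\rho}\,Y'_\rho,\qquad Y'_\rho=(-1)^{\#\text{crossings of }\rho}\prod_{\{b,w\}\in\rho}Y_{b,w}.$$ In particular $Z^{DD}_\sigma(G,\mathbf N)/(Z^D(G))^2$ is an integer-coefficient homogeneous polynomial in the $Y_{i,j}$.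
   Context: $G=(V_1,V_2,E)$ is a finite edge-weighted planar bipartite graph embedded in the plane; $V_1$ black, $V_2$ white. Nodes $\mathbf N$: $2n$ vertices on the outer face labeled $1,\dots,2n$ counterclockwise, $n$ black and $n$ white, colors otherwise arbitrary. $Z^D(H)$ is the weighted sum of perfect matchings of $H$; $G_{i,j}$ is $G$ with vertices $i,j$ deleted; $Y_{i,j}=Z^D(G_{i,j})/Z^D(G)$. A double-dimer configuration on $(G,\mathbf N)$ is a multiset of edges in which each node has degree 1 and every other vertex degree 2; weight = product of edge weights times $2^{\#\text{loops}}$ (loops = cycles of length $>2$); $Z^{DD}_\sigma(G,\mathbf N)$ = total weight of configurations whose paths pair the nodes according to $\sigma$. Pairings are partitions into 2-element blocks; $\{a,c\},\{b,d\}$ cross if $a<b<c<d$; planar = no crossings; the number of crossings counts crossing pairs of pairs. Odd-even pairing: every pair has one odd and one even element; $\mathrm{sign}_{OE}(\pi)$ is the sign of the permutation $(\pi(1)/2,\pi(3)/2,\dots,\pi(2n-1)/2)$. Black-white pairing: every pair has one black and one white node; with black nodes $b_1<\dots<b_n$ and white nodes $w_1<\dots<w_n$, $\mathrm{sign}_{BW}(\rho)$ is the sign of the permutation $\theta$ with $\rho(b_i)=w_{\theta(i)}$. (The reduction in the rule terminates and the resulting coefficients do not depend on the choices made.) *)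

theory Defs
  imports "HOL-Analysis.Analysis" "HOL-Combinatorics.Permutations" "HOL-Library.Multiset"
begin

section \<open>Graphs: finite bipartite graph, edges oriented (black, white)\<close>

definition bip_graph :: "'v set \<Rightarrow> 'v set \<Rightarrow> ('v \<times> 'v) set \<Rightarrow> bool" where
  "bip_graph V V1 E \<longleftrightarrow> finite V \<and> V1 \<subseteq> V \<and> E \<subseteq> V1 \<times> (V - V1)"

definition nodes_ok :: "'v set \<Rightarrow> 'v set \<Rightarrow> nat \<Rightarrow> (nat \<Rightarrow> 'v) \<Rightarrow> bool" where
  "nodes_ok V V1 n node \<longleftrightarrow> inj_on node {1..2*n} \<and> node ` {1..2*n} \<subseteq> V
     \<and> card {k\<in>{1..2*n}. node k \<in> V1} = n"

text \<open>Planar embedding in the closed unit disk, nodes on the boundary circle in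
  counterclockwise order 1,...,2n, everything else in the open disk
  (equivalent to a plane embedding with the nodes on the outer face in ccw order).\<close>
definition disk_embedding ::
  "'v set \<Rightarrow> ('v \<times> 'v) set \<Rightarrow> nat \<Rightarrow> (nat \<Rightarrow> 'v) \<Rightarrow> ('v \<Rightarrow> complex)
     \<Rightarrow> ('v \<times> 'v \<Rightarrow> real \<Rightarrow> complex) \<Rightarrow> bool" where
  "disk_embedding V E n node pos \<gamma> \<longleftrightarrow>
     inj_on pos V \<and>
     (\<forall>e\<in>E. arc (\<gamma> e) \<and> pathstart (\<gamma> e) = pos (fst e) \<and> pathfinish (\<gamma> e) = pos (snd e)) \<and>
     (\<forall>e\<in>E. \<forall>v\<in>V. pos v \<in> path_image (\<gamma> e) \<longrightarrow> v = fst e \<or> v = snd e) \<and>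
     (\<forall>e\<in>E. \<forall>e'\<in>E. e \<noteq> e' \<longrightarrow>
        path_image (\<gamma> e) \<inter> path_image (\<gamma> e') \<subseteq> pos ` ({fst e, snd e} \<inter> {fst e', snd e'})) \<and>
     (\<forall>e\<in>E. path_image (\<gamma> e) \<subseteq> cball 0 1) \<and>
     (\<forall>e\<in>E. path_image (\<gamma> e) \<inter> sphere 0 1 \<subseteq> pos ` node ` {1..2*n}) \<and>
     (\<forall>v\<in>V - node ` {1..2*n}. norm (pos v) < 1) \<and>
     (\<exists>\<theta>::nat \<Rightarrow> real. (\<forall>k\<in>{1..2*n}. pos (node k) = cis (\<theta> k)) \<and>
        strict_mono_on {1..2*n} \<theta> \<and> (0 < n \<longrightarrow> \<theta> (2*n) < \<theta> 1 + 2*pi))"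

definition perfect_matching :: "('v \<times> 'v) set \<Rightarrow> 'v set \<Rightarrow> ('v \<times> 'v) set \<Rightarrow> bool" where
  "perfect_matching E W M \<longleftrightarrow> M \<subseteq> E \<and> (\<forall>e\<in>M. fst e \<in> W \<and> snd e \<in> W) \<and>
     (\<forall>x\<in>W. \<exists>!e\<in>M. x = fst e \<or> x = snd e)"

definition ZD :: "('v \<times> 'v) set \<Rightarrow> ('v \<times> 'v \<Rightarrow> real) \<Rightarrow> 'v set \<Rightarrow> real" where
  "ZD E wt W = (\<Sum>M\<in>{M. perfect_matching E W M}. \<Prod>e\<in>M. wt e)"

definition ddeg :: "('v \<times> 'v) multiset \<Rightarrow> 'v \<Rightarrow> nat" where
  "ddeg D x = size (filter_mset (\<lambda>e. fst e = x \<or> snd e = x) D)"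

definition dd_config :: "'v set \<Rightarrow> ('v \<times> 'v) set \<Rightarrow> 'v set \<Rightarrow> ('v \<times> 'v) multiset \<Rightarrow> bool" where
  "dd_config V E N D \<longleftrightarrow> set_mset D \<subseteq> E \<and> (\<forall>x\<in>V. ddeg D x = (if x \<in> N then 1 else 2))"

definition dd_rel :: "('v \<times> 'v) multiset \<Rightarrow> ('v \<times> 'v) set" where
  "dd_rel D = set_mset D \<union> (\<lambda>(x,y). (y,x)) ` set_mset D"

definition dd_loops :: "'v set \<Rightarrow> 'v set \<Rightarrow> ('v \<times> 'v) multiset \<Rightarrow> nat" where
  "dd_loops V N D = card {C. \<exists>x\<in>V. C = {y. (x,y) \<in> (dd_rel D)\<^sup>*} \<and> C \<inter> N = {} \<and> card C > 2}"

definition dd_pairing :: "nat \<Rightarrow> (nat \<Rightarrow> 'v) \<Rightarrow> ('v \<times> 'v) multiset \<Rightarrow> nat set set" where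
  "dd_pairing n node D = {{i,j} |i j. i \<in> {1..2*n} \<and> j \<in> {1..2*n} \<and> i \<noteq> j \<and>
      (node i, node j) \<in> (dd_rel D)\<^sup>*}"

definition ZDD :: "'v set \<Rightarrow> ('v \<times> 'v) set \<Rightarrow> ('v \<times> 'v \<Rightarrow> real) \<Rightarrow> nat \<Rightarrow> (nat \<Rightarrow> 'v)
     \<Rightarrow> nat set set \<Rightarrow> real" where
  "ZDD V E wt n node \<sigma> =
     (\<Sum>D\<in>{D. dd_config V E (node ` {1..2*n}) D \<and> dd_pairing n node D = \<sigma>}.
        (\<Prod>e\<in>set_mset D. wt e ^ count D e) * 2 ^ dd_loops V (node ` {1..2*n}) D)"

definition is_pairing :: "nat \<Rightarrow> nat set set \<Rightarrow> bool" where
  "is_pairing n P \<longleftrightarrow> (\<forall>B\<in>P. \<exists>i j. i \<noteq> j \<and> B = {i,j}) \<and> \<Union>P \<subseteq> {1..2*n} \<and>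
     (\<forall>k\<in>{1..2*n}. \<exists>!B\<in>P. k \<in> B)"

definition planar_pairing :: "nat set set \<Rightarrow> bool" where
  "planar_pairing P \<longleftrightarrow> \<not> (\<exists>a b c d. a < b \<and> b < c \<and> c < d \<and> {a,c} \<in> P \<and> {b,d} \<in> P)"

definition ncross :: "nat set set \<Rightarrow> nat" where
  "ncross P = card {(B1,B2) \<in> P \<times> P. \<exists>a b c d. a < b \<and> b < c \<and> c < d \<and> B1 = {a,c} \<and> B2 = {b,d}}"

definition partner :: "nat set set \<Rightarrow> nat \<Rightarrow> nat" where
  "partner P k = (THE j. j \<noteq> k \<and> {k,j} \<in> P)"

definition sign_OE :: "nat \<Rightarrow> nat set set \<Rightarrow> int" where
  "sign_OE n P = sign (\<lambda>i. if i \<in> {1..n} then partner P (2*i - 1) div 2 else i)"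

definition black_labels :: "'v set \<Rightarrow> nat \<Rightarrow> (nat \<Rightarrow> 'v) \<Rightarrow> nat list" where
  "black_labels V1 n node = sorted_list_of_set {k\<in>{1..2*n}. node k \<in> V1}"

definition white_labels :: "'v set \<Rightarrow> nat \<Rightarrow> (nat \<Rightarrow> 'v) \<Rightarrow> nat list" where
  "white_labels V1 n node = sorted_list_of_set {k\<in>{1..2*n}. node k \<notin> V1}"

definition is_bw_pairing :: "'v set \<Rightarrow> nat \<Rightarrow> (nat \<Rightarrow> 'v) \<Rightarrow> nat set set \<Rightarrow> bool" where
  "is_bw_pairing V1 n node P \<longleftrightarrow> is_pairing n P \<and>
     (\<forall>B\<in>P. \<exists>b w. B = {b,w} \<and> node b \<in> V1 \<and> node w \<notin> V1)"

definition sign_BW :: "'v set \<Rightarrow> nat \<Rightarrow> (nat \<Rightarrow> 'v) \<Rightarrow> nat set set \<Rightarrow> int" where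
  "sign_BW V1 n node P = sign (\<lambda>i. if i \<in> {1..n} then
      (THE j. j \<in> {1..n} \<and> white_labels V1 n node ! (j - 1) =
                 partner P (black_labels V1 n node ! (i - 1)))
      else i)"

definition red_step :: "(nat set set \<Rightarrow> int) \<Rightarrow> (nat set set \<Rightarrow> int) \<Rightarrow> bool" where
  "red_step f g \<longleftrightarrow> (\<exists>\<rho> a b c d. f \<rho> \<noteq> 0 \<and> a < b \<and> b < c \<and> c < d \<and> {a,c} \<in> \<rho> \<and> {b,d} \<in> \<rho> \<and>
      (let \<rho>1 = (\<rho> - {{a,c},{b,d}}) \<union> {{a,b},{c,d}};
           \<rho>2 = (\<rho> - {{a,c},{b,d}}) \<union> {{a,d},{b,c}}
       in g = (\<lambda>\<tau>. f \<tau> - (if \<tau> = \<rho> then f \<rho> else 0) - (if \<tau> = \<rho>1 then f \<rho> else 0)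
                    - (if \<tau> = \<rho>2 then f \<rho> else 0))))"

definition Pcoef :: "nat set set \<Rightarrow> nat set set \<Rightarrow> int" where
  "Pcoef \<sigma> \<rho> = (SOME f. red_step\<^sup>*\<^sup>* (\<lambda>\<tau>. if \<tau> = \<rho> then 1 else 0) f \<and>
                        (\<forall>\<tau>. f \<tau> \<noteq> 0 \<longrightarrow> planar_pairing \<tau>)) \<sigma>"

definition QDD :: "'v set \<Rightarrow> nat \<Rightarrow> (nat \<Rightarrow> 'v) \<Rightarrow> nat set set \<Rightarrow> nat set set \<Rightarrow> int" where
  "QDD V1 n node \<sigma> \<rho> = sign_OE n \<sigma> * sign_BW V1 n node \<rho> * Pcoef \<sigma> \<rho>"

definition Ynode :: "'v set \<Rightarrow> ('v \<times> 'v) set \<Rightarrow> ('v \<times> 'v \<Rightarrow> real) \<Rightarrow> (nat \<Rightarrow> 'v) \<Rightarrow> nat \<Rightarrow> nat \<Rightarrow> real" where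
  "Ynode V E wt node i j = ZD E wt (V - {node i, node j}) / ZD E wt V"

definition Yprime :: "'v set \<Rightarrow> ('v \<times> 'v) set \<Rightarrow> ('v \<times> 'v \<Rightarrow> real) \<Rightarrow> (nat \<Rightarrow> 'v) \<Rightarrow> nat set set \<Rightarrow> real" where
  "Yprime V E wt node \<rho> = (-1) ^ ncross \<rho> *
     (\<Prod>B\<in>\<rho>. Ynode V E wt node (Min B) (Max B))"

end

(* A superposition of perfect matchings of G minus X and G minus Y, for disjoint node sets X and Y, is a
   double-dimer configuration with node set X + Y. Conversely such a configuration splits in 2^loops ways,
   provided that each of its paths joins a black and a white node on the same side of the partition (X, Y),
   or two nodes of equal colour on different sides, and in no way otherwise.
   As the paths cannot cross, this gives a Laplace expansion for Z(G - A), hence Z(G - A) / Z(G) is the sum over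
   the black-white pairings of A of sign times product of the Y's. Taking X + Y to be all nodes,
   the sums of Z_sigma^DD over the planar sigma that connect S to its complement become quadratic expressions in the Y's.
   On the other side, a pairing weighted by its crossing sign times the product of s_i - s_j (i < j paired),
   s the indicator of S, obeys the reduction rule by the Pluecker identity, so that the claimed
   right-hand sides satisfy the same linear system; for S the set of smaller ends of the pairs of sigma,
   this system is triangular. *)
theory Submission
  imports Defs
begin

section \<open>Splitting double-dimer configurations into matchings\<close>

text \<open>The obstacle is that connectivity is a property of a whole configuration, whereas signs
  are computed block by block. Two devices bridge this. In counting splits, paths and loops are
  never written as vertex sequences: degrees and reachability carry an induction that deletes edges.
  Crossing signs are rewritten as products of order signs over pairs of labels, so the sign produced
  by joining two label sets depends on the sets alone and not on how each is paired; hence one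
  function \<open>chi\<close> serves the Laplace expansion, the product over a cut and the reduction
  rule. Planarity of the embedding enters through noncrossing pairings, in which the ends of every
  pair occupy positions of opposite parity. \<open>Pcoef\<close> chooses a terminal combination. A
  linear functional that is invariant under each step has the same value on every terminal
  combination, so the choice is controlled once termination is known. The signs
  \<open>sign_OE\<close> and \<open>sign_BW\<close> come out of the same computation, applied to the
  odd-even colouring and to the given one. The test sets S have n elements, so that both sides of
  the resulting cut contain as many black as white labels.\<close>

abbreviation dd_conn :: "('v \<times> 'v) multiset \<Rightarrow> 'v \<Rightarrow> 'v \<Rightarrow> bool" where
  "dd_conn D x y \<equiv> (x, y) \<in> (dd_rel D)\<^sup>*"

lemma sym_dd_rel: "sym (dd_rel D)"
  unfolding dd_rel_def sym_def by auto

lemma dd_conn_sym: "dd_conn D x y \<Longrightarrow> dd_conn D y x"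
  using sym_rtrancl[OF sym_dd_rel] by (metis symD)

lemma dd_conn_sym_iff: "dd_conn D x y \<longleftrightarrow> dd_conn D y x"
  by (rule iffI; rule dd_conn_sym)

lemma ddeg_empty [simp]: "ddeg {#} x = 0"
  by (simp add: ddeg_def)

lemma ddeg_add_mset [simp]:
  "ddeg (add_mset e D) x = ddeg D x + (if x = fst e \<or> x = snd e then 1 else 0)"
  by (auto simp: ddeg_def)

lemma ddeg_union [simp]: "ddeg (D + D') x = ddeg D x + ddeg D' x"
  by (simp add: ddeg_def)

lemma ddeg_diff: "M \<subseteq># D \<Longrightarrow> ddeg (D - M) x = ddeg D x - ddeg M x"
  by (metis add_diff_cancel_left' ddeg_union subset_mset.add_diff_inverse)

lemma ddeg_eq_0_iff: "ddeg D x = 0 \<longleftrightarrow> (\<forall>e\<in>#D. x \<noteq> fst e \<and> x \<noteq> snd e)"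
  by (induction D) auto

lemma dd_rel_add_mset:
  "e = (t, u) \<or> e = (u, t) \<Longrightarrow> dd_rel (add_mset e D) = insert (t, u) (insert (u, t) (dd_rel D))"
  by (auto simp: dd_rel_def)

lemma dd_conn_isolated:
  assumes "ddeg D t = 0" "dd_conn D t x"
  shows "x = t"
  using assms(2)
proof (induction rule: rtrancl_induct)
  case (step y z)
  then have "(t, z) \<in> dd_rel D" by simp
  then show ?case using assms(1) by (auto simp: dd_rel_def ddeg_eq_0_iff)
qed simp

text \<open>Only \<open>u\<close> is adjacent to \<open>t\<close> after the edge is added, so a walk
  enters and leaves \<open>t\<close> through \<open>u\<close>, and connections among the other
  vertices are unaffected.\<close>

lemma dd_conn_pendant:
  assumes t: "ddeg D t = 0" and "t \<noteq> u" and e: "e = (t, u) \<or> e = (u, t)"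
  shows "dd_conn (add_mset e D) t y \<longleftrightarrow> y = t \<or> dd_conn D u y"
    and "dd_conn (add_mset e D) x t \<longleftrightarrow> x = t \<or> dd_conn D x u"
    and "x \<noteq> t \<Longrightarrow> y \<noteq> t \<Longrightarrow> dd_conn (add_mset e D) x y \<longleftrightarrow> dd_conn D x y"
proof -
  let ?R = "dd_rel D" and ?R' = "dd_rel (add_mset e D)"
  have R': "?R' = insert (t, u) (insert (u, t) ?R)" by (rule dd_rel_add_mset[OF e])
  have mono: "(x, y) \<in> ?R\<^sup>* \<Longrightarrow> (x, y) \<in> ?R'\<^sup>*" for x y
    using rtrancl_mono[of ?R ?R'] R' by blast
  have iso: "(t, v) \<notin> ?R" "(v, t) \<notin> ?R" for v
    using t by (auto simp: dd_rel_def ddeg_eq_0_iff)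
  \<comment> \<open>Collapsing \<open>t\<close> onto \<open>u\<close> sends every walk of the
    enlarged multiset to a walk of \<open>D\<close>.\<close>
  have fwd: "(x, if y = t then u else y) \<in> ?R\<^sup>*" if "(x, y) \<in> ?R'\<^sup>*" "x \<noteq> t" for x y
    using that(1)
  proof (induction rule: rtrancl_induct)
    case base then show ?case using that(2) by simp
  next
    case (step y z)
    from step.hyps(2) R' consider "y = t" "z = u" | "y = u" "z = t" | "(y, z) \<in> ?R" by auto
    then show ?case
    proof cases
      case 3
      then have "y \<noteq> t" "z \<noteq> t" using iso by auto
      then show ?thesis using step.IH 3 by (simp add: rtrancl.rtrancl_into_rtrancl)
    qed (use step.IH \<open>t \<noteq> u\<close> in auto)
  qed
  have tu: "(t, u) \<in> ?R'\<^sup>*" "(u, t) \<in> ?R'\<^sup>*" using R' by auto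
  show A: "(t, y) \<in> ?R'\<^sup>* \<longleftrightarrow> y = t \<or> (u, y) \<in> ?R\<^sup>*" for y
  proof
    assume "(t, y) \<in> ?R'\<^sup>*"
    then have "(u, y) \<in> ?R'\<^sup>*" using tu by (meson rtrancl_trans)
    then show "y = t \<or> (u, y) \<in> ?R\<^sup>*" using fwd[of u y] \<open>t \<noteq> u\<close> by (auto split: if_splits)
  next
    assume "y = t \<or> (u, y) \<in> ?R\<^sup>*"
    then show "(t, y) \<in> ?R'\<^sup>*" using tu mono by (meson rtrancl_trans rtrancl.rtrancl_refl)
  qed
  show "(x, t) \<in> ?R'\<^sup>* \<longleftrightarrow> x = t \<or> (x, u) \<in> ?R\<^sup>*"
    using A[of x] dd_conn_sym_iff by metis
  show "(x, y) \<in> ?R'\<^sup>* \<longleftrightarrow> (x, y) \<in> ?R\<^sup>*" if "x \<noteq> t" "y \<noteq> t"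
    using fwd[of x y] mono that by auto
qed

definition dd_comp :: "('v \<times> 'v) multiset \<Rightarrow> 'v \<Rightarrow> 'v set" where
  "dd_comp D x = {y. dd_conn D x y}"

text \<open>Loops described by degrees alone, without the ambient vertex set and node set of
  \<open>dd_loops\<close>, so that the notion survives the deletion of edges. The cardinality bound
  discards doubled edges and isolated vertices.\<close>

definition loop_comps :: "('v \<times> 'v) multiset \<Rightarrow> 'v set set" where
  "loop_comps D = {C. \<exists>x. C = dd_comp D x \<and> card C > 2 \<and> (\<forall>y\<in>C. ddeg D y \<noteq> 1)}"

lemma dd_comp_subset: "dd_comp D x \<subseteq> insert x (fst ` set_mset D \<union> snd ` set_mset D)"
proof
  fix y assume "y \<in> dd_comp D x"
  then have "dd_conn D x y" by (simp add: dd_comp_def)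
  then show "y \<in> insert x (fst ` set_mset D \<union> snd ` set_mset D)"
    by (cases rule: rtranclE) (force simp: dd_rel_def)+
qed

lemma finite_dd_comp: "finite (dd_comp D x)"
  by (rule finite_subset[OF dd_comp_subset]) auto

lemma dd_comp_self: "x \<in> dd_comp D x"
  by (simp add: dd_comp_def)

lemma dd_comp_isolated: "ddeg D x = 0 \<Longrightarrow> dd_comp D x = {x}"
  using dd_conn_isolated by (force simp: dd_comp_def)

lemma dd_comp_eq: "y \<in> dd_comp D x \<Longrightarrow> dd_comp D y = dd_comp D x"
  unfolding dd_comp_def using dd_conn_sym[of x y D] rtrancl_trans[of _ _ "dd_rel D"]
  by (intro Collect_cong iffI) blast+

lemma finite_loop_comps: "finite (loop_comps D)"
proof (rule finite_subset)
  show "loop_comps D \<subseteq> dd_comp D ` (fst ` set_mset D \<union> snd ` set_mset D)"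
  proof
    fix C assume "C \<in> loop_comps D"
    then obtain x where C: "C = dd_comp D x" "card C > 2" by (auto simp: loop_comps_def)
    have "ddeg D x \<noteq> 0"
    proof
      assume "ddeg D x = 0"
      then show False using C dd_comp_isolated[of D x] by simp
    qed
    then show "C \<in> dd_comp D ` (fst ` set_mset D \<union> snd ` set_mset D)"
      using C by (auto simp: ddeg_eq_0_iff)
  qed
qed auto

text \<open>The degree at \<open>v\<close> of the first matching, where \<open>X\<close> consists of the ends that it misses.\<close>
definition split_deg :: "('v \<times> 'v) multiset \<Rightarrow> 'v set \<Rightarrow> 'v \<Rightarrow> nat" where
  "split_deg D X v = (if ddeg D v = 2 then 1 else if v \<in> X then 0 else ddeg D v)"

text \<open>The possible first matchings; \<open>D - M\<close> is the second. Prescribing the degree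
  at every vertex encodes being a matching of the right vertex set, and of a doubled edge it lets
  \<open>M\<close> take just one copy.\<close>

definition splits :: "('v \<times> 'v) multiset \<Rightarrow> 'v set \<Rightarrow> ('v \<times> 'v) multiset set" where
  "splits D X = {M. M \<subseteq># D \<and> (\<forall>v. ddeg M v = split_deg D X v)}"

text \<open>Edges alternate between the two matchings along a path. A path joining opposite colours
  has an odd number of edges, so its end edges belong to the same matching and both ends are missed
  by the same one; with equal colours the number is even and the ends are missed by different
  matchings.\<close>

definition ends_compat :: "'v set \<Rightarrow> ('v \<times> 'v) multiset \<Rightarrow> 'v set \<Rightarrow> bool" where
  "ends_compat B D X \<longleftrightarrow> (\<forall>s t. s \<noteq> t \<and> ddeg D s = 1 \<and> ddeg D t = 1 \<and> dd_conn D s t \<longrightarrow>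
     ((s \<in> B \<longleftrightarrow> t \<notin> B) \<longleftrightarrow> (s \<in> X \<longleftrightarrow> t \<in> X)))"

lemma subset_mset_add_mset_notin:
  assumes "M \<subseteq># add_mset e D" "e \<notin># M"
  shows "M \<subseteq># D"
proof (rule mset_subset_eqI)
  fix a
  show "count M a \<le> count D a"
    using mset_subset_eq_count[OF assms(1), of a] assms(2) by (cases "a = e") (auto simp: not_in_iff)
qed

lemma subset_mset_add_msetI: "M \<subseteq># D \<Longrightarrow> M \<subseteq># add_mset e D"
  by (rule subset_mset.order_trans[of _ D]) auto

lemma splits_add_mset_in:
  assumes deg: "\<And>v. split_deg (add_mset e D) X v = split_deg D X' v + (if v = fst e \<or> v = snd e then 1 else 0)"
    and "\<And>M. M \<in> splits (add_mset e D) X \<Longrightarrow> e \<in># M"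
  shows "splits (add_mset e D) X = add_mset e ` splits D X'"
proof
  show "splits (add_mset e D) X \<subseteq> add_mset e ` splits D X'"
  proof
    fix M assume M: "M \<in> splits (add_mset e D) X"
    then obtain M' where M': "M = add_mset e M'" using assms(2) by (metis mset_add)
    have "ddeg M' v = split_deg D X' v" for v
    proof -
      have "ddeg M v = split_deg (add_mset e D) X v" using M by (simp add: splits_def)
      then show ?thesis unfolding M' deg by (simp split: if_splits)
    qed
    then show "M \<in> add_mset e ` splits D X'" using M M' by (auto simp: splits_def)
  qed
  show "add_mset e ` splits D X' \<subseteq> splits (add_mset e D) X"
    by (auto simp: splits_def deg)
qed

lemma splits_add_mset_out:
  assumes deg: "\<And>v. split_deg (add_mset e D) X v = split_deg D X' v"
    and out: "\<And>M. M \<in> splits (add_mset e D) X \<Longrightarrow> e \<notin># M"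
  shows "splits (add_mset e D) X = splits D X'"
proof
  show "splits (add_mset e D) X \<subseteq> splits D X'"
  proof
    fix M assume M: "M \<in> splits (add_mset e D) X"
    then have "M \<subseteq># D" using out[OF M] subset_mset_add_mset_notin[of M e D] by (simp add: splits_def)
    then show "M \<in> splits D X'" using M by (auto simp: splits_def deg)
  qed
  show "splits D X' \<subseteq> splits (add_mset e D) X"
    by (auto simp: splits_def deg intro: subset_mset_add_msetI)
qed

lemma pendant_in_split_iff:
  assumes "M \<subseteq># add_mset e D" "ddeg D t = 0" "t = fst e \<or> t = snd e"
  shows "e \<in># M \<longleftrightarrow> ddeg M t \<noteq> 0"
proof
  show "e \<in># M \<Longrightarrow> ddeg M t \<noteq> 0" using assms(3) by (auto simp: ddeg_eq_0_iff)
  assume "ddeg M t \<noteq> 0"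
  then obtain e' where e': "e' \<in># M" "t = fst e' \<or> t = snd e'" by (auto simp: ddeg_eq_0_iff)
  then have "e' \<in># add_mset e D" using assms(1) by (meson mset_subset_eqD)
  then show "e \<in># M" using e' assms(2) by (auto simp: ddeg_eq_0_iff)
qed

text \<open>With the edge present, the component of \<open>t\<close> contains the end
  \<open>t\<close>; without it, the component of \<open>u\<close> has the end \<open>u\<close> or is
  a single vertex. In neither case is it a loop, and all other components are untouched.\<close>

lemma loop_comps_pendant:
  assumes t: "ddeg D t = 0" and u: "ddeg D u \<le> 1" "t \<noteq> u" and e: "e = (t, u) \<or> e = (u, t)"
  shows "loop_comps (add_mset e D) = loop_comps D"
proof -
  let ?D = "add_mset e D"
  note conn = dd_conn_pendant[OF t \<open>t \<noteq> u\<close> e]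
  have tt: "dd_comp D t = {t}" by (rule dd_comp_isolated[OF t])
  have degt: "ddeg ?D t = 1" using t e u by auto
  have same: "dd_comp ?D x = dd_comp D x" "x \<noteq> t" "\<forall>y\<in>dd_comp D x. ddeg ?D y = ddeg D y"
    if "t \<notin> dd_comp ?D x" for x
  proof -
    show x: "x \<noteq> t" using that dd_comp_self by metis
    have "\<not> dd_conn D x u" using that x conn(2)[of x] by (auto simp: dd_comp_def)
    moreover have "\<not> dd_conn D x t" using x tt dd_conn_sym by (force simp: dd_comp_def)
    moreover have "\<not> dd_conn ?D x t" using that by (simp add: dd_comp_def)
    ultimately have "dd_conn ?D x y \<longleftrightarrow> dd_conn D x y" for y
      using conn(3)[OF x, of y] by (cases "y = t") auto
    then show "dd_comp ?D x = dd_comp D x" by (simp add: dd_comp_def)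
    show "\<forall>y\<in>dd_comp D x. ddeg ?D y = ddeg D y"
      using \<open>(x, u) \<notin> _\<close> \<open>\<not> dd_conn D x t\<close> e by (auto simp: dd_comp_def)
  qed
  show ?thesis
  proof (intro equalityI subsetI)
    fix C assume "C \<in> loop_comps ?D"
    then obtain x where C: "C = dd_comp ?D x" "card C > 2" "\<forall>y\<in>C. ddeg ?D y \<noteq> 1"
      by (auto simp: loop_comps_def)
    then have "t \<notin> dd_comp ?D x" using degt by metis
    then have "C = dd_comp D x" "\<forall>y\<in>C. ddeg D y \<noteq> 1" using same[of x] C by auto
    then show "C \<in> loop_comps D" using C(2) unfolding loop_comps_def by blast
  next
    fix C assume "C \<in> loop_comps D"
    then obtain x where C: "C = dd_comp D x" "card C > 2" "\<forall>y\<in>C. ddeg D y \<noteq> 1"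
      by (auto simp: loop_comps_def)
    have "x \<noteq> t" using C tt by auto
    moreover have "u \<notin> C"
    proof
      assume uC: "u \<in> C"
      then have "ddeg D u \<noteq> 1" using C(3) by blast
      then have "ddeg D u = 0" using u by simp
      then have "C = {u}" using dd_comp_isolated[of D u] dd_comp_eq[of u D x] uC C(1) by simp
      then show False using C(2) by simp
    qed
    ultimately have "t \<notin> dd_comp ?D x" using C(1) conn(2)[of x] by (auto simp: dd_comp_def)
    then have "C = dd_comp ?D x" "\<forall>y\<in>C. ddeg ?D y \<noteq> 1" using same[of x] C by auto
    then show "C \<in> loop_comps ?D" using C(2) unfolding loop_comps_def by blast
  qed
qed

definition bip_degree_le_2 :: "'v set \<Rightarrow> ('v \<times> 'v) multiset \<Rightarrow> bool" where
  "bip_degree_le_2 B D \<longleftrightarrow> (\<forall>e\<in>#D. fst e \<in> B \<and> snd e \<notin> B) \<and> (\<forall>x. ddeg D x \<le> 2)"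

text \<open>Both claims are proved together by deleting edges: the edge at an end (its neighbour then becomes an end or
  is isolated), or, if there are no ends, an edge of a loop. In the last case the uniqueness of partners shows that
  the loop stays connected.\<close>
lemma ends_and_splits:
  assumes "bip_degree_le_2 B D"
  shows "(\<forall>t. ddeg D t = 1 \<longrightarrow> (\<exists>!s. s \<noteq> t \<and> ddeg D s = 1 \<and> dd_conn D t s)) \<and>
    (\<forall>X. card (splits D X) = (if ends_compat B D X then 2 ^ card (loop_comps D) else 0))"
  using assms
proof (induction "size D" arbitrary: D rule: less_induct)
  case less
  note bip = less.prems
  consider "D = {#}" | (pendant) t where "ddeg D t = 1" | (cyc) "D \<noteq> {#}" "\<forall>t. ddeg D t \<noteq> 1" by blast
  then show ?case
  proof cases
    case 1
    have "loop_comps D = {}" using 1 by (auto simp: loop_comps_def dd_comp_def dd_rel_def)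
    moreover have "splits D X = {{#}}" for X using 1 by (auto simp: splits_def split_deg_def)
    ultimately show ?thesis using 1 by (auto simp: ends_compat_def)
  next
    case pendant
    then obtain e where "e \<in># D" and te: "t = fst e \<or> t = snd e" by (metis ddeg_eq_0_iff zero_neq_one)
    then obtain D' where D: "D = add_mset e D'" by (metis mset_add)
    define u where "u = (if t = fst e then snd e else fst e)"
    have eB: "fst e \<in> B" "snd e \<notin> B" using bip D by (auto simp: bip_degree_le_2_def)
    have e: "e = (t, u) \<or> e = (u, t)" and tu: "t \<noteq> u" and tuB: "t \<in> B \<longleftrightarrow> u \<notin> B"
      using te eB by (auto simp: u_def prod_eq_iff)
    have ends: "x = fst e \<or> x = snd e \<longleftrightarrow> x = t \<or> x = u" for x using e by auto
    have t0: "ddeg D' t = 0" using pendant D te by auto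
    have degle: "ddeg D x \<le> 2" for x using bip by (simp add: bip_degree_le_2_def)
    have deg: "ddeg D x = ddeg D' x + (if x = t \<or> x = u then 1 else 0)" for x
      by (simp add: D ends)
    have u1: "ddeg D' u \<le> 1" using degle[of u] deg[of u] by simp
    have bip': "bip_degree_le_2 B D'" using bip degle deg
      unfolding bip_degree_le_2_def D by (auto intro: le_trans[OF le_add1])
    note IH = less.hyps[OF _ bip', unfolded D, simplified]
    note conn = dd_conn_pendant[OF t0 tu e, folded D]
    have loops: "loop_comps D = loop_comps D'"
      unfolding D by (rule loop_comps_pendant[OF t0 u1 tu e])
    have eM: "e \<in># M \<longleftrightarrow> split_deg D X t \<noteq> 0" if "M \<in> splits D X" for M X
      using that pendant_in_split_iff[of M e D' t] t0 te by (auto simp: splits_def D)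
    have sdt: "split_deg D X t = (if t \<in> X then 0 else 1)" for X
      using pendant by (simp add: split_deg_def)
    have u': "ddeg D' u = 0 \<or> ddeg D' u = 1" using u1 by auto
    then show ?thesis
    proof
      \<comment> \<open>Here \<open>e\<close> alone is a complete path, and both of its ends
        disappear with it.\<close>
      assume u0: "ddeg D' u = 0"
      have uiso: "dd_conn D' u y \<longleftrightarrow> y = u" "dd_conn D' y u \<longleftrightarrow> y = u" for y
        using dd_conn_isolated[OF u0] dd_conn_sym by (metis rtrancl.rtrancl_refl)+
      have d1: "ddeg D x = 1 \<longleftrightarrow> ddeg D' x = 1 \<or> x = t \<or> x = u" for x
        using deg[of x] t0 u0 by auto
      have conn': "dd_conn D x y \<longleftrightarrow>
         (x \<in> {t, u} \<and> y \<in> {t, u}) \<or> (x \<notin> {t, u} \<and> y \<notin> {t, u} \<and> dd_conn D' x y)" for x y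
        using conn(1)[of y] conn(2)[of x] conn(3)[of x y] uiso[of y] uiso[of x] tu by auto
      have p1: "\<exists>!s. s \<noteq> a \<and> ddeg D s = 1 \<and> dd_conn D a s" if "ddeg D a = 1" for a
      proof (cases "a = t \<or> a = u")
        case True
        then have "s \<noteq> a \<and> ddeg D s = 1 \<and> dd_conn D a s \<longleftrightarrow> s = (if a = t then u else t)" for s
          using tu d1[of s] conn'[of a s] by auto
        then show ?thesis by simp
      next
        case False
        then have "\<exists>!s. s \<noteq> a \<and> ddeg D' s = 1 \<and> dd_conn D' a s" using IH d1 that by auto
        moreover have "s \<noteq> a \<and> ddeg D s = 1 \<and> dd_conn D a s \<longleftrightarrow> s \<noteq> a \<and> ddeg D' s = 1 \<and> dd_conn D' a s" for s
          using False t0 u0 d1[of s] conn'[of a s] by auto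
        ultimately show ?thesis by simp
      qed
      have p2: "card (splits D X) = (if ends_compat B D X then 2 ^ card (loop_comps D) else 0)" for X
      proof (cases "t \<in> X \<longleftrightarrow> u \<in> X")
        case False
        have "\<not> ends_compat B D X"
          using False tu tuB d1 conn' unfolding ends_compat_def by (intro notI) (drule spec[of _ t], drule spec[of _ u], simp)
        moreover have "splits D X = {}"
        proof -
          have "split_deg D X u = (if u \<in> X then 0 else 1)"
            using deg[of u] u0 by (simp add: split_deg_def)
          then have "e \<in># M \<longleftrightarrow> u \<notin> X" if "M \<in> splits D X" for M
            using that pendant_in_split_iff[of M e D' u] u0 ends by (auto simp: splits_def D)
          then show ?thesis using eM[of _ X] sdt[of X] False by auto
        qed
        ultimately show ?thesis by simp
      next
        case True
        have "ends_compat B D X \<longleftrightarrow> ends_compat B D' X"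
        proof -
          have "t \<in> {t, u}" "u \<in> {t, u}" "ddeg D' v = 1 \<Longrightarrow> v \<notin> {t, u}" for v using t0 u0 by auto
          then show ?thesis unfolding ends_compat_def conn' d1 using True tuB by (smt (verit) insertE singletonD)
        qed
        moreover have "card (splits D X) = card (splits D' X)"
        proof (cases "t \<in> X")
          case t: True
          have "splits D X = splits D' X"
            unfolding D
          proof (rule splits_add_mset_out)
            show "split_deg (add_mset e D') X v = split_deg D' X v" for v
              using deg[of v, unfolded D] t True t0 u0 unfolding split_deg_def by auto
            show "e \<notin># M" if "M \<in> splits (add_mset e D') X" for M
              using eM[of M X] sdt[of X] t that D by simp
          qed
          then show ?thesis by simp
        next
          case t: False
          have "splits D X = add_mset e ` splits D' X"
            unfolding D
          proof (rule splits_add_mset_in)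
            show "split_deg (add_mset e D') X v = split_deg D' X v + (if v = fst e \<or> v = snd e then 1 else 0)" for v
              unfolding ends using deg[of v, unfolded D] t True t0 u0 unfolding split_deg_def by auto
            show "e \<in># M" if "M \<in> splits (add_mset e D') X" for M
              using eM[of M X] sdt[of X] t that D by simp
          qed
          then show ?thesis by (simp add: card_image inj_on_def)
        qed
        ultimately show ?thesis using IH loops by simp
      qed
      show ?thesis using p1 p2 by blast
    next
      \<comment> \<open>Here the path is shortened by one edge, and \<open>u\<close> replaces
        \<open>t\<close> as its end, with the opposite colour.\<close>
      assume u0: "ddeg D' u = 1"
      have d1: "ddeg D x = 1 \<longleftrightarrow> (ddeg D' x = 1 \<and> x \<noteq> u) \<or> x = t" for x
        using deg[of x] t0 u0 tu by auto
      have p1: "\<exists>!s. s \<noteq> a \<and> ddeg D s = 1 \<and> dd_conn D a s" if a: "ddeg D a = 1" for a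
      proof (cases "a = t")
        case True
        have "\<exists>!s. s \<noteq> u \<and> ddeg D' s = 1 \<and> dd_conn D' u s" using IH u0 by auto
        moreover have "s \<noteq> a \<and> ddeg D s = 1 \<and> dd_conn D a s \<longleftrightarrow> s \<noteq> u \<and> ddeg D' s = 1 \<and> dd_conn D' u s" for s
          using True d1[of s] conn(1)[of s] t0 by auto
        ultimately show ?thesis by simp
      next
        case False
        then have a': "ddeg D' a = 1" "a \<noteq> u" using d1 a by auto
        have "\<exists>!s. s \<noteq> a \<and> ddeg D' s = 1 \<and> dd_conn D' a s" using IH a' by auto
        then obtain p where p: "p \<noteq> a" "ddeg D' p = 1" "dd_conn D' a p"
          and un: "\<And>s. s \<noteq> a \<Longrightarrow> ddeg D' s = 1 \<Longrightarrow> dd_conn D' a s \<Longrightarrow> s = p" by blast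
        have pt: "p \<noteq> t" using p t0 by auto
        have "s \<noteq> a \<and> ddeg D s = 1 \<and> dd_conn D a s \<longleftrightarrow> s = (if p = u then t else p)" for s
          using p pt un[of s] un[of u] u0 False a' d1[of s] conn(2)[of a] conn(3)[of a s] t0 by auto
        then show ?thesis by auto
      qed
      have p2: "card (splits D X) = (if ends_compat B D X then 2 ^ card (loop_comps D) else 0)" for X
      proof -
        \<comment> \<open>Alternation at \<open>u\<close>: if the first matching misses
          \<open>t\<close>, then \<open>e\<close> is in the second one and the first covers
          \<open>u\<close> by the remaining edge; if it uses \<open>e\<close>, its remainder misses
          \<open>u\<close>.\<close>
        define X' where "X' = (if t \<in> X then X - {u} else insert u X)"
        have X'u: "u \<in> X' \<longleftrightarrow> t \<notin> X" and X'o: "v \<noteq> u \<Longrightarrow> v \<in> X' \<longleftrightarrow> v \<in> X" for v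
          by (auto simp: X'_def)
        have "ends_compat B D X \<longleftrightarrow> ends_compat B D' X'"
        proof -
          have cD: "dd_conn D x y \<longleftrightarrow> dd_conn D' (if x = t then u else x) (if y = t then u else y)"
            if "x \<noteq> y" for x y
            using conn(1)[of y] conn(2)[of x] conn(3)[of x y] that tu by auto
          have "ddeg D' v = 1 \<Longrightarrow> v \<noteq> t" for v using t0 by auto
          then show ?thesis unfolding ends_compat_def d1 using cD X'u X'o tuB tu u0 by (smt (verit))
        qed
        moreover have "card (splits D X) = card (splits D' X')"
        proof (cases "t \<in> X")
          case t: True
          have "splits D X = splits D' X'"
            unfolding D
          proof (rule splits_add_mset_out)
            show "split_deg (add_mset e D') X v = split_deg D' X' v" for v
              using deg[of v, unfolded D] t t0 u0 tu unfolding split_deg_def X'_def by auto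
            show "e \<notin># M" if "M \<in> splits (add_mset e D') X" for M
              using eM[of M X] sdt[of X] t that D by simp
          qed
          then show ?thesis by simp
        next
          case t: False
          have "splits D X = add_mset e ` splits D' X'"
            unfolding D
          proof (rule splits_add_mset_in)
            show "split_deg (add_mset e D') X v = split_deg D' X' v + (if v = fst e \<or> v = snd e then 1 else 0)" for v
              unfolding ends using deg[of v, unfolded D] t t0 u0 tu unfolding split_deg_def X'_def by auto
            show "e \<in># M" if "M \<in> splits (add_mset e D') X" for M
              using eM[of M X] sdt[of X] t that D by simp
          qed
          then show ?thesis by (simp add: card_image inj_on_def)
        qed
        ultimately show ?thesis using IH loops by simp
      qed
      show ?thesis using p1 p2 by blast
    qed
  next
    case cyc
    then obtain e where "e \<in># D" by auto
    then obtain D' where D: "D = add_mset e D'" by (metis mset_add)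
    obtain x y where e: "e = (x, y)" by (cases e)
    have B: "x \<in> B" "y \<notin> B" using bip D e by (auto simp: bip_degree_le_2_def)
    then have xy: "x \<noteq> y" by auto
    have degle: "ddeg D v \<le> 2" for v using bip by (simp add: bip_degree_le_2_def)
    have deg: "ddeg D v = ddeg D' v + (if v = x \<or> v = y then 1 else 0)" for v by (simp add: D e)
    have d02: "ddeg D v = 0 \<or> ddeg D v = 2" for v using degle[of v] cyc(2)[rule_format, of v] by linarith
    have dxy: "ddeg D' x = 1" "ddeg D' y = 1" using deg[of x] deg[of y] d02[of x] d02[of y] by auto
    have compat: "ends_compat B D X" for X using cyc by (simp add: ends_compat_def)
    have bip': "bip_degree_le_2 B D'" using bip degle deg
      unfolding bip_degree_le_2_def D by (auto intro: le_trans[OF le_add1])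
    have p1: "\<forall>t. ddeg D t = 1 \<longrightarrow> (\<exists>!s. s \<noteq> t \<and> ddeg D s = 1 \<and> dd_conn D t s)" using cyc by auto
    have p2: "card (splits D X) = 2 ^ card (loop_comps D)" for X
    proof (cases "e \<in># D'")
      \<comment> \<open>A doubled edge is a component with two vertices and no loop. Each matching
        receives one copy, so neither the number of splits nor that of loops changes when both
        copies are removed.\<close>
      case True
      then obtain D'' where D': "D' = add_mset e D''" by (metis mset_add)
      have deg': "ddeg D' v = ddeg D'' v + (if v = x \<or> v = y then 1 else 0)" for v by (simp add: D' e)
      have xy0: "ddeg D'' x = 0" "ddeg D'' y = 0" using dxy deg'[of x] deg'[of y] by auto
      have no1: "ddeg D'' v \<noteq> 1" for v using d02[of v] deg[of v] deg'[of v] xy0 by (auto split: if_splits)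
      have bip'': "bip_degree_le_2 B D''" using bip' deg'
        unfolding bip_degree_le_2_def D' by (auto intro: le_trans[OF le_add1])
      have IH: "card (splits D'' X) = 2 ^ card (loop_comps D'')"
        using less.hyps[OF _ bip''] no1 by (simp add: D D' ends_compat_def)
      have "dd_rel D = dd_rel D'" by (auto simp: D D' dd_rel_def)
      then have comp: "dd_comp D = dd_comp D'" by (simp add: dd_comp_def fun_eq_iff)
      have c2: "card (dd_comp D' v) \<le> 2" if "v = x \<or> v = y" for v
      proof -
        have "dd_comp D' v \<subseteq> {x, y}"
          using that dd_conn_pendant(1)[OF xy0(1) xy, of e] dd_conn_pendant(1)[OF xy0(2) xy[symmetric], of e]
            dd_conn_isolated[OF xy0(1)] dd_conn_isolated[OF xy0(2)] e
          by (auto simp: dd_comp_def D')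
        then show ?thesis using xy card_mono[of "{x, y}" "dd_comp D' v"] by simp
      qed
      have "loop_comps D = loop_comps D''"
      proof -
        have "loop_comps D' = loop_comps D''"
          unfolding D' using loop_comps_pendant[OF xy0(1) _ xy, of e] xy0 e by simp
        moreover have "loop_comps D = loop_comps D'"
        proof -
          have "(\<forall>w\<in>dd_comp D' v. ddeg D w \<noteq> 1) \<longleftrightarrow> (\<forall>w\<in>dd_comp D' v. ddeg D' w \<noteq> 1)" if "card (dd_comp D' v) > 2" for v
          proof -
            have "x \<notin> dd_comp D' v" "y \<notin> dd_comp D' v"
              using that c2[of x] c2[of y] dd_comp_eq[of _ D' v] by (metis linorder_not_le)+
            then show ?thesis using deg by (intro ball_cong) auto
          qed
          then show ?thesis unfolding loop_comps_def comp by auto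
        qed
        ultimately show ?thesis by simp
      qed
      moreover have "splits D X = add_mset e ` splits D'' X"
      proof
        show "add_mset e ` splits D'' X \<subseteq> splits D X"
        proof
          fix M assume "M \<in> add_mset e ` splits D'' X"
          then obtain M' where M: "M = add_mset e M'" "M' \<subseteq># D''" "\<And>v. ddeg M' v = split_deg D'' X v"
            by (auto simp: splits_def)
          have "M \<subseteq># D" using M(2) by (simp add: M(1) D D' subset_mset_add_msetI)
          moreover have "ddeg M v = split_deg D X v" for v
            using M(3)[of v] deg[of v] deg'[of v] xy0 by (auto simp: M(1) e split_deg_def)
          ultimately show "M \<in> splits D X" by (simp add: splits_def)
        qed
        show "splits D X \<subseteq> add_mset e ` splits D'' X"
        proof
          fix M assume M: "M \<in> splits D X"
          have Mx: "ddeg M x = 1" using M d02[of x] deg[of x] by (simp add: splits_def split_deg_def)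
          then obtain e' where e': "e' \<in># M" "x = fst e' \<or> x = snd e'" by (metis ddeg_eq_0_iff zero_neq_one)
          have "e' \<in># D" using M e' by (auto simp: splits_def dest: mset_subset_eqD)
          then have "e' = e" using e' xy0(1) by (auto simp: D D' ddeg_eq_0_iff)
          then obtain M' where M': "M = add_mset e M'" using e' by (metis mset_add)
          have "e \<notin># M'" using Mx e by (auto simp: M' ddeg_eq_0_iff)
          moreover have "M' \<subseteq># add_mset e D''" using M by (simp add: splits_def M' D D')
          ultimately have "M' \<subseteq># D''" using subset_mset_add_mset_notin by metis
          moreover have "ddeg M' v = split_deg D'' X v" for v
          proof -
            have "ddeg M v = split_deg D X v" using M by (simp add: splits_def)
            then show ?thesis using deg[of v] deg'[of v] xy0 by (auto simp: M' e split_deg_def split: if_splits)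
          qed
          ultimately show "M \<in> add_mset e ` splits D'' X" by (auto simp: splits_def M')
        qed
      qed
      ultimately show ?thesis using IH by (simp add: card_image inj_on_def)
    next
      \<comment> \<open>Deleting \<open>e\<close> opens a cycle into a path whose ends are
        \<open>x\<close> and \<open>y\<close>.\<close>
      case False
      note IH = less.hyps[OF _ bip', unfolded D, simplified]
      have d1: "ddeg D' v = 1 \<longleftrightarrow> v = x \<or> v = y" for v using d02[of v] deg[of v] dxy by (auto split: if_splits)
      have "\<exists>!s. s \<noteq> x \<and> ddeg D' s = 1 \<and> dd_conn D' x s" using IH dxy by auto
      then obtain s where s: "s \<noteq> x" "ddeg D' s = 1" "dd_conn D' x s" by blast
      then have conn: "dd_conn D' x y" using d1 by auto
      have Req: "(dd_rel D)\<^sup>* = (dd_rel D')\<^sup>*"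
      proof
        have "dd_rel D = insert (x, y) (insert (y, x) (dd_rel D'))"
          unfolding D by (rule dd_rel_add_mset) (simp add: e)
        then have "dd_rel D \<subseteq> (dd_rel D')\<^sup>*" using conn dd_conn_sym[OF conn] by auto
        then show "(dd_rel D)\<^sup>* \<subseteq> (dd_rel D')\<^sup>*" by (rule rtrancl_subset_rtrancl)
        show "(dd_rel D')\<^sup>* \<subseteq> (dd_rel D)\<^sup>*" by (rule rtrancl_mono) (auto simp: D dd_rel_def)
      qed
      then have comp: "dd_comp D = dd_comp D'" by (simp add: dd_comp_def fun_eq_iff)
      have loops: "loop_comps D = insert (dd_comp D' x) (loop_comps D')" "dd_comp D' x \<notin> loop_comps D'"
      proof -
        show "dd_comp D' x \<notin> loop_comps D'" using dxy dd_comp_self by (force simp: loop_comps_def)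
        \<comment> \<open>An edge is determined by its black and its white vertex, so the other edge
          at \<open>x\<close> leads to a third vertex.\<close>
        have big: "card (dd_comp D' x) > 2"
        proof -
          obtain e' where e': "e' \<in># D'" "x = fst e' \<or> x = snd e'" using dxy(1) by (metis ddeg_eq_0_iff zero_neq_one)
          then have "x = fst e'" "snd e' \<notin> B" using bip' B by (auto simp: bip_degree_le_2_def)
          moreover have "e' \<noteq> e" using e' False by blast
          ultimately have z: "snd e' \<noteq> y" "snd e' \<noteq> x" using e B by (cases e'; auto)+
          have "(x, snd e') \<in> dd_rel D'" using e'(1) \<open>x = fst e'\<close> by (auto simp: dd_rel_def)
          then have "{x, y, snd e'} \<subseteq> dd_comp D' x" using conn by (auto simp: dd_comp_def)
          then have "card {x, y, snd e'} \<le> card (dd_comp D' x)" by (rule card_mono[OF finite_dd_comp])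
          then show ?thesis using z xy by (simp add: card_insert_if)
        qed
        show "loop_comps D = insert (dd_comp D' x) (loop_comps D')"
        proof (intro equalityI subsetI)
          fix C assume "C \<in> loop_comps D"
          then obtain v where C: "C = dd_comp D' v" "card C > 2" by (auto simp: loop_comps_def comp)
          show "C \<in> insert (dd_comp D' x) (loop_comps D')"
          proof (cases "x \<in> C \<or> y \<in> C")
            case True
            then have "C = dd_comp D' x" using C dd_comp_eq conn by (metis dd_comp_def mem_Collect_eq)
            then show ?thesis by simp
          next
            case False
            then have "\<forall>w\<in>C. ddeg D' w \<noteq> 1" using d1 by auto
            then show ?thesis using C by (auto simp: loop_comps_def)
          qed
        next
          fix C assume "C \<in> insert (dd_comp D' x) (loop_comps D')"
          then show "C \<in> loop_comps D" using big cyc(2) by (auto simp: loop_comps_def comp)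
        qed
      qed
      \<comment> \<open>The two ways to treat a loop: either the first matching contains
        \<open>e\<close> and its remainder misses both \<open>x\<close> and \<open>y\<close>, or it
        covers both inside \<open>D'\<close>. As \<open>x\<close> and \<open>y\<close> have opposite
        colours, both end sets are compatible, and the count doubles.\<close>
      have "splits D X = add_mset e ` splits D' {x, y} \<union> splits D' {}"
      proof (intro equalityI subsetI)
        fix M assume M: "M \<in> splits D X"
        then have Mdeg: "ddeg M v = split_deg D X v" for v by (simp add: splits_def)
        show "M \<in> add_mset e ` splits D' {x, y} \<union> splits D' {}"
        proof (cases "e \<in># M")
          case True
          then obtain M' where M': "M = add_mset e M'" by (metis mset_add)
          have "ddeg M' v = split_deg D' {x, y} v" for v
            using Mdeg[of v] deg[of v] dxy d02[of v] by (auto simp: M' e split_deg_def split: if_splits)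
          then have "M' \<in> splits D' {x, y}" using M by (simp add: splits_def M' D)
          then show ?thesis using M' by simp
        next
          case eM: False
          then have "M \<subseteq># D'" using M subset_mset_add_mset_notin[of M e D'] by (simp add: splits_def D)
          moreover have "ddeg M v = split_deg D' {} v" for v
            using Mdeg[of v] deg[of v] dxy d02[of v] by (auto simp: split_deg_def)
          ultimately show ?thesis by (simp add: splits_def)
        qed
      next
        fix M assume "M \<in> add_mset e ` splits D' {x, y} \<union> splits D' {}"
        then consider M' where "M = add_mset e M'" "M' \<in> splits D' {x, y}" | "M \<in> splits D' {}" by auto
        then show "M \<in> splits D X"
        proof cases
          case 1
          have "ddeg M v = split_deg D X v" for v
          proof -
            have "ddeg M' v = split_deg D' {x, y} v" using 1 by (simp add: splits_def)
            then show ?thesis using deg[of v] dxy d02[of v] by (auto simp: 1 e split_deg_def split: if_splits)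
          qed
          then show ?thesis using 1 by (simp add: splits_def D)
        next
          case 2
          have "ddeg M v = split_deg D X v" for v
          proof -
            have "ddeg M v = split_deg D' {} v" using 2 by (simp add: splits_def)
            then show ?thesis using deg[of v] dxy d02[of v] by (auto simp: split_deg_def split: if_splits)
          qed
          then show ?thesis using 2 by (auto simp: splits_def D intro: subset_mset_add_msetI)
        qed
      qed
      moreover have "add_mset e ` splits D' {x, y} \<inter> splits D' {} = {}"
        using False by (auto simp: splits_def dest: mset_subset_eqD)
      moreover have c: "ends_compat B D' {}" "ends_compat B D' {x, y}"
        using d1 B by (auto simp: ends_compat_def)
      moreover have fin: "finite (splits D' {})" "finite (splits D' {x, y})"
        using IH c by (auto intro!: card_ge_0_finite)
      ultimately have "card (splits D X) = card (splits D' {x, y}) + card (splits D' {})"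
        by (simp add: card_Un_disjoint card_image inj_on_def)
      also have "\<dots> = 2 ^ Suc (card (loop_comps D'))" using IH c by simp
      also have "Suc (card (loop_comps D')) = card (loop_comps D)"
        unfolding loops(1) using card_insert_disjoint[OF finite_loop_comps loops(2)] by simp
      finally show ?thesis .
    qed
    show ?thesis using p1 p2 compat by simp
  qed
qed

section \<open>Matchings and double-dimer configurations as multisets with prescribed
  degrees\<close>

lemma bip_graph_edges:
  assumes "bip_graph V V1 E"
  shows "finite E" "E \<subseteq> V \<times> V"
proof -
  show "E \<subseteq> V \<times> V" using assms by (auto simp: bip_graph_def)
  moreover have "finite (V \<times> V)" using assms by (simp add: bip_graph_def)
  ultimately show "finite E" by (rule finite_subset)
qed

lemma count_le_ddeg: "count D e \<le> ddeg D (fst e)"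
  by (induction D) auto

lemma ddeg_mset_set: "finite M \<Longrightarrow> ddeg (mset_set M) v = card {e \<in> M. fst e = v \<or> snd e = v}"
  by (simp add: ddeg_def filter_mset_mset_set)

text \<open>Puts matchings into the same language of degrees as \<open>splits\<close> and
  \<open>dd_config\<close>.\<close>

lemma perfect_matching_iff_ddeg:
  assumes "finite M" "M \<subseteq> E"
  shows "perfect_matching E W M \<longleftrightarrow> (\<forall>v. ddeg (mset_set M) v = (if v \<in> W then 1 else 0))"
proof -
  have ex1: "(\<exists>!e. e \<in> M \<and> (v = fst e \<or> v = snd e)) \<longleftrightarrow> ddeg (mset_set M) v = 1" for v
  proof -
    have "(\<exists>!e. e \<in> A) \<longleftrightarrow> card A = 1" for A :: "('a \<times> 'a) set"
      unfolding One_nat_def card_1_singleton_iff by blast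
    from this[of "{e \<in> M. fst e = v \<or> snd e = v}"] show ?thesis
      unfolding ddeg_mset_set[OF assms(1)] by (simp add: eq_commute[of v])
  qed
  have no: "(\<forall>e\<in>M. fst e \<in> W \<and> snd e \<in> W) \<longleftrightarrow> (\<forall>v. v \<notin> W \<longrightarrow> ddeg (mset_set M) v = 0)"
    using assms(1) by (auto simp: ddeg_eq_0_iff)
  show ?thesis unfolding perfect_matching_def ex1 no using assms(2) by auto
qed

lemma finite_dd_configs:
  assumes "finite E" "E \<subseteq> V \<times> V"
  shows "finite {D. dd_config V E T D}"
proof (rule finite_subset)
  \<comment> \<open>Degrees are at most 2, hence so are multiplicities, and two copies of
    \<open>E\<close> contain every configuration.\<close>
  show "{D. dd_config V E T D} \<subseteq> {D. D \<subseteq># mset_set E + mset_set E}"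
  proof safe
    fix D assume D: "dd_config V E T D"
    show "D \<subseteq># mset_set E + mset_set E"
    proof (rule mset_subset_eqI)
      fix e
      show "count D e \<le> count (mset_set E + mset_set E) e"
      proof (cases "e \<in># D")
        case True
        then have "e \<in> E" "fst e \<in> V" using D assms by (auto simp: dd_config_def)
        then have "count D e \<le> 2" using count_le_ddeg[of D e] D by (auto simp: dd_config_def split: if_splits)
        then show ?thesis using \<open>e \<in> E\<close> assms(1) by simp
      qed (simp add: not_in_iff)
    qed
  qed
  have "finite {D. D \<subseteq># M}" for M :: "('v \<times> 'v) multiset"
  proof (induction M)
    case (add e M)
    have "{D. D \<subseteq># add_mset e M} \<subseteq> {D. D \<subseteq># M} \<union> add_mset e ` {D. D \<subseteq># M}"
    proof
      fix D assume D: "D \<in> {D. D \<subseteq># add_mset e M}"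
      show "D \<in> {D. D \<subseteq># M} \<union> add_mset e ` {D. D \<subseteq># M}"
      proof (cases "e \<in># D")
        case True
        then obtain D' where "D = add_mset e D'" by (metis mset_add)
        then show ?thesis using D by auto
      next
        case False
        then show ?thesis using D subset_mset_add_mset_notin by auto
      qed
    qed
    then show ?case using add finite_subset by auto
  qed simp
  then show "finite {D. D \<subseteq># mset_set E + mset_set E}" .
qed

lemma dd_config_ddeg:
  assumes "bip_graph V V1 E" "T \<subseteq> V" "dd_config V E T D"
  shows "ddeg D v = (if v \<in> T then 1 else if v \<in> V then 2 else 0)"
proof (cases "v \<in> V")
  case False
  then have "ddeg D v = 0" using assms by (fastforce simp: bip_graph_def dd_config_def ddeg_eq_0_iff)
  then show ?thesis using False assms by auto
qed (use assms in \<open>auto simp: dd_config_def\<close>)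

lemma dd_config_bip_degree_le_2:
  assumes "bip_graph V V1 E" "T \<subseteq> V" "dd_config V E T D"
  shows "bip_degree_le_2 V1 D"
  using assms(1,3) dd_config_ddeg[OF assms] unfolding bip_degree_le_2_def bip_graph_def dd_config_def by auto

text \<open>In a configuration the vertices of degree 1 are exactly the nodes, and vertices outside
  \<open>V\<close> are isolated, so the degree description of loops agrees with the official
  one.\<close>

lemma dd_loops_eq:
  assumes "bip_graph V V1 E" "T \<subseteq> V" "dd_config V E T D"
  shows "dd_loops V T D = card (loop_comps D)"
proof -
  note deg = dd_config_ddeg[OF assms]
  have "(\<exists>x\<in>V. C = dd_comp D x \<and> C \<inter> T = {} \<and> card C > 2) \<longleftrightarrow> C \<in> loop_comps D" for C
  proof
    assume "\<exists>x\<in>V. C = dd_comp D x \<and> C \<inter> T = {} \<and> card C > 2"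
    then show "C \<in> loop_comps D" using deg by (auto simp: loop_comps_def)
  next
    assume "C \<in> loop_comps D"
    then obtain x where C: "C = dd_comp D x" "card C > 2" "\<forall>y\<in>C. ddeg D y \<noteq> 1" by (auto simp: loop_comps_def)
    have "ddeg D x \<noteq> 0"
    proof
      assume "ddeg D x = 0"
      then show False using C dd_comp_isolated[of D x] by simp
    qed
    then have "x \<in> V" using deg[of x] assms(2) by (auto split: if_splits)
    moreover have "C \<inter> T = {}" using C(3) deg by auto
    ultimately show "\<exists>x\<in>V. C = dd_comp D x \<and> C \<inter> T = {} \<and> card C > 2" using C by auto
  qed
  then show ?thesis unfolding dd_loops_def dd_comp_def by simp
qed

definition dd_weight :: "('v \<times> 'v \<Rightarrow> real) \<Rightarrow> ('v \<times> 'v) multiset \<Rightarrow> real" where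
  "dd_weight wt D = (\<Prod>e\<in>set_mset D. wt e ^ count D e)"

lemma dd_weight_eq: "dd_weight wt D = prod_mset (image_mset wt D)"
  by (simp add: dd_weight_def image_prod_mset_multiplicity)

text \<open>The first matching determines the second as its complement in \<open>D\<close>.
  Conversely both parts of a split have degrees at most 1, so they contain no repeated edge and are
  multisets of genuine matchings.\<close>

lemma superposition_fiber_card:
  assumes bip: "bip_graph V V1 E" and T: "T \<subseteq> V" "X \<subseteq> T" and D: "dd_config V E T D"
  shows "card {(M1, M2). perfect_matching E (V - X) M1 \<and> perfect_matching E (V - (T - X)) M2 \<and>
    mset_set M1 + mset_set M2 = D} = card (splits D X)"
proof (rule bij_betw_same_card)
  note deg = dd_config_ddeg[OF bip T(1) D]
  have finE: "finite E" by (rule bip_graph_edges(1)[OF bip])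
  have pm: "finite M" "M \<subseteq> E" "ddeg (mset_set M) v = (if v \<in> W then 1 else 0)" if "perfect_matching E W M" for M W v
  proof -
    show "M \<subseteq> E" "finite M" using that finE by (auto simp: perfect_matching_def intro: finite_subset)
    then show "ddeg (mset_set M) v = (if v \<in> W then 1 else 0)" using that perfect_matching_iff_ddeg by blast
  qed
  have sd: "split_deg D X v = (if v \<in> V - X then 1 else 0)" for v
    using deg[of v] T by (auto simp: split_deg_def)
  have simple: "mset_set (set_mset M) = M" "perfect_matching E W (set_mset M)"
    if "\<And>v. ddeg M v = (if v \<in> W then 1 else 0)" "M \<subseteq># D" for M W
  proof -
    have "count M e \<le> 1" for e using count_le_ddeg[of M e] that(1)[of "fst e"] by (auto split: if_splits)
    then have "count M e = (if e \<in># M then 1 else 0)" for e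
      by (metis count_eq_zero_iff le_antisym less_one not_le_imp_less)
    then show *: "mset_set (set_mset M) = M" by (intro multiset_eqI) (simp add: count_mset_set')
    have "set_mset M \<subseteq> E" using that(2) D by (auto simp: dd_config_def dest: mset_subset_eqD)
    then show "perfect_matching E W (set_mset M)"
      using perfect_matching_iff_ddeg[of "set_mset M" E W] * that(1) by simp
  qed
  let ?F = "{(M1, M2). perfect_matching E (V - X) M1 \<and> perfect_matching E (V - (T - X)) M2 \<and> mset_set M1 + mset_set M2 = D}"
  show "bij_betw (\<lambda>(M1, M2). mset_set M1) ?F (splits D X)"
    unfolding bij_betw_def
  proof
    show "inj_on (\<lambda>(M1, M2). mset_set M1) ?F"
    proof (rule inj_onI)
      fix p q assume p: "p \<in> ?F" and q: "q \<in> ?F" and eq: "(case p of (M1, M2) \<Rightarrow> mset_set M1) = (case q of (M1, M2) \<Rightarrow> mset_set M1)"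
      obtain M1 M2 N1 N2 where pq: "p = (M1, M2)" "q = (N1, N2)" by (cases p; cases q)
      have "mset_set M1 = mset_set N1" using eq pq by simp
      moreover have "mset_set M1 + mset_set M2 = mset_set N1 + mset_set N2" using p q pq by simp
      ultimately have "mset_set M1 = mset_set N1" "mset_set M2 = mset_set N2" by simp_all
      moreover have "finite M1" "finite M2" "finite N1" "finite N2" using p q pq pm(1) by auto
      ultimately show "p = q" using pq by (simp add: mset_set_eq_iff)
    qed
    show "(\<lambda>(M1, M2). mset_set M1) ` ?F = splits D X"
    proof (intro equalityI subsetI)
      fix M assume "M \<in> (\<lambda>(M1, M2). mset_set M1) ` ?F"
      then obtain M1 M2 where M: "M = mset_set M1" "perfect_matching E (V - X) M1" "mset_set M1 + mset_set M2 = D" by auto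
      then have "M \<subseteq># D" by auto
      then show "M \<in> splits D X" using pm(3)[OF M(2)] M(1) by (simp add: splits_def sd)
    next
      fix M assume "M \<in> splits D X"
      then have M: "M \<subseteq># D" "\<And>v. ddeg M v = (if v \<in> V - X then 1 else 0)" by (auto simp: splits_def sd)
      have M': "D - M \<subseteq># D" "\<And>v. ddeg (D - M) v = (if v \<in> V - (T - X) then 1 else 0)"
        using M deg T by (auto simp: ddeg_diff)
      have "(set_mset M, set_mset (D - M)) \<in> ?F"
        using simple[OF M(2,1)] simple[OF M'(2,1)] M(1) by simp
      then show "M \<in> (\<lambda>(M1, M2). mset_set M1) ` ?F"
        using simple(1)[OF M(2,1)] by (intro image_eqI[of _ _ "(set_mset M, set_mset (D - M))"]) simp_all
    qed
  qed
qed

text \<open>Group the pairs of matchings by their multiset sum: weights multiply, and the size of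
  each fibre is the number of splits given by \<open>ends_and_splits\<close>. The nodes in
  \<open>T\<close> have degree 1 since each of them is missed by exactly one of the two
  matchings.\<close>

lemma superposition:
  assumes bip: "bip_graph V V1 E" and T: "T \<subseteq> V" "X \<subseteq> T"
  shows "ZD E wt (V - X) * ZD E wt (V - (T - X)) =
    (\<Sum>D\<in>{D. dd_config V E T D}. dd_weight wt D * 2 ^ dd_loops V T D * (if ends_compat V1 D X then 1 else 0))"
proof -
  let ?P = "\<lambda>W. {M. perfect_matching E W M}" and ?S = "{D. dd_config V E T D}"
  let ?X = "V - X" and ?Y = "V - (T - X)"
  note finE = bip_graph_edges[OF bip]
  have sub: "M \<subseteq> E" "finite M" if "perfect_matching E W M" for M W
    using that finE(1) by (auto simp: perfect_matching_def intro: finite_subset)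
  have finP: "finite (?P W)" for W
    by (rule finite_subset[of _ "Pow E"]) (use sub finE in auto)
  let ?f = "\<lambda>(M1, M2). mset_set M1 + mset_set M2" and ?h = "\<lambda>(M1, M2). (\<Prod>e\<in>M1. wt e) * (\<Prod>e\<in>M2. wt e)"
  have range: "?f ` (?P ?X \<times> ?P ?Y) \<subseteq> ?S"
  proof clarify
    fix M1 M2 assume M: "perfect_matching E ?X M1" "perfect_matching E ?Y M2"
    have d: "ddeg (mset_set M1) v = (if v \<in> ?X then 1 else 0)" "ddeg (mset_set M2) v = (if v \<in> ?Y then 1 else 0)" for v
      using M perfect_matching_iff_ddeg[OF sub(2,1)[OF M(1)]] perfect_matching_iff_ddeg[OF sub(2,1)[OF M(2)]]
      by simp_all
    show "dd_config V E T (mset_set M1 + mset_set M2)"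
      using T M sub[OF M(1)] sub[OF M(2)] by (auto simp: dd_config_def d)
  qed
  have h: "?h p = dd_weight wt (?f p)" if p: "p \<in> ?P ?X \<times> ?P ?Y" for p
    using p sub by (auto simp: dd_weight_eq prod_unfold_prod_mset)
  have "ZD E wt ?X * ZD E wt ?Y = (\<Sum>p\<in>?P ?X \<times> ?P ?Y. ?h p)"
    by (simp add: ZD_def sum_product sum.cartesian_product case_prod_beta)
  also have "\<dots> = (\<Sum>D\<in>?S. \<Sum>p\<in>{p \<in> ?P ?X \<times> ?P ?Y. ?f p = D}. ?h p)"
    by (rule sum.group[symmetric]) (use finP finite_dd_configs[OF finE] range in auto)
  also have "\<dots> = (\<Sum>D\<in>?S. dd_weight wt D * 2 ^ dd_loops V T D * (if ends_compat V1 D X then 1 else 0))"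
  proof (rule sum.cong[OF refl])
    fix D assume "D \<in> ?S"
    then have D: "dd_config V E T D" by simp
    let ?F = "{p \<in> ?P ?X \<times> ?P ?Y. ?f p = D}"
    have "?F = {(M1, M2). perfect_matching E ?X M1 \<and> perfect_matching E ?Y M2 \<and> mset_set M1 + mset_set M2 = D}"
      by auto
    then have c: "card ?F = (if ends_compat V1 D X then 2 ^ dd_loops V T D else 0)"
      using superposition_fiber_card[OF bip T D] ends_and_splits[OF dd_config_bip_degree_le_2[OF bip T(1) D]]
        dd_loops_eq[OF bip T(1) D] by simp
    have "(\<Sum>p\<in>?F. ?h p) = (\<Sum>p\<in>?F. dd_weight wt D)"
      using h by (intro sum.cong) auto
    also have "\<dots> = of_nat (card ?F) * dd_weight wt D" by simp
    finally show "(\<Sum>p\<in>?F. ?h p) = dd_weight wt D * 2 ^ dd_loops V T D * (if ends_compat V1 D X then 1 else 0)"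
      unfolding c by simp
  qed
  finally show ?thesis .
qed

section \<open>Disjoint components do not cross\<close>

lemma cot_half_less:
  fixes x y :: real
  assumes "0 < x" "x < y" "y < 2 * pi"
  shows "- sin x / (1 - cos x) < - sin y / (1 - cos y)"
proof -
  have half: "- sin t / (1 - cos t) = - (cos (t/2) / sin (t/2))" "sin (t/2) > 0" if "0 < t" "t < 2*pi" for t
  proof -
    show s: "sin (t/2) > 0" using that by (intro sin_gt_zero) auto
    have "sin t = 2 * sin (t/2) * cos (t/2)" "cos t = 1 - 2 * (sin (t/2))^2"
      using sin_double[of "t/2"] cos_double_sin[of "t/2"] by auto
    then show "- sin t / (1 - cos t) = - (cos (t/2) / sin (t/2))"
      using s by (simp add: power2_eq_square)
  qed
  have "sin (y/2 - x/2) > 0" using assms by (intro sin_gt_zero) auto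
  then have "cos (x/2) * sin (y/2) - cos (y/2) * sin (x/2) > 0" by (simp add: sin_diff mult.commute)
  then have "cos (y/2) / sin (y/2) < cos (x/2) / sin (x/2)"
    using half(2)[of x] half(2)[of y] assms by (simp add: field_simps)
  then show ?thesis using half(1)[of x] half(1)[of y] assms by simp
qed

text \<open>The Cayley transform \<open>\<i> * (1 + z) / (1 - z)\<close> in real coordinates, from
  the disk to the upper half-plane, with 1 sent to infinity. At the boundary point of angle
  \<open>t\<close> the first coordinate is \<open>- cot (t / 2)\<close>, which increases with
  \<open>t\<close>. The type \<open>real^2\<close> is that of
  \<open>fashoda_interlace\<close>.\<close>

definition cayley :: "complex \<Rightarrow> real^2" where
  "cayley z = vector [- 2 * Im z / (cmod (1 - z))\<^sup>2, (1 - (cmod z)\<^sup>2) / (cmod (1 - z))\<^sup>2]"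

lemma cayley_complex:
  assumes "z \<noteq> 1"
  shows "Complex (cayley z $ 1) (cayley z $ 2) = \<i> * (1 + z) / (1 - z)"
proof -
  have "\<i> * (1 + z) / (1 - z) = \<i> * (1 + z) * cnj (1 - z) / (complex_of_real ((cmod (1 - z))\<^sup>2))"
    by (metis complex_div_cnj of_real_power)
  also have "\<i> * (1 + z) * cnj (1 - z) = Complex (- 2 * Im z) (1 - (cmod z)\<^sup>2)"
    unfolding complex_eq_iff cmod_power2 by (simp add: algebra_simps power2_eq_square)
  also have "\<dots> / (complex_of_real ((cmod (1 - z))\<^sup>2)) = Complex (cayley z $ 1) (cayley z $ 2)"
    by (simp add: cayley_def complex_eq_iff Re_divide_of_real Im_divide_of_real del: of_real_power)
  finally show ?thesis by simp
qed

lemma cayley_inj: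
  assumes "z \<noteq> 1" "w \<noteq> 1" "cayley z = cayley w"
  shows "z = w"
proof -
  have "\<i> * (1 + z) / (1 - z) = \<i> * (1 + w) / (1 - w)"
    using cayley_complex[of z] cayley_complex[of w] assms by simp
  then have "(1 + z) * (1 - w) = (1 + w) * (1 - z)"
    using assms by (simp add: frac_eq_eq)
  then show ?thesis by (simp add: algebra_simps)
qed

lemma continuous_on_cayley: "continuous_on (- {1}) cayley"
proof -
  have "cayley = (\<lambda>z. (- 2 * Im z / (cmod (1 - z))\<^sup>2) *\<^sub>R axis 1 1 + ((1 - (cmod z)\<^sup>2) / (cmod (1 - z))\<^sup>2) *\<^sub>R axis 2 1)"
    by (rule ext) (simp add: cayley_def vec_eq_iff forall_2 axis_def)
  then show ?thesis by (rule ssubst) (auto intro!: continuous_intros)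
qed

lemma cayley_cis:
  assumes "0 < t" "t < 2 * pi"
  shows "cayley (cis t) $ 1 = - sin t / (1 - cos t)" "cayley (cis t) $ 2 = 0" "cis t \<noteq> 1"
proof -
  have "sin (t/2) > 0" using assms by (intro sin_gt_zero) auto
  then have c: "cos t < 1" using cos_double_sin[of "t/2"] by simp
  have "(cmod (1 - cis t))\<^sup>2 = 2 * (1 - cos t)"
    unfolding cmod_power2 using sin_cos_squared_add[of t] by (simp add: algebra_simps power2_eq_square)
  then show "cayley (cis t) $ 1 = - sin t / (1 - cos t)" "cayley (cis t) $ 2 = 0"
    using c by (simp_all add: cayley_def) (simp add: field_simps)
  show "cis t \<noteq> 1" using c by (auto simp: complex_eq_iff)
qed

text \<open>The transform makes the four boundary points interlaced on the real line and keeps both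
  paths in the closed half-plane, so the fashoda theorem yields a common image point, and
  injectivity brings it back. The point 1 must be avoided since it goes to infinity.\<close>

lemma interlaced_disc_paths_meet:
  fixes f g :: "real \<Rightarrow> complex"
  assumes "path f" "path g" "path_image f \<subseteq> cball 0 1 - {1}" "path_image g \<subseteq> cball 0 1 - {1}"
    and ends: "pathstart f = cis a1" "pathfinish f = cis a3" "pathstart g = cis a2" "pathfinish g = cis a4"
    and ord: "0 < a1" "a1 < a2" "a2 < a3" "a3 < a4" "a4 < 2 * pi"
  shows "path_image f \<inter> path_image g \<noteq> {}"
proof -
  let ?K = "cayley ` (path_image f \<union> path_image g)"
  have sub: "path_image f \<union> path_image g \<subseteq> cball 0 1 - {1}" using assms by auto
  have cont: "continuous_on (path_image f \<union> path_image g) cayley"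
    by (rule continuous_on_subset[OF continuous_on_cayley]) (use sub in auto)
  have "compact ?K" using assms by (intro compact_continuous_image[OF cont] compact_Un compact_path_image)
  then have "bounded ?K" by (rule compact_imp_bounded)
  then obtain M where M: "\<And>x. x \<in> ?K \<Longrightarrow> norm x \<le> M" by (auto simp: bounded_iff)
  \<comment> \<open>The box has the real line as its bottom side; \<open>M\<close> bounds both
    compact images.\<close>
  define a b :: "real^2" where "a = vector [-M, 0]" and "b = vector [M, M]"
  have box: "cayley z \<in> cbox a b" if z: "z \<in> path_image f \<union> path_image g" for z
  proof -
    have "\<bar>cayley z $ i\<bar> \<le> M" for i using M[of "cayley z"] z component_le_norm_cart[of "cayley z" i] by force
    moreover have "cayley z $ 2 \<ge> 0" using sub z by (auto simp: cayley_def power_le_one)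
    ultimately show ?thesis
      by (auto simp: mem_box_cart forall_2 a_def b_def abs_le_iff) (smt (verit))+
  qed
  have "\<exists>z. z \<in> path_image (cayley \<circ> f) \<and> z \<in> path_image (cayley \<circ> g)"
  proof -
    have cf: "continuous_on (path_image f) cayley" "continuous_on (path_image g) cayley"
      using cont continuous_on_subset by blast+
    obtain z where "z \<in> path_image (cayley \<circ> f)" "z \<in> path_image (cayley \<circ> g)"
    proof (rule fashoda_interlace[of "cayley \<circ> f" "cayley \<circ> g" a b])
      show "path (cayley \<circ> f)" "path (cayley \<circ> g)"
        using path_continuous_image assms cf by blast+
      show "path_image (cayley \<circ> f) \<subseteq> cbox a b" "path_image (cayley \<circ> g) \<subseteq> cbox a b"
        using box by (auto simp: path_image_compose)
      show "pathstart (cayley \<circ> f) $ 2 = a $ 2" "pathfinish (cayley \<circ> f) $ 2 = a $ 2"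
           "pathstart (cayley \<circ> g) $ 2 = a $ 2" "pathfinish (cayley \<circ> g) $ 2 = a $ 2"
        using ord by (simp_all add: pathstart_compose pathfinish_compose ends cayley_cis a_def)
      show "pathstart (cayley \<circ> f) $ 1 < pathstart (cayley \<circ> g) $ 1"
           "pathstart (cayley \<circ> g) $ 1 < pathfinish (cayley \<circ> f) $ 1"
           "pathfinish (cayley \<circ> f) $ 1 < pathfinish (cayley \<circ> g) $ 1"
        using ord by (simp_all only: pathstart_compose pathfinish_compose ends cayley_cis cot_half_less)
    qed
    then show ?thesis by blast
  qed
  then obtain x y where "x \<in> path_image f" "y \<in> path_image g" "cayley x = cayley y"
    by (auto simp: path_image_compose)
  then have "x = y" using cayley_inj[of x y] sub by auto
  then show ?thesis using \<open>x \<in> path_image f\<close> \<open>y \<in> path_image g\<close> by auto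
qed

text \<open>The part of the drawing that belongs to one component. An edge is selected by its first
  end, which is connected to the second anyway; \<open>pos x\<close> is added so that a vertex
  without edges also has an image.\<close>

definition comp_image :: "('v \<Rightarrow> complex) \<Rightarrow> ('v \<times> 'v \<Rightarrow> real \<Rightarrow> complex) \<Rightarrow> ('v \<times> 'v) multiset \<Rightarrow> 'v \<Rightarrow> complex set" where
  "comp_image pos \<gamma> D x = insert (pos x) (\<Union>e\<in>{e \<in> set_mset D. dd_conn D x (fst e)}. path_image (\<gamma> e))"

lemma path_component_comp_image:
  assumes emb: "disk_embedding V E n node pos \<gamma>" and D: "set_mset D \<subseteq> E"
    and xy: "dd_conn D x y"
  shows "path_component (comp_image pos \<gamma> D x) (pos x) (pos y)"
  using xy
proof (induction rule: rtrancl_induct)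
  case base
  show ?case by (simp add: comp_image_def path_component_refl)
next
  case (step y z)
  then obtain e where e: "e \<in> set_mset D" "(y = fst e \<and> z = snd e) \<or> (y = snd e \<and> z = fst e)"
    by (auto simp: dd_rel_def)
  have xe: "dd_conn D x (fst e)"
    using e step.hyps by (auto intro: rtrancl_into_rtrancl)
  have ae: "arc (\<gamma> e)" "pathstart (\<gamma> e) = pos (fst e)" "pathfinish (\<gamma> e) = pos (snd e)"
    using emb e D by (auto simp: disk_embedding_def)
  have sub: "path_image (\<gamma> e) \<subseteq> comp_image pos \<gamma> D x"
    using xe e by (auto simp: comp_image_def)
  have "path_component (comp_image pos \<gamma> D x) (pos (fst e)) (pos (snd e))"
    unfolding path_component_def using ae sub arc_imp_path by blast
  then have "path_component (comp_image pos \<gamma> D x) (pos y) (pos z)"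
    using e(2) path_component_sym by metis
  with step.IH show ?case by (rule path_component_trans)
qed

text \<open>In an embedding, a point common to the two images is a vertex, or lies on an edge that
  both use; either would connect \<open>x\<close> to \<open>y\<close>.\<close>

lemma comp_image_disjoint:
  assumes emb: "disk_embedding V E n node pos \<gamma>" and D: "set_mset D \<subseteq> E"
    and bip: "bip_graph V V1 E"
    and xy: "x \<in> V" "y \<in> V" "\<not> dd_conn D x y"
  shows "comp_image pos \<gamma> D x \<inter> comp_image pos \<gamma> D y = {}"
proof (rule ccontr)
  assume "\<not> ?thesis"
  then obtain z where z: "z \<in> comp_image pos \<gamma> D x" "z \<in> comp_image pos \<gamma> D y" by auto
  have inj: "inj_on pos V" and vert: "\<And>e v. e \<in> E \<Longrightarrow> v \<in> V \<Longrightarrow> pos v \<in> path_image (\<gamma> e) \<Longrightarrow> v = fst e \<or> v = snd e"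
    and edge: "\<And>e e'. e \<in> E \<Longrightarrow> e' \<in> E \<Longrightarrow> e \<noteq> e' \<Longrightarrow>
        path_image (\<gamma> e) \<inter> path_image (\<gamma> e') \<subseteq> pos ` ({fst e, snd e} \<inter> {fst e', snd e'})"
    using emb by (auto simp: disk_embedding_def)
  let ?R = "(dd_rel D)\<^sup>*"
  have fs: "(fst e, snd e) \<in> ?R" if "e \<in> set_mset D" for e
    using that by (auto simp: dd_rel_def intro!: r_into_rtrancl)
  have hit: "\<exists>v. (u, v) \<in> ?R \<and> ((v = u \<and> z = pos u) \<or> (\<exists>e\<in>set_mset D. v = fst e \<and> z \<in> path_image (\<gamma> e)))"
    if "z \<in> comp_image pos \<gamma> D u" for u
    using that by (auto simp: comp_image_def)
  have conn_e: "(u, v) \<in> ?R" if "e \<in> set_mset D" "u = fst e \<or> u = snd e" "v = fst e \<or> v = snd e" for e u v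
    using that fs[OF that(1)] dd_conn_sym by fastforce
  obtain v where v: "(x, v) \<in> ?R" "(v = x \<and> z = pos x) \<or> (\<exists>e\<in>set_mset D. v = fst e \<and> z \<in> path_image (\<gamma> e))"
    using hit[OF z(1)] by auto
  obtain w where w: "(y, w) \<in> ?R" "(w = y \<and> z = pos y) \<or> (\<exists>e\<in>set_mset D. w = fst e \<and> z \<in> path_image (\<gamma> e))"
    using hit[OF z(2)] by auto
  have "(v, w) \<in> ?R"
    using v(2)
  proof
    assume v: "v = x \<and> z = pos x"
    from w(2) show ?thesis
    proof
      assume "w = y \<and> z = pos y"
      then show ?thesis using v inj xy by (auto dest: inj_onD)
    next
      assume "\<exists>e\<in>set_mset D. w = fst e \<and> z \<in> path_image (\<gamma> e)"
      then obtain e where "e \<in> set_mset D" "w = fst e" "z \<in> path_image (\<gamma> e)" by auto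
      then show ?thesis using v vert[of e x] xy D conn_e[of e] by auto
    qed
  next
    assume "\<exists>e\<in>set_mset D. v = fst e \<and> z \<in> path_image (\<gamma> e)"
    then obtain e where e: "e \<in> set_mset D" "v = fst e" "z \<in> path_image (\<gamma> e)" by auto
    from w(2) show ?thesis
    proof
      assume "w = y \<and> z = pos y"
      then show ?thesis using e vert[of e y] xy D conn_e[of e] by auto
    next
      assume "\<exists>e\<in>set_mset D. w = fst e \<and> z \<in> path_image (\<gamma> e)"
      then obtain e' where e': "e' \<in> set_mset D" "w = fst e'" "z \<in> path_image (\<gamma> e')" by auto
      show ?thesis
      proof (cases "e = e'")
        case True then show ?thesis using e e' by simp
      next
        case False
        then obtain u where u: "u = fst e \<or> u = snd e" "u = fst e' \<or> u = snd e'"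
          using edge[of e e'] e e' D by blast
        have "(v, u) \<in> ?R" "(u, w) \<in> ?R" using conn_e e e' u by blast+
        then show ?thesis by (rule rtrancl_trans)
      qed
    qed
  qed
  then have "(x, y) \<in> ?R" using v(1) w(1) dd_conn_sym by (meson rtrancl_trans)
  with xy show False by simp
qed

text \<open>Otherwise disjoint parts of the drawing would contain paths with interlaced ends on the
  circle.\<close>

lemma noncrossing_components:
  assumes bip: "bip_graph V V1 E" and nodes: "nodes_ok V V1 n node"
    and emb: "disk_embedding V E n node pos \<gamma>" and D: "set_mset D \<subseteq> E"
    and ord: "1 \<le> i" "i < j" "j < k" "k < l" "l \<le> 2 * n"
    and ik: "dd_conn D (node i) (node k)" and jl: "dd_conn D (node j) (node l)"
  shows "dd_conn D (node i) (node j)"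
proof (rule ccontr)
  assume nc: "\<not> dd_conn D (node i) (node j)"
  let ?N = "{1..2*n}"
  obtain \<theta> :: "nat \<Rightarrow> real" where th: "\<And>k. k \<in> ?N \<Longrightarrow> pos (node k) = cis (\<theta> k)"
      "strict_mono_on ?N \<theta>" "0 < n \<longrightarrow> \<theta> (2*n) < \<theta> 1 + 2*pi"
    using emb by (auto simp: disk_embedding_def)
  have n: "n > 0" using ord by auto
  \<comment> \<open>The midpoint of the boundary arc from node \<open>2*n\<close> round to node 1.
    No node is there, hence no edge touches it, and rotating it to 1 prepares the Cayley transform.
    Subtracting \<open>2*pi\<close> places all angles \<open>\<theta> p - \<psi>\<close> between 0
    and \<open>2*pi\<close>.\<close>
  define \<psi> where "\<psi> = (\<theta> (2*n) + \<theta> 1 + 2*pi) / 2 - 2*pi"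
  have mono: "\<theta> p < \<theta> q" if "p \<in> ?N" "q \<in> ?N" "p < q" for p q
    using th(2) that by (auto simp: strict_mono_on_def)
  have mono': "\<theta> p \<le> \<theta> q" if "p \<in> ?N" "q \<in> ?N" "p \<le> q" for p q
    using mono[of p q] that by (cases "p = q") auto
  have rng: "0 < \<theta> p - \<psi>" "\<theta> p - \<psi> < 2 * pi" if "p \<in> ?N" for p
    using th(3) n mono'[of 1 p] mono'[of p "2*n"] that by (auto simp: \<psi>_def field_simps)
  have V: "node p \<in> V" if "p \<in> ?N" for p using nodes that by (auto simp: nodes_ok_def)
  have N: "i \<in> ?N" "j \<in> ?N" "k \<in> ?N" "l \<in> ?N" using ord by auto
  have avoid: "comp_image pos \<gamma> D (node p) \<subseteq> cball 0 1 - {cis \<psi>}" if p: "p \<in> ?N" for p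
  proof -
    have nn: "pos (node q) \<noteq> cis \<psi>" if "q \<in> ?N" for q
    proof
      assume "pos (node q) = cis \<psi>"
      then have "cis (\<theta> q - \<psi>) = 1" using th(1)[OF that] by (simp add: cis_divide[symmetric])
      then show False using cayley_cis(3) rng[OF that] by blast
    qed
    have sph: "cis \<psi> \<in> sphere 0 1" by simp
    have ed: "path_image (\<gamma> e) \<subseteq> cball 0 1 - {cis \<psi>}" if "e \<in> E" for e
    proof -
      have "path_image (\<gamma> e) \<subseteq> cball 0 1" "path_image (\<gamma> e) \<inter> sphere 0 1 \<subseteq> pos ` node ` ?N"
        using emb that unfolding disk_embedding_def by (elim conjE, blast)+
      moreover have "cis \<psi> \<notin> pos ` node ` ?N"
      proof
        assume "cis \<psi> \<in> pos ` node ` ?N"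
        then obtain q where "q \<in> ?N" "cis \<psi> = pos (node q)" by (elim imageE) simp
        then show False using nn[of q] by simp
      qed
      ultimately have "cis \<psi> \<notin> path_image (\<gamma> e)" using sph by (meson IntI subsetD)
      then show ?thesis using \<open>path_image (\<gamma> e) \<subseteq> cball 0 1\<close> by auto
    qed
    have "pos (node p) \<in> cball 0 1" using th(1)[OF p] by simp
    moreover have "path_image (\<gamma> e) \<subseteq> cball 0 1 - {cis \<psi>}" if "e \<in> set_mset D" for e
      using ed[of e] D that by blast
    ultimately show ?thesis using nn[OF p] unfolding comp_image_def by (intro insert_subsetI UN_least) auto
  qed
  obtain f where f: "path f" "path_image f \<subseteq> comp_image pos \<gamma> D (node i)"
      "pathstart f = pos (node i)" "pathfinish f = pos (node k)"
    using path_component_comp_image[OF emb D ik] by (auto simp: path_component_def)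
  obtain g where g: "path g" "path_image g \<subseteq> comp_image pos \<gamma> D (node j)"
      "pathstart g = pos (node j)" "pathfinish g = pos (node l)"
    using path_component_comp_image[OF emb D jl] by (auto simp: path_component_def)
  let ?r = "\<lambda>z. cis (- \<psi>) * z"
  have rsub: "path_image (?r \<circ> h) \<subseteq> cball 0 1 - {1}" if "path_image h \<subseteq> cball 0 1 - {cis \<psi>}" for h
  proof -
    have "cis (- \<psi>) * z = 1 \<Longrightarrow> z = cis \<psi>" for z
      by (metis cis_inverse cis_neq_zero inverse_unique inverse_inverse_eq)
    then show ?thesis using that by (auto simp: path_image_compose norm_mult)
  qed
  have "path_image (?r \<circ> f) \<inter> path_image (?r \<circ> g) \<noteq> {}"
  proof (rule interlaced_disc_paths_meet[of _ _ "\<theta> i - \<psi>" "\<theta> k - \<psi>" "\<theta> j - \<psi>" "\<theta> l - \<psi>"])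
    show "path (?r \<circ> f)" "path (?r \<circ> g)"
      using f g by (auto intro!: path_continuous_image continuous_intros)
    show "path_image (?r \<circ> f) \<subseteq> cball 0 1 - {1}" "path_image (?r \<circ> g) \<subseteq> cball 0 1 - {1}"
      using f g avoid N by (intro rsub; blast)+
  qed (use f g N rng mono ord in \<open>auto simp: pathstart_compose pathfinish_compose th(1) cis_mult\<close>)
  then have "path_image f \<inter> path_image g \<noteq> {}" by (auto simp: path_image_compose)
  moreover have "comp_image pos \<gamma> D (node i) \<inter> comp_image pos \<gamma> D (node j) = {}"
    using comp_image_disjoint[OF emb D bip V V nc] N by blast
  ultimately show False using f g by blast
qed

section \<open>Pairings of finite sets of labels\<close>

text \<open>The label set is arbitrary because the expansions remove two labels at a time and cuts
  divide the labels into two parts.\<close>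

definition pairing_on :: "nat set \<Rightarrow> nat set set \<Rightarrow> bool" where
  "pairing_on A P \<longleftrightarrow> (\<forall>B\<in>P. card B = 2) \<and> pairwise disjnt P \<and> \<Union>P = A"

lemma pairing_onD:
  assumes "pairing_on A P"
  shows "B \<in> P \<Longrightarrow> card B = 2" "B \<in> P \<Longrightarrow> B \<subseteq> A" "\<Union>P = A" "pairwise disjnt P"
    "B \<in> P \<Longrightarrow> B' \<in> P \<Longrightarrow> x \<in> B \<Longrightarrow> x \<in> B' \<Longrightarrow> B = B'"
  using assms by (auto simp: pairing_on_def pairwise_def disjnt_iff)

lemma card_2_neq: "card B = 2 \<Longrightarrow> \<exists>i j. i \<noteq> j \<and> B = {i, j}"
  by (auto simp: card_2_iff)

lemma is_pairing_iff: "is_pairing n P \<longleftrightarrow> pairing_on {1..2*n} P"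
proof
  assume P: "is_pairing n P"
  then have two: "\<And>B. B \<in> P \<Longrightarrow> card B = 2" and sub: "\<Union>P \<subseteq> {1..2*n}"
    and ex1: "\<And>k. k \<in> {1..2*n} \<Longrightarrow> \<exists>!B. B \<in> P \<and> k \<in> B"
    by (auto simp: is_pairing_def)
  have "pairwise disjnt P"
    unfolding pairwise_def disjnt_iff using ex1 sub by blast
  moreover have "\<Union>P = {1..2*n}" using ex1 sub by blast
  ultimately show "pairing_on {1..2*n} P" using two by (simp add: pairing_on_def)
next
  assume P: "pairing_on {1..2*n} P"
  have "\<exists>!B. B \<in> P \<and> k \<in> B" if "k \<in> {1..2*n}" for k
    using pairing_onD(3)[OF P] pairing_onD(5)[OF P] that by blast
  then show "is_pairing n P"
    using card_2_neq[OF pairing_onD(1)[OF P]] pairing_onD(3)[OF P] unfolding is_pairing_def by auto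
qed

lemma pairing_on_empty [simp]: "pairing_on {} P \<longleftrightarrow> P = {}"
  unfolding pairing_on_def by (auto simp: card_2_iff)

lemma finite_pairing: "finite A \<Longrightarrow> pairing_on A P \<Longrightarrow> finite P"
  by (simp add: pairing_on_def finite_UnionD)

lemma finite_pairings: "finite A \<Longrightarrow> finite {P. pairing_on A P}"
  by (rule finite_subset[of _ "Pow (Pow A)"]) (auto simp: pairing_on_def)

lemma pairing_on_Un:
  "pairing_on A P \<Longrightarrow> pairing_on A' P' \<Longrightarrow> A \<inter> A' = {} \<Longrightarrow> pairing_on (A \<union> A') (P \<union> P')"
  unfolding pairing_on_def pairwise_def disjnt_def by (auto; blast)

lemma pairing_on_block: "i \<noteq> j \<Longrightarrow> pairing_on {i, j} {{i, j}}"
  by (auto simp: pairing_on_def)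

lemma pairing_on_subset:
  assumes "pairing_on A P" "Q \<subseteq> P"
  shows "pairing_on (\<Union>Q) Q"
  using assms by (auto simp: pairing_on_def intro: pairwise_subset)

lemma pairing_on_Diff:
  assumes P: "pairing_on A P" and Q: "Q \<subseteq> P"
  shows "pairing_on (A - \<Union>Q) (P - Q)"
proof -
  have "\<Union>(P - Q) = A - \<Union>Q" using pairing_onD(3,5)[OF P] Q by blast
  then show ?thesis using pairing_on_subset[OF P, of "P - Q"] by simp
qed

lemma pairing_on_remove:
  "pairing_on A P \<Longrightarrow> {i, j} \<in> P \<Longrightarrow> pairing_on (A - {i, j}) (P - {{i, j}})"
  using pairing_on_Diff[of A P "{{i, j}}"] by simp

lemma pairing_on_insert:
  assumes "pairing_on (A - {i, j}) P" "i \<in> A" "j \<in> A" "i \<noteq> j"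
  shows "pairing_on A (insert {i, j} P)" "{i, j} \<notin> P"
proof -
  have "{i, j} \<union> (A - {i, j}) = A" using assms by auto
  then show "pairing_on A (insert {i, j} P)"
    using pairing_on_Un[OF pairing_on_block[OF assms(4)] assms(1)] by auto
  show "{i, j} \<notin> P" using pairing_onD(2)[OF assms(1)] by blast
qed

lemma pairing_ex1:
  assumes "pairing_on A P" "k \<in> A"
  shows "\<exists>!j. j \<noteq> k \<and> {k, j} \<in> P"
proof -
  obtain B where B: "B \<in> P" "k \<in> B" using assms pairing_onD(3) by blast
  then obtain p q where "p \<noteq> q" "B = {p, q}" using card_2_neq[OF pairing_onD(1)[OF assms(1) B(1)]] by auto
  then obtain j where j: "j \<noteq> k" "B = {k, j}" using B(2) by (metis insertE insert_commute singletonD)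
  show ?thesis
  proof (rule ex1I[of _ j])
    fix l assume "l \<noteq> k \<and> {k, l} \<in> P"
    then have "{k, l} = {k, j}" using pairing_onD(5)[OF assms(1), of "{k, l}" B k] B j by auto
    then show "l = j" using \<open>l \<noteq> k \<and> _\<close> by auto
  qed (use B j in auto)
qed

lemma pairing_unique:
  assumes "pairing_on A P" "{i, j} \<in> P" "{i, l} \<in> P"
  shows "j = l"
  using pairing_onD(5)[OF assms(1,2,3), of i] by (auto simp: doubleton_eq_iff)

lemma pairing_neq:
  "pairing_on A P \<Longrightarrow> {i, j} \<in> P \<Longrightarrow> i \<noteq> j"
  using pairing_onD(1) by fastforce

lemma pairing_mem:
  "pairing_on A P \<Longrightarrow> {i, j} \<in> P \<Longrightarrow> i \<in> A \<and> j \<in> A"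
  using pairing_onD(2) by blast

lemma partner_eq:
  assumes "pairing_on A P" "{k, j} \<in> P"
  shows "partner P k = j"
  unfolding partner_def
proof (rule the_equality)
  show "j \<noteq> k \<and> {k, j} \<in> P" using pairing_neq[OF assms] assms(2) by simp
  show "l = j" if "l \<noteq> k \<and> {k, l} \<in> P" for l
    by (rule pairing_unique[OF assms(1) conjunct2[OF that] assms(2)])
qed

section \<open>Crossing signs\<close>

text \<open>With the value -1 on the diagonal, squares are 1 without exception, so products of order
  signs cancel with no side conditions.\<close>

definition osgn :: "nat \<Rightarrow> nat \<Rightarrow> int" where
  "osgn x y = (if x < y then 1 else - 1)"

lemma osgn_square [simp]: "osgn x y * osgn x y = 1" "osgn x y * (osgn x y * z) = z"
  by (auto simp: osgn_def)

lemma osgn_swap: "x \<noteq> y \<Longrightarrow> osgn y x = - osgn x y"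
  by (auto simp: osgn_def)

definition crosses :: "nat set \<Rightarrow> nat set \<Rightarrow> bool" where
  "crosses B1 B2 \<longleftrightarrow> (\<exists>a b c d. a < b \<and> b < c \<and> c < d \<and> B1 = {a,c} \<and> B2 = {b,d})"

definition chi :: "nat set set \<Rightarrow> int" where
  "chi P = (- 1) ^ ncross P"

lemma crosses_iff:
  assumes "p < q" "r < s"
  shows "crosses {p, q} {r, s} \<longleftrightarrow> p < r \<and> r < q \<and> q < s"
  unfolding crosses_def using assms
  by (auto simp: doubleton_eq_iff)

text \<open>The number of inversions between two disjoint blocks is 1 or 3 if they interlace, and 0,
  2 or 4 if they are nested or apart.\<close>

lemma prod_osgn_crosses:
  assumes "card B = 2" "card B' = 2" "B \<inter> B' = {}"
  shows "(\<Prod>x\<in>B. \<Prod>y\<in>B'. osgn x y) = (if crosses B B' \<or> crosses B' B then - 1 else 1)"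
proof -
  obtain p q where B: "B = {p, q}" "p < q"
    using card_2_neq[OF assms(1)] by (metis insert_commute linorder_neqE_nat)
  obtain r s where B': "B' = {r, s}" "r < s"
    using card_2_neq[OF assms(2)] by (metis insert_commute linorder_neqE_nat)
  have "p \<noteq> r" "p \<noteq> s" "q \<noteq> r" "q \<noteq> s" using assms(3) B B' by auto
  then show ?thesis unfolding B(1) B'(1) crosses_iff[OF B(2) B'(2)] crosses_iff[OF B'(2) B(2)]
    using B(2) B'(2) by (auto simp: osgn_def)
qed

lemma prod_minus_one_card:
  "finite A \<Longrightarrow> (\<Prod>x\<in>A. if Q x then - 1 else (1::int)) = (- 1) ^ card {x \<in> A. Q x}"
  by (subst prod.If_cases) (auto simp: Int_def)

lemma ncross_eq: "ncross P = card {(B1, B2) \<in> P \<times> P. crosses B1 B2}"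
  by (simp add: ncross_def crosses_def)

lemma not_crosses_sym: "crosses B B' \<Longrightarrow> \<not> crosses B' B"
  by (auto simp: crosses_def doubleton_eq_iff)

text \<open>The parity of the crossings between \<open>B\<close> and \<open>P\<close> is a product
  over pairs of labels, so it sees the label set \<open>A\<close> but not the way in which
  \<open>P\<close> pairs it.\<close>

lemma chi_insert:
  assumes P: "pairing_on A P" and fin: "finite A" and B: "card B = 2" "B \<inter> A = {}"
  shows "chi (insert B P) = chi P * (\<Prod>x\<in>B. \<Prod>y\<in>A. osgn x y)"
proof -
  have finP: "finite P" using finite_pairing[OF fin P] .
  have nB: "B \<notin> P"
  proof
    assume "B \<in> P"
    then have "B = {}" using B(2) pairing_onD(2)[OF P] by blast
    then show False using B(1) by simp
  qed
  have disj: "B \<inter> B' = {}" "card B' = 2" if "B' \<in> P" for B'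
    using that B pairing_onD(1,2)[OF P] by auto
  let ?X = "{(B1, B2) \<in> P \<times> P. crosses B1 B2}" and ?L = "{B' \<in> P. crosses B B'}" and ?R = "{B' \<in> P. crosses B' B}"
  have irr: "\<not> crosses B B" using not_crosses_sym by blast
  have split: "{(B1, B2) \<in> insert B P \<times> insert B P. crosses B1 B2} = ?X \<union> (Pair B ` ?L \<union> (\<lambda>B'. (B', B)) ` ?R)"
    using irr by auto
  have "ncross (insert B P) = ncross P + (card ?L + card ?R)"
    unfolding ncross_eq split
  proof (subst card_Un_disjoint)
    show "finite ?X" by (rule finite_subset[of _ "P \<times> P"]) (use finP in auto)
    show "finite (Pair B ` ?L \<union> (\<lambda>B'. (B', B)) ` ?R)" using finP by auto
    show "?X \<inter> (Pair B ` ?L \<union> (\<lambda>B'. (B', B)) ` ?R) = {}" using nB by auto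
    have "card (Pair B ` ?L \<union> (\<lambda>B'. (B', B)) ` ?R) = card (Pair B ` ?L) + card ((\<lambda>B'. (B', B)) ` ?R)"
      using nB finP by (intro card_Un_disjoint) auto
    then show "card ?X + card (Pair B ` ?L \<union> (\<lambda>B'. (B', B)) ` ?R) = card ?X + (card ?L + card ?R)"
      by (simp add: card_image inj_on_def)
  qed
  moreover have "card ?L + card ?R = card {B' \<in> P. crosses B B' \<or> crosses B' B}"
  proof -
    have "?L \<inter> ?R = {}" using not_crosses_sym by auto
    moreover have "?L \<union> ?R = {B' \<in> P. crosses B B' \<or> crosses B' B}" by auto
    ultimately show ?thesis using finP card_Un_disjoint[of ?L ?R] by simp
  qed
  ultimately have "chi (insert B P) = chi P * (\<Prod>B'\<in>P. if crosses B B' \<or> crosses B' B then - 1 else 1)"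
    by (simp add: chi_def power_add prod_minus_one_card[OF finP])
  also have "(\<Prod>B'\<in>P. if crosses B B' \<or> crosses B' B then - 1 else 1) = (\<Prod>B'\<in>P. \<Prod>y\<in>B'. \<Prod>x\<in>B. osgn x y)"
    using prod_osgn_crosses[OF B(1) disj(2,1)] by (intro prod.cong refl) (simp add: prod.swap[of _ B])
  also have "\<dots> = (\<Prod>y\<in>\<Union>P. \<Prod>x\<in>B. osgn x y)"
    using pairing_onD(4)[OF P] disj(2)
    by (subst prod.Union_disjoint) (auto simp: pairwise_def disjnt_iff intro: card_ge_0_finite)
  also have "\<dots> = (\<Prod>x\<in>B. \<Prod>y\<in>A. osgn x y)"
    using pairing_onD(3)[OF P] by (simp add: prod.swap[of _ B])
  finally show ?thesis .
qed

lemma chi_empty [simp]: "chi {} = 1"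
  by (simp add: chi_def ncross_def)

text \<open>Block by block from \<open>chi_insert\<close>: the mutual crossings contribute a sign of
  the two label sets only.\<close>

lemma chi_Un:
  assumes "pairing_on A P" "finite A" "pairing_on A' P'" "finite A'" "A \<inter> A' = {}"
  shows "chi (P \<union> P') = chi P * chi P' * (\<Prod>x\<in>A. \<Prod>y\<in>A'. osgn x y)"
proof -
  have "finite P" using assms finite_pairing by blast
  then show ?thesis using assms(1,2,5)
  proof (induction P arbitrary: A)
    case (insert B P)
    have B: "card B = 2" "B \<subseteq> A" using pairing_onD(1,2)[OF insert.prems(1)] by auto
    then have "finite B" using insert.prems(2) finite_subset by blast
    have P: "pairing_on (A - B) P"
      using pairing_on_Diff[OF insert.prems(1), of "{B}"] insert.hyps by simp
    have disj: "(A - B) \<inter> A' = {}" "B \<inter> A' = {}" using insert.prems(3) B by auto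
    have PP: "pairing_on (A - B \<union> A') (P \<union> P')" by (rule pairing_on_Un[OF P assms(3) disj(1)])
    have "chi (insert B (P \<union> P')) = chi (P \<union> P') * (\<Prod>x\<in>B. \<Prod>y\<in>A - B \<union> A'. osgn x y)"
      by (rule chi_insert[OF PP]) (use insert.prems assms B disj in auto)
    also have "\<dots> = chi P * chi P' * (\<Prod>x\<in>A - B. \<Prod>y\<in>A'. osgn x y) * (\<Prod>x\<in>B. (\<Prod>y\<in>A - B. osgn x y) * (\<Prod>y\<in>A'. osgn x y))"
    proof -
      have "(\<Prod>y\<in>A - B \<union> A'. osgn x y) = (\<Prod>y\<in>A - B. osgn x y) * (\<Prod>y\<in>A'. osgn x y)" for x
        by (rule prod.union_disjoint) (use insert.prems assms disj in auto)
      then show ?thesis using insert.IH[OF P _ disj(1)] insert.prems by simp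
    qed
    also have "\<dots> = (chi P * (\<Prod>x\<in>B. \<Prod>y\<in>A - B. osgn x y)) * chi P' * ((\<Prod>x\<in>B. \<Prod>y\<in>A'. osgn x y) * (\<Prod>x\<in>A - B. \<Prod>y\<in>A'. osgn x y))"
      by (simp add: prod.distrib mult_ac)
    also have "chi P * (\<Prod>x\<in>B. \<Prod>y\<in>A - B. osgn x y) = chi (insert B P)"
      by (rule chi_insert[OF P, symmetric]) (use insert.prems B in auto)
    also have "(\<Prod>x\<in>B. \<Prod>y\<in>A'. osgn x y) * (\<Prod>x\<in>A - B. \<Prod>y\<in>A'. osgn x y) = (\<Prod>x\<in>A. \<Prod>y\<in>A'. osgn x y)"
      using prod.subset_diff[OF B(2) insert.prems(2), of "\<lambda>x. \<Prod>y\<in>A'. osgn x y"] by (simp add: mult.commute)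
    finally show ?case by simp
  qed (simp add: pairing_on_def)
qed

text \<open>This is -1 to the number of elements of \<open>A\<close> before \<open>i\<close>, the
  sign of a row or column in a cofactor expansion.\<close>

definition pos_sgn :: "nat set \<Rightarrow> nat \<Rightarrow> int" where
  "pos_sgn A i = (\<Prod>y\<in>A - {i}. osgn i y)"

lemma pos_sgn_square: "pos_sgn A i * pos_sgn A i = 1"
  unfolding pos_sgn_def prod.distrib[symmetric] by simp

text \<open>The two position signs also compare \<open>i\<close> and \<open>j\<close> with each
  other, which is not part of the crossing sign; these two comparisons multiply to -1, whence the
  leading minus.\<close>

lemma chi_remove:
  assumes P: "pairing_on A P" and fin: "finite A" and ij: "{i, j} \<in> P"
  shows "chi P = - pos_sgn A i * pos_sgn A j * chi (P - {{i, j}})"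
proof -
  have D: "A - {i} - {j} = A - {i, j}" "A - {j} - {i} = A - {i, j}" by auto
  have neq: "i \<noteq> j" and mem: "i \<in> A" "j \<in> A" using pairing_neq[OF P ij] pairing_mem[OF P ij] by auto
  have "chi (insert {i, j} (P - {{i, j}})) = chi (P - {{i, j}}) * (\<Prod>x\<in>{i, j}. \<Prod>y\<in>A - {i, j}. osgn x y)"
    by (rule chi_insert[OF pairing_on_remove[OF P ij]]) (use fin neq in auto)
  moreover have "insert {i, j} (P - {{i, j}}) = P" using ij by auto
  moreover have "pos_sgn A i = osgn i j * (\<Prod>y\<in>A - {i, j}. osgn i y)"
    unfolding pos_sgn_def using prod.remove[of "A - {i}" j "osgn i"] neq mem fin unfolding D by simp
  moreover have "pos_sgn A j = osgn j i * (\<Prod>y\<in>A - {i, j}. osgn j y)"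
    unfolding pos_sgn_def using prod.remove[of "A - {j}" i "osgn j"] neq mem fin unfolding D by simp
  ultimately show ?thesis using neq osgn_swap[OF neq] by (simp add: mult_ac)
qed

lemma planar_chi: "planar_pairing P \<Longrightarrow> chi P = 1"
proof -
  assume "planar_pairing P"
  then have "{(B1, B2) \<in> P \<times> P. crosses B1 B2} = {}"
    unfolding planar_pairing_def crosses_def by blast
  then show ?thesis by (simp only: chi_def ncross_eq card.empty power_0)
qed

lemma planar_subset: "planar_pairing P \<Longrightarrow> Q \<subseteq> P \<Longrightarrow> planar_pairing Q"
  unfolding planar_pairing_def by blast

text \<open>Removing a pair from a planar pairing leaves a planar pairing, so both crossing signs in
  \<open>chi_remove\<close> are 1.\<close>

lemma planar_pos_sgn:
  assumes "pairing_on A P" "finite A" "planar_pairing P" "{i, j} \<in> P"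
  shows "pos_sgn A i * pos_sgn A j = - 1"
  using chi_remove[OF assms(1,2,4)] planar_chi[OF assms(3)] planar_chi[OF planar_subset[OF assms(3)], of "P - {{i, j}}"]
  by simp

section \<open>Signed sums over black-white pairings\<close>

definition bw_pairings :: "nat set \<Rightarrow> nat set \<Rightarrow> nat set set set" where
  "bw_pairings K A = {P. pairing_on A P \<and> (\<forall>B\<in>P. \<exists>b w. B = {b, w} \<and> b \<in> K \<and> w \<notin> K)}"

lemma finite_bw_pairings: "finite A \<Longrightarrow> finite (bw_pairings K A)"
  by (rule finite_subset[OF _ finite_pairings]) (auto simp: bw_pairings_def)

lemma bw_pairings_insert:
  assumes "P \<in> bw_pairings K (A - {b, w})" "b \<in> A" "b \<in> K" "w \<in> A" "w \<notin> K"
  shows "insert {b, w} P \<in> bw_pairings K A" "{b, w} \<notin> P"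
  using pairing_on_insert[of A b w P] assms by (auto simp: bw_pairings_def)

lemma bw_pairings_remove:
  assumes "P \<in> bw_pairings K A" "{b, w} \<in> P"
  shows "P - {{b, w}} \<in> bw_pairings K (A - {b, w})"
  using pairing_on_remove[of A P b w] assms by (auto simp: bw_pairings_def)

lemma bw_pairings_partner:
  assumes P: "P \<in> bw_pairings K A" and b: "b \<in> A" "b \<in> K"
  shows "{b, partner P b} \<in> P" "partner P b \<in> A - K"
proof -
  have PA: "pairing_on A P" using P by (simp add: bw_pairings_def)
  obtain w where w: "{b, w} \<in> P" using pairing_ex1[OF PA b(1)] by blast
  then have p: "partner P b = w" by (rule partner_eq[OF PA])
  show "{b, partner P b} \<in> P" using w p by simp
  obtain b' w' where "{b, w} = {b', w'}" "b' \<in> K" "w' \<notin> K" using P w unfolding bw_pairings_def by blast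
  then have "w \<notin> K" using b by (auto simp: doubleton_eq_iff)
  then show "partner P b \<in> A - K" using p pairing_mem[OF PA w] by simp
qed

text \<open>For \<open>A\<close> with equally many labels inside and outside \<open>K\<close> this
  is, up to a global sign, the determinant with rows \<open>b\<close>, columns \<open>w\<close> and
  entries \<open>osgn b w * y {b, w}\<close>.\<close>

definition bw_sum :: "nat set \<Rightarrow> (nat set \<Rightarrow> real) \<Rightarrow> nat set \<Rightarrow> real" where
  "bw_sum K y A = (\<Sum>P\<in>bw_pairings K A. of_int (chi P) * (\<Prod>B\<in>P. y B))"

lemma bw_sum_empty: "bw_sum K y {} = 1"
proof -
  have "bw_pairings K {} = {{}}" by (auto simp: bw_pairings_def)
  then show ?thesis by (simp add: bw_sum_def)
qed

text \<open>Laplace expansion along the row of \<open>b\<close>: a pairing is the partner of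
  \<open>b\<close> together with a pairing of the other labels, and \<open>chi_remove\<close>
  supplies the cofactor sign.\<close>

lemma bw_sum_expand:
  assumes A: "finite A" and b: "b \<in> A" "b \<in> K"
  shows "bw_sum K y A = (\<Sum>w\<in>A - K. of_int (- pos_sgn A b * pos_sgn A w) * y {b, w} * bw_sum K y (A - {b, w}))"
proof -
  let ?g = "\<lambda>P. of_int (chi P) * (\<Prod>B\<in>P. y B)"
  have fin: "finite (A - K)" "\<forall>w\<in>A - K. finite (bw_pairings K (A - {b, w}))"
    using A by (auto intro: finite_bw_pairings)
  have "(\<Sum>w\<in>A - K. of_int (- pos_sgn A b * pos_sgn A w) * y {b, w} * bw_sum K y (A - {b, w})) =
     (\<Sum>w\<in>A - K. \<Sum>P\<in>bw_pairings K (A - {b, w}). of_int (- pos_sgn A b * pos_sgn A w) * y {b, w} * ?g P)"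
    by (simp add: bw_sum_def sum_distrib_left)
  also have "\<dots> = (\<Sum>(w, P)\<in>Sigma (A - K) (\<lambda>w. bw_pairings K (A - {b, w})).
      of_int (- pos_sgn A b * pos_sgn A w) * y {b, w} * ?g P)"
    by (rule sum.Sigma[OF fin])
  also have "\<dots> = (\<Sum>P\<in>bw_pairings K A. ?g P)"
  proof (rule sum.reindex_bij_witness[where j = "\<lambda>(w, P). insert {b, w} P" and i = "\<lambda>P. (partner P b, P - {{b, partner P b}})"])
    fix P assume P: "P \<in> bw_pairings K A"
    note p = bw_pairings_partner[OF P b]
    show "(partner P b, P - {{b, partner P b}}) \<in> Sigma (A - K) (\<lambda>w. bw_pairings K (A - {b, w}))"
      using p bw_pairings_remove[OF P p(1)] by simp
    show "(case (partner P b, P - {{b, partner P b}}) of (w, P) \<Rightarrow> insert {b, w} P) = P"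
      using p(1) by auto
  next
    fix a assume a: "a \<in> Sigma (A - K) (\<lambda>w. bw_pairings K (A - {b, w}))"
    obtain w P where wP: "a = (w, P)" by (cases a)
    have w: "w \<in> A" "w \<notin> K" and P: "P \<in> bw_pairings K (A - {b, w})" using a wP by auto
    note I = bw_pairings_insert[OF P b w]
    have IA: "pairing_on A (insert {b, w} P)" using I(1) by (simp add: bw_pairings_def)
    have part: "partner (insert {b, w} P) b = w" by (rule partner_eq[OF IA]) simp
    show "(case a of (w, P) \<Rightarrow> insert {b, w} P) \<in> bw_pairings K A" using I(1) wP by simp
    show "(partner (case a of (w, P) \<Rightarrow> insert {b, w} P) b,
        (case a of (w, P) \<Rightarrow> insert {b, w} P) - {{b, partner (case a of (w, P) \<Rightarrow> insert {b, w} P) b}}) = a"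
      using part I(2) wP by simp
    have finP: "finite P" using finite_pairing[of "A - {b, w}" P] P A by (simp add: bw_pairings_def)
    have "chi (insert {b, w} P) = - pos_sgn A b * pos_sgn A w * chi (insert {b, w} P - {{b, w}})"
      by (rule chi_remove[OF IA A]) simp
    also have "insert {b, w} P - {{b, w}} = P" using I(2) by simp
    finally have "chi (insert {b, w} P) = - pos_sgn A b * pos_sgn A w * chi P" .
    then show "?g (case a of (w, P) \<Rightarrow> insert {b, w} P) =
       (case a of (w, P) \<Rightarrow> of_int (- pos_sgn A b * pos_sgn A w) * y {b, w} * ?g P)"
      using I(2) finP wP by (simp add: mult_ac)
  qed
  finally show ?thesis by (simp add: bw_sum_def)
qed

text \<open>The condition \<open>ends_compat\<close> read off from labels instead of vertices, with
  \<open>K\<close> as the set of black labels.\<close>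

definition pairing_compat :: "nat set \<Rightarrow> nat set set \<Rightarrow> nat set \<Rightarrow> bool" where
  "pairing_compat K P X \<longleftrightarrow> (\<forall>i j. {i, j} \<in> P \<longrightarrow> ((i \<in> K \<longleftrightarrow> j \<notin> K) \<longleftrightarrow> (i \<in> X \<longleftrightarrow> j \<in> X)))"

text \<open>If not all pairs are black-white but some \<open>w\<close> contributes, then exactly two do, namely the two ends of the
  unique white-white pair, and planarity makes their signs opposite.\<close>
lemma planar_laplace:
  assumes P: "pairing_on A P" and A: "finite A" and planar: "planar_pairing P" and b: "b \<in> A" "b \<in> K"
  shows "(\<Sum>w\<in>A - K. - pos_sgn A b * pos_sgn A w * (if pairing_compat K P {b, w} then 1 else 0)) =
    (if pairing_compat K P A then 1 else 0)"
proof -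
  obtain b' where b': "{b, b'} \<in> P" using pairing_ex1[OF P b(1)] by blast
  have bb': "b \<noteq> b'" "b' \<in> A" using pairing_neq[OF P b'] pairing_mem[OF P b'] by auto
  have uniq: "j = l" if "{i, j} \<in> P" "{i, l} \<in> P" for i j l by (rule pairing_unique[OF P that])
  have sw: "{i, j} \<in> P \<longleftrightarrow> {j, i} \<in> P" for i j by (simp add: insert_commute)
  have mem: "i \<in> A" "j \<in> A" if "{i, j} \<in> P" for i j using pairing_mem[OF P that] by auto
  show ?thesis
  proof (cases "pairing_compat K P A")
    case True
    \<comment> \<open>With \<open>X = A\<close> both ends of each pair are in \<open>X\<close>, so
      compatibility says that every pair is black-white.\<close>
    then have bw: "i \<in> K \<longleftrightarrow> j \<notin> K" if "{i, j} \<in> P" for i j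
      using that mem[OF that] by (auto simp: pairing_compat_def)
    have only: "pairing_compat K P {b, w} \<longleftrightarrow> w = b'" if w: "w \<in> A - K" for w
    proof
      assume "pairing_compat K P {b, w}"
      then have "b' \<in> {b, w}" using b' bw[OF b'] by (auto simp: pairing_compat_def)
      then show "w = b'" using bb' by simp
    next
      assume "w = b'"
      show "pairing_compat K P {b, w}"
        unfolding pairing_compat_def \<open>w = b'\<close>
      proof (intro allI impI)
        fix i j assume ij: "{i, j} \<in> P"
        have "i \<in> {b, b'} \<longleftrightarrow> j \<in> {b, b'}" using uniq ij b' sw by (metis insertE insertI1 insert_commute singletonD)
        then show "(i \<in> K \<longleftrightarrow> j \<notin> K) \<longleftrightarrow> (i \<in> {b, b'} \<longleftrightarrow> j \<in> {b, b'})" using bw[OF ij] by simp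
      qed
    qed
    have b'K: "b' \<in> A - K" using bb' bw[OF b'] b by auto
    have "(\<Sum>w\<in>A - K. - pos_sgn A b * pos_sgn A w * (if pairing_compat K P {b, w} then 1 else 0)) =
        (\<Sum>w\<in>A - K. if w = b' then - pos_sgn A b * pos_sgn A w else 0)"
      using only by (intro sum.cong) auto
    also have "\<dots> = - pos_sgn A b * pos_sgn A b'" using b'K A by simp
    also have "\<dots> = 1" using planar_pos_sgn[OF P A planar b'] by simp
    finally show ?thesis using True by simp
  next
    case False
    show ?thesis
    proof (cases "\<exists>w\<in>A - K. pairing_compat K P {b, w}")
      case none: False
      have "(\<Sum>w\<in>A - K. - pos_sgn A b * pos_sgn A w * (if pairing_compat K P {b, w} then 1 else 0)) = 0"
        using none by (intro sum.neutral) auto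
      then show ?thesis using False by simp
    next
      case True
      then obtain w0 where w0: "w0 \<in> A" "w0 \<notin> K" and c0: "pairing_compat K P {b, w0}" by auto
      obtain w1 where w1: "{w0, w1} \<in> P" using pairing_ex1[OF P w0(1)] by blast
      have w01: "w0 \<noteq> w1" "w1 \<in> A" using pairing_neq[OF P w1] mem[OF w1] by auto
      have c: "(i \<in> K \<longleftrightarrow> j \<notin> K) \<longleftrightarrow> (i \<in> {b, w0} \<longleftrightarrow> j \<in> {b, w0})" if "{i, j} \<in> P" for i j
        using c0 that by (simp add: pairing_compat_def)
      \<comment> \<open>If \<open>b\<close> were paired with \<open>w0\<close>, then
        \<open>{b, w0}\<close> would be a block, no pair would be divided by it, and all pairs would
        be black-white, against the case assumption.\<close>
      have b'w0: "b' \<noteq> w0"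
      proof
        assume eq: "b' = w0"
        have "i \<in> K \<longleftrightarrow> j \<notin> K" if ij: "{i, j} \<in> P" for i j
        proof -
          have "i \<in> {b, w0} \<longleftrightarrow> j \<in> {b, w0}" using uniq ij b' sw eq by (metis insertE insertI1 insert_commute singletonD)
          then show ?thesis using c[OF ij] by simp
        qed
        then have "pairing_compat K P A" using mem by (auto simp: pairing_compat_def)
        then show False using False by simp
      qed
      have w1b: "w1 \<noteq> b" using b'w0 uniq b' w1 sw by metis
      have b'K: "b' \<in> K" using c[OF b'] b bb' b'w0 by auto
      have w1K: "w1 \<notin> K" using c[OF w1] w0 w01 w1b by auto
      \<comment> \<open>Any contributing \<open>w\<close> must divide the white-white pair.
        Replacing \<open>w0\<close> by \<open>w1\<close> still divides it and changes nothing for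
        the other pairs.\<close>
      have only: "pairing_compat K P {b, w} \<longleftrightarrow> w \<in> {w0, w1}" if w: "w \<in> A - K" for w
      proof
        assume "pairing_compat K P {b, w}"
        then have "w0 \<in> {b, w} \<longleftrightarrow> w1 \<notin> {b, w}" using w1 w0 w1K by (auto simp: pairing_compat_def)
        moreover have "w0 \<noteq> b" "w1 \<noteq> b" using w0 b w1b by auto
        ultimately show "w \<in> {w0, w1}" by auto
      next
        assume "w \<in> {w0, w1}"
        moreover have "pairing_compat K P {b, w1}"
          unfolding pairing_compat_def
        proof (intro allI impI)
          fix i j assume ij: "{i, j} \<in> P"
          have nb: "b \<noteq> w0" "b \<noteq> w1" "b' \<noteq> w1" using w0 b w1b b'K w1K by auto
          consider "i = w0" "j = w1" | "i = w1" "j = w0" | "i \<notin> {w0, w1}" "j \<notin> {w0, w1}"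
            using uniq ij w1 sw by (metis insertE singletonD)
          then show "(i \<in> K \<longleftrightarrow> j \<notin> K) \<longleftrightarrow> (i \<in> {b, w1} \<longleftrightarrow> j \<in> {b, w1})"
          proof cases
            case 3
            then show ?thesis using c[OF ij] by simp
          qed (use w0 w01 w1K nb in auto)
        qed
        ultimately show "pairing_compat K P {b, w}" using c0 by auto
      qed
      have "(\<Sum>w\<in>A - K. - pos_sgn A b * pos_sgn A w * (if pairing_compat K P {b, w} then 1 else 0)) =
        (\<Sum>w\<in>A - K. if w \<in> {w0, w1} then - pos_sgn A b * pos_sgn A w else 0)"
        using only by (intro sum.cong) auto
      also have "\<dots> = (\<Sum>w\<in>{w0, w1}. - pos_sgn A b * pos_sgn A w)"
      proof -
        have "(A - K) \<inter> {w0, w1} = {w0, w1}" using w0 w01 w1K by auto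
        moreover have "finite (A - K)" using A by simp
        ultimately show ?thesis using sum.inter_restrict[of "A - K" "\<lambda>w. - pos_sgn A b * pos_sgn A w" "{w0, w1}"] by simp
      qed
      also have "\<dots> = - pos_sgn A b * (pos_sgn A w0 + pos_sgn A w1)" using w01 by (simp add: algebra_simps)
      also have "pos_sgn A w0 + pos_sgn A w1 = 0"
      proof -
        have "pos_sgn A w0 * (pos_sgn A w0 + pos_sgn A w1) = 0"
          using planar_pos_sgn[OF P A planar w1] pos_sgn_square[of A w0] by (simp add: distrib_left)
        then show ?thesis using pos_sgn_square[of A w0] by auto
      qed
      finally show ?thesis using False by simp
    qed
  qed
qed

section \<open>Signs of permutations and crossings\<close>

definition match :: "nat set \<Rightarrow> (nat \<Rightarrow> nat) \<Rightarrow> (nat \<Rightarrow> nat) \<Rightarrow> nat set set" where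
  "match I b w = (\<lambda>k. {b k, w k}) ` I"

text \<open>The order signs inside the blocks complete the crossing sign to an alternating function
  of the enumeration \<open>w\<close>.\<close>

definition match_sgn :: "nat set \<Rightarrow> (nat \<Rightarrow> nat) \<Rightarrow> (nat \<Rightarrow> nat) \<Rightarrow> int" where
  "match_sgn I b w = chi (match I b w) * (\<Prod>k\<in>I. osgn (b k) (w k))"

lemma pairing_on_match:
  assumes "inj_on b I" "inj_on w I" "b ` I \<inter> w ` I = {}"
  shows "pairing_on (b ` I \<union> w ` I) (match I b w)"
proof -
  have bw: "b k \<noteq> w l" if "k \<in> I" "l \<in> I" for k l using assms(3) that by auto
  have "k = l" if "k \<in> I" "l \<in> I" "x \<in> {b k, w k}" "x \<in> {b l, w l}" for k l x
    using that bw[of k l] bw[of l k] inj_onD[OF assms(1), of k l] inj_onD[OF assms(2), of k l] by auto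
  then have "pairwise disjnt (match I b w)"
    unfolding pairwise_def disjnt_iff match_def by blast
  moreover have "\<forall>B\<in>match I b w. card B = 2" using bw by (auto simp: match_def)
  moreover have "\<Union>(match I b w) = b ` I \<union> w ` I" by (auto simp: match_def)
  ultimately show ?thesis by (simp add: pairing_on_def)
qed

lemma inj_on_match:
  assumes "inj_on b I" "b ` I \<inter> w ` I = {}"
  shows "inj_on (\<lambda>k. {b k, w k}) I"
proof (rule inj_onI)
  fix k l assume "k \<in> I" "l \<in> I" "{b k, w k} = {b l, w l}"
  moreover from this have "b k \<noteq> w l" using assms(2) by auto
  ultimately have "b k = b l" by (simp add: doubleton_eq_iff)
  then show "k = l" using inj_onD[OF assms(1)] \<open>k \<in> I\<close> \<open>l \<in> I\<close> by blast
qed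

lemma chi_block: "i \<noteq> j \<Longrightarrow> chi {{i, j}} = 1"
  using chi_insert[of "{}" "{}" "{i, j}"] by simp

lemma chi_two_blocks:
  assumes "p \<noteq> q" "r \<noteq> s" "{p, q} \<inter> {r, s} = {}"
  shows "chi {{p, q}, {r, s}} = osgn p r * osgn p s * osgn q r * osgn q s"
  using chi_insert[OF pairing_on_block[OF assms(2)], of "{p, q}"] assms chi_block[OF assms(2)] by simp

text \<open>Exchanging two white labels keeps the other blocks and the label set, so by
  \<open>chi_Un\<close> everything outside the two affected blocks is a common factor
  \<open>?C\<close>. For two blocks, writing all comparisons in a common orientation leaves a single
  minus sign.\<close>

lemma match_sgn_transpose:
  assumes I: "finite I" "i \<in> I" "j \<in> I" "i \<noteq> j"
    and inj: "inj_on b I" "inj_on w I" "b ` I \<inter> w ` I = {}"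
  shows "match_sgn I b (w \<circ> Transposition.transpose i j) = - match_sgn I b w"
proof -
  let ?I = "I - {i, j}"
  have bw: "b k \<noteq> w l" "w l \<noteq> b k" if "k \<in> I" "l \<in> I" for k l using inj(3) that by auto
  have ne: "b i \<noteq> b j" "w i \<noteq> w j" using inj I by (auto dest: inj_onD)
  let ?C = "chi (match ?I b w) * (\<Prod>x\<in>b ` ?I \<union> w ` ?I. \<Prod>y\<in>{b i, w i, b j, w j}. osgn x y) * (\<Prod>k\<in>?I. osgn (b k) (w k))"
  have general: "match_sgn I b v = ?C * (chi {{b i, v i}, {b j, v j}} * osgn (b i) (v i) * osgn (b j) (v j))"
    if v: "inj_on v I" "v ` I = w ` I" "\<And>k. k \<in> ?I \<Longrightarrow> v k = w k" "{v i, v j} = {w i, w j}" for v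
  proof -
    have vb: "b ` I \<inter> v ` I = {}" using inj v by simp
    have M: "match I b v = match ?I b w \<union> {{b i, v i}, {b j, v j}}"
    proof -
      have "I = ?I \<union> {i, j}" using I by auto
      then have "match I b v = match ?I b v \<union> match {i, j} b v" unfolding match_def by (metis image_Un)
      moreover have "match ?I b v = match ?I b w" unfolding match_def by (rule image_cong) (simp_all add: v(3))
      ultimately show ?thesis by (simp add: match_def)
    qed
    have p1: "pairing_on (b ` ?I \<union> w ` ?I) (match ?I b w)"
      by (rule pairing_on_match) (use inj in \<open>auto intro: inj_on_subset\<close>)
    have "{i, j} \<subseteq> I" using I by simp
    then have "inj_on b {i, j}" "inj_on v {i, j}" "b ` {i, j} \<inter> v ` {i, j} = {}"
      using inj_on_subset[OF inj(1)] inj_on_subset[OF v(1)] vb by blast+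
    then have "pairing_on (b ` {i, j} \<union> v ` {i, j}) (match {i, j} b v)" by (rule pairing_on_match)
    moreover have "b ` {i, j} \<union> v ` {i, j} = {b i, w i, b j, w j}" using v(4) by auto
    moreover have "match {i, j} b v = {{b i, v i}, {b j, v j}}" by (simp add: match_def)
    ultimately have p2: "pairing_on {b i, w i, b j, w j} {{b i, v i}, {b j, v j}}" by simp
    have disj: "(b ` ?I \<union> w ` ?I) \<inter> {b i, w i, b j, w j} = {}"
    proof -
      have "b k \<noteq> b l" "w k \<noteq> w l" "b k \<noteq> w l" "w k \<noteq> b l" if "k \<in> ?I" "l \<in> {i, j}" for k l
        using that I inj_onD[OF inj(1), of k l] inj_onD[OF inj(2), of k l] bw[of k l] bw[of l k] by auto
      then show ?thesis by blast
    qed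
    have "chi (match I b v) = chi (match ?I b w) * chi {{b i, v i}, {b j, v j}} *
        (\<Prod>x\<in>b ` ?I \<union> w ` ?I. \<Prod>y\<in>{b i, w i, b j, w j}. osgn x y)"
      unfolding M by (rule chi_Un[OF p1 _ p2 _ disj]) (use I in auto)
    moreover have "(\<Prod>k\<in>I. osgn (b k) (v k)) = (\<Prod>k\<in>?I. osgn (b k) (w k)) * (osgn (b i) (v i) * osgn (b j) (v j))"
    proof -
      have "(\<Prod>k\<in>I. osgn (b k) (v k)) = (\<Prod>k\<in>?I. osgn (b k) (v k)) * (\<Prod>k\<in>{i, j}. osgn (b k) (v k))"
        by (rule prod.subset_diff) (use I in auto)
      moreover have "(\<Prod>k\<in>?I. osgn (b k) (v k)) = (\<Prod>k\<in>?I. osgn (b k) (w k))" using v(3) by (intro prod.cong) auto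
      ultimately show ?thesis using I by simp
    qed
    ultimately show ?thesis by (simp add: match_sgn_def mult_ac)
  qed
  have tr: "Transposition.transpose i j ` I = I" using I by (metis permutes_image permutes_swap_id)
  let ?v = "w \<circ> Transposition.transpose i j"
  have "match_sgn I b ?v = ?C * (chi {{b i, ?v i}, {b j, ?v j}} * osgn (b i) (?v i) * osgn (b j) (?v j))"
  proof (rule general)
    show "inj_on ?v I" using inj(2) tr by (intro comp_inj_on) (auto intro: inj_on_subset[OF inj_on_transpose])
    show "?v ` I = w ` I" using tr by (metis image_comp)
    show "?v k = w k" if "k \<in> ?I" for k using that by (simp add: transpose_apply_other)
    show "{?v i, ?v j} = {w i, w j}" by auto
  qed
  also have "\<dots> = ?C * (chi {{b i, w j}, {b j, w i}} * osgn (b i) (w j) * osgn (b j) (w i))" by simp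
  also have "chi {{b i, w j}, {b j, w i}} * osgn (b i) (w j) * osgn (b j) (w i) =
      - (chi {{b i, w i}, {b j, w j}} * osgn (b i) (w i) * osgn (b j) (w j))"
  proof -
    have "chi {{b i, w j}, {b j, w i}} = osgn (b i) (b j) * osgn (b i) (w i) * osgn (w j) (b j) * osgn (w j) (w i)"
      by (rule chi_two_blocks) (use bw ne I in auto)
    moreover have "chi {{b i, w i}, {b j, w j}} = osgn (b i) (b j) * osgn (b i) (w j) * osgn (w i) (b j) * osgn (w i) (w j)"
      by (rule chi_two_blocks) (use bw ne I in auto)
    moreover have "osgn (w j) (b j) = - osgn (b j) (w j)" "osgn (w i) (b j) = - osgn (b j) (w i)"
      "osgn (w j) (w i) = - osgn (w i) (w j)"
      using bw ne I by (auto intro!: osgn_swap)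
    ultimately show ?thesis by (simp add: mult_ac)
  qed
  also have "?C * - (chi {{b i, w i}, {b j, w j}} * osgn (b i) (w i) * osgn (b j) (w j)) = - match_sgn I b w"
    using general[OF inj(2)] by simp
  finally show ?thesis .
qed

lemma match_sgn_permutes:
  assumes "finite I" "p permutes I" and inj: "inj_on b I" "inj_on w I" "b ` I \<inter> w ` I = {}"
  shows "match_sgn I b (w \<circ> p) = sign p * match_sgn I b w"
  using assms(1,2)
proof (induction rule: permutes_rev_induct)
  case (swap i j p)
  have pI: "p ` I = I" using swap by (simp add: permutes_image)
  then have "b ` I \<inter> (w \<circ> p) ` I = {}" using inj(3) by (metis image_comp)
  moreover have "inj_on (w \<circ> p) I" using inj(2) pI swap by (intro comp_inj_on) (auto intro: permutes_inj_on)
  ultimately have "inj_on (w \<circ> p) I" "b ` I \<inter> (w \<circ> p) ` I = {}" by simp_all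
  then have "match_sgn I b ((w \<circ> p) \<circ> Transposition.transpose i j) = - match_sgn I b (w \<circ> p)"
    using match_sgn_transpose[OF assms(1) swap(1-3) inj(1)] by blast
  moreover have "sign (p \<circ> Transposition.transpose i j) = - sign p"
    using sign_compose[of p "Transposition.transpose i j"] permutation_swap_id[of i j] sign_swap_id[of i j]
      permutation_permutes[of p] swap assms(1) by auto
  ultimately show ?case using swap.IH by (simp only: comp_assoc mult_minus_left)
qed simp

text \<open>Induction on the last pair. For indices \<open>k < l\<close> the black-black and
  white-white comparisons cancel, and turning round the comparison of the later white with the
  earlier black label costs one minus sign; the exponent counts such index pairs.\<close>

lemma match_sgn_strict_mono:
  assumes "strict_mono_on {1..m} b" "strict_mono_on {1..m} w" "b ` {1..m} \<inter> w ` {1..m} = {}"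
  shows "match_sgn {1..m} b w = (- 1) ^ (\<Sum>k<m. k) * (\<Prod>k\<in>{1..m}. \<Prod>l\<in>{1..m}. osgn (b k) (w l))"
  using assms
proof (induction m)
  case 0
  show ?case by (simp add: match_sgn_def match_def)
next
  case (Suc m)
  let ?I = "{1..m}" and ?b = "b (Suc m)" and ?w = "w (Suc m)"
  have ins: "{1..Suc m} = insert (Suc m) ?I" by auto
  have mono: "strict_mono_on ?I b" "strict_mono_on ?I w"
    using Suc.prems by (auto simp: strict_mono_on_def)
  moreover have mono3: "b ` ?I \<inter> w ` ?I = {}"
    using Suc.prems(3) unfolding ins by auto
  ultimately have mono: "strict_mono_on ?I b" "strict_mono_on ?I w" "b ` ?I \<inter> w ` ?I = {}" by simp_all
  have bw: "b k \<noteq> w l" if "k \<in> {1..Suc m}" "l \<in> {1..Suc m}" for k l using Suc.prems(3) that by blast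
  have lt: "b k < ?b" "w k < ?w" if "k \<in> ?I" for k
    using that Suc.prems(1,2) by (auto simp: strict_mono_on_def)
  have injb: "inj_on b ?I" and injw: "inj_on w ?I" using mono strict_mono_on_imp_inj_on by blast+
  have "chi (match {1..Suc m} b w) = chi (match ?I b w) * (\<Prod>x\<in>{?b, ?w}. \<Prod>y\<in>b ` ?I \<union> w ` ?I. osgn x y)"
  proof -
    have "match {1..Suc m} b w = insert {?b, ?w} (match ?I b w)" unfolding match_def ins by (rule image_insert)
    moreover have "{?b, ?w} \<inter> (b ` ?I \<union> w ` ?I) = {}" using bw lt by fastforce
    ultimately show ?thesis
      using chi_insert[OF pairing_on_match[OF injb injw mono(3)], of "{?b, ?w}"] bw by simp
  qed
  also have "(\<Prod>x\<in>{?b, ?w}. \<Prod>y\<in>b ` ?I \<union> w ` ?I. osgn x y) =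
     (\<Prod>k\<in>?I. osgn ?b (b k) * osgn ?b (w k)) * (\<Prod>k\<in>?I. osgn ?w (b k) * osgn ?w (w k))"
  proof -
    have "(\<Prod>y\<in>b ` ?I \<union> w ` ?I. osgn x y) = (\<Prod>k\<in>?I. osgn x (b k) * osgn x (w k))" for x
      using mono(3) injb injw by (subst prod.union_disjoint) (auto simp: prod.reindex prod.distrib)
    moreover have "?b \<noteq> ?w" using bw by auto
    ultimately show ?thesis by simp
  qed
  also have "\<dots> = (\<Prod>k\<in>?I. - osgn ?b (w k) * osgn (b k) ?w)"
    unfolding prod.distrib[symmetric]
  proof (rule prod.cong[OF refl])
    fix k assume k: "k \<in> ?I"
    have "osgn ?b (b k) = - 1" "osgn ?w (w k) = - 1" using lt[OF k] by (auto simp: osgn_def)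
    moreover have "osgn ?w (b k) = - osgn (b k) ?w" using bw[of k "Suc m"] k by (auto intro!: osgn_swap)
    ultimately show "osgn ?b (b k) * osgn ?b (w k) * (osgn ?w (b k) * osgn ?w (w k)) = - osgn ?b (w k) * osgn (b k) ?w"
      by simp
  qed
  also have "\<dots> = (- 1) ^ m * ((\<Prod>k\<in>?I. osgn ?b (w k)) * (\<Prod>k\<in>?I. osgn (b k) ?w))"
    by (simp add: prod.distrib prod_uminus)
  finally have chi: "chi (match {1..Suc m} b w) = chi (match ?I b w) * ((- 1) ^ m * ((\<Prod>k\<in>?I. osgn ?b (w k)) * (\<Prod>k\<in>?I. osgn (b k) ?w)))" .
  have "match_sgn {1..Suc m} b w = match_sgn ?I b w * ((- 1) ^ m * ((\<Prod>k\<in>?I. osgn ?b (w k)) * (\<Prod>k\<in>?I. osgn (b k) ?w))) * osgn ?b ?w"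
    unfolding match_sgn_def chi unfolding ins by (simp add: mult_ac)
  also have "match_sgn ?I b w = (- 1) ^ (\<Sum>k<m. k) * (\<Prod>k\<in>?I. \<Prod>l\<in>?I. osgn (b k) (w l))"
    by (rule Suc.IH[OF mono])
  finally show ?case
    unfolding ins by (simp add: prod.distrib power_add mult_ac)
qed

text \<open>Each unordered pair of elements occurs in both orders and contributes -1.\<close>

lemma prod_osgn_off_diagonal:
  "finite A \<Longrightarrow> (\<Prod>x\<in>A. \<Prod>y\<in>A - {x}. osgn x y) = (- 1) ^ (\<Sum>k<card A. k)"
proof (induction A rule: finite_induct)
  case (insert z A)
  have "(\<Prod>x\<in>A. \<Prod>y\<in>insert z A - {x}. osgn x y) = (\<Prod>x\<in>A. osgn x z * (\<Prod>y\<in>A - {x}. osgn x y))"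
  proof (rule prod.cong[OF refl])
    fix x assume "x \<in> A"
    then have "insert z A - {x} = insert z (A - {x})" using insert.hyps by auto
    then show "(\<Prod>y\<in>insert z A - {x}. osgn x y) = osgn x z * (\<Prod>y\<in>A - {x}. osgn x y)"
      using insert.hyps by simp
  qed
  moreover have "insert z A - {z} = A" using insert.hyps by auto
  moreover have "(\<Prod>y\<in>A. osgn z y) * (\<Prod>x\<in>A. osgn x z) = (- 1) ^ card A"
  proof -
    have "(\<Prod>y\<in>A. osgn z y * osgn y z) = (\<Prod>y\<in>A. - 1)"
    proof (rule prod.cong[OF refl])
      fix y assume "y \<in> A"
      then have "z \<noteq> y" using insert.hyps by auto
      then show "osgn z y * osgn y z = - 1" using osgn_swap[of z y] by simp
    qed
    then show ?thesis by (simp add: prod.distrib)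
  qed
  ultimately show ?case using insert by (simp add: prod.distrib power_add mult_ac)
qed simp

text \<open>Position signs compare \<open>x\<close> with all of \<open>N\<close>; the comparisons
  inside \<open>A\<close> amount to the power of -1 from
  \<open>prod_osgn_off_diagonal\<close>.\<close>

lemma prod_osgn_cut:
  assumes "finite N" "A \<subseteq> N"
  shows "(\<Prod>x\<in>A. \<Prod>y\<in>N - A. osgn x y) = (- 1) ^ (\<Sum>k<card A. k) * (\<Prod>x\<in>A. pos_sgn N x)"
proof -
  have A: "finite A" using assms finite_subset by blast
  have "(\<Prod>x\<in>A. pos_sgn N x) = (\<Prod>x\<in>A. (\<Prod>y\<in>N - A. osgn x y) * (\<Prod>y\<in>A - {x}. osgn x y))"
  proof (rule prod.cong[OF refl])
    fix x assume "x \<in> A"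
    then have "N - {x} = (N - A) \<union> (A - {x})" "(N - A) \<inter> (A - {x}) = {}" using assms by auto
    then show "pos_sgn N x = (\<Prod>y\<in>N - A. osgn x y) * (\<Prod>y\<in>A - {x}. osgn x y)"
      unfolding pos_sgn_def using assms A by (simp add: prod.union_disjoint)
  qed
  also have "\<dots> = (\<Prod>x\<in>A. \<Prod>y\<in>N - A. osgn x y) * (- 1) ^ (\<Sum>k<card A. k)"
    by (simp add: prod.distrib prod_osgn_off_diagonal[OF A])
  finally show ?thesis by (simp add: mult_ac power_mult_distrib[symmetric] left_right_inverse_power)
qed

section \<open>The uncrossing rule\<close>

text \<open>A 2 by 2 minor of the matrix whose rows are the indicator of \<open>S\<close> and the
  constant 1, with the columns of the block in increasing order.\<close>

definition mem_sgn :: "nat set \<Rightarrow> nat set \<Rightarrow> int" where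
  "mem_sgn S B = of_bool (Min B \<in> S) - of_bool (Max B \<in> S)"

definition split_sgn :: "nat set \<Rightarrow> nat set set \<Rightarrow> int" where
  "split_sgn S P = chi P * (\<Prod>B\<in>P. mem_sgn S B)"

text \<open>For a pairing, this is exactly when no factor \<open>mem_sgn S B\<close>
  vanishes.\<close>

definition separates :: "nat set \<Rightarrow> nat set set \<Rightarrow> bool" where
  "separates S P \<longleftrightarrow> (\<forall>i j. {i, j} \<in> P \<longrightarrow> (i \<in> S \<longleftrightarrow> j \<notin> S))"

lemma mem_sgn_less: "x < y \<Longrightarrow> mem_sgn S {x, y} = of_bool (x \<in> S) - of_bool (y \<in> S)"
  by (simp add: mem_sgn_def min_def max_def)

lemma mem_sgn_osgn:
  assumes "x \<noteq> y"
  shows "mem_sgn S {x, y} = osgn x y * (of_bool (x \<in> S) - of_bool (y \<in> S))"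
proof (cases "x < y")
  case True
  then show ?thesis by (simp add: mem_sgn_less osgn_def)
next
  case False
  then have "mem_sgn S {y, x} = of_bool (y \<in> S) - of_bool (x \<in> S)" using assms by (intro mem_sgn_less) simp
  then show ?thesis using False by (simp add: osgn_def insert_commute)
qed

lemma pairing_on_two:
  assumes "distinct [p, q, r, s]"
  shows "pairing_on {p, q, r, s} {{p, q}, {r, s}}"
  using pairing_on_Un[OF pairing_on_block[of p q] pairing_on_block[of r s]] assms by (auto simp: insert_commute)

text \<open>Isolates a factor that is the same for all three ways of pairing four given
  labels.\<close>

lemma split_sgn_two:
  assumes R: "pairing_on A R" "finite A" and d: "distinct [p, q, r, s]" "{p, q, r, s} \<inter> A = {}"
  shows "split_sgn S (R \<union> {{p, q}, {r, s}}) =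
    (chi R * (\<Prod>B\<in>R. mem_sgn S B) * (\<Prod>x\<in>A. \<Prod>y\<in>{p, q, r, s}. osgn x y)) *
    (osgn p r * osgn p s * osgn q r * osgn q s * mem_sgn S {p, q} * mem_sgn S {r, s})"
proof -
  have "chi (R \<union> {{p, q}, {r, s}}) = chi R * chi {{p, q}, {r, s}} * (\<Prod>x\<in>A. \<Prod>y\<in>{p, q, r, s}. osgn x y)"
    by (rule chi_Un[OF R pairing_on_two[OF d(1)]]) (use d(2) in auto)
  moreover have "chi {{p, q}, {r, s}} = osgn p r * osgn p s * osgn q r * osgn q s"
    by (rule chi_two_blocks) (use d(1) in auto)
  moreover have "(\<Prod>B\<in>R \<union> {{p, q}, {r, s}}. mem_sgn S B) = (\<Prod>B\<in>R. mem_sgn S B) * (mem_sgn S {p, q} * mem_sgn S {r, s})"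
  proof -
    have "R \<inter> {{p, q}, {r, s}} = {}" using pairing_onD(2)[OF R(1)] d(2) by blast
    moreover have "{p, q} \<noteq> {r, s}" using d(1) by (auto simp: doubleton_eq_iff)
    ultimately show ?thesis using finite_pairing[OF R(2,1)] by (subst prod.union_disjoint) auto
  qed
  ultimately show ?thesis by (simp add: split_sgn_def mult_ac)
qed

text \<open>After cancelling the common factor this is the three-term relation of the minors, ac *
  bd = ab * cd + ad * bc; the crossing on the left supplies the minus sign of the rule.\<close>

lemma split_sgn_uncross:
  assumes R: "pairing_on A R" "finite A" and ord: "a < b" "b < c" "c < d" and disj: "{a, b, c, d} \<inter> A = {}"
  shows "split_sgn S (R \<union> {{a, c}, {b, d}}) = - split_sgn S (R \<union> {{a, b}, {c, d}}) - split_sgn S (R \<union> {{a, d}, {b, c}})"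
proof -
  let ?C = "chi R * (\<Prod>B\<in>R. mem_sgn S B) * (\<Prod>x\<in>A. \<Prod>y\<in>{a, b, c, d}. osgn x y)"
  have sets: "{a, c, b, d} = {a, b, c, d}" "{a, d, b, c} = {a, b, c, d}" by auto
  have e1: "split_sgn S (R \<union> {{a, c}, {b, d}}) = ?C * (- (mem_sgn S {a, c} * mem_sgn S {b, d}))"
    using split_sgn_two[OF R, of a c b d S, unfolded sets] ord disj by (simp add: osgn_def)
  have e2: "split_sgn S (R \<union> {{a, b}, {c, d}}) = ?C * (mem_sgn S {a, b} * mem_sgn S {c, d})"
    using split_sgn_two[OF R, of a b c d S] ord disj by (simp add: osgn_def)
  have e3: "split_sgn S (R \<union> {{a, d}, {b, c}}) = ?C * (mem_sgn S {a, d} * mem_sgn S {b, c})"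
    using split_sgn_two[OF R, of a d b c S, unfolded sets] ord disj by (simp add: osgn_def)
  have "mem_sgn S {a, c} * mem_sgn S {b, d} = mem_sgn S {a, b} * mem_sgn S {c, d} + mem_sgn S {a, d} * mem_sgn S {b, c}"
    using ord by (simp add: mem_sgn_less algebra_simps)
  then show ?thesis unfolding e1 e2 e3 by (simp only:) (simp add: algebra_simps)
qed

text \<open>Reorienting each block from smaller-larger to the order given by \<open>b\<close> and
  \<open>w\<close> produces the factors that turn \<open>chi\<close> into
  \<open>match_sgn\<close>.\<close>

lemma split_sgn_match:
  assumes "finite I" "inj_on b I" "inj_on w I" "b ` I \<inter> w ` I = {}"
  shows "split_sgn S (match I b w) = match_sgn I b w * (\<Prod>k\<in>I. of_bool (b k \<in> S) - of_bool (w k \<in> S))"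
proof -
  have "(\<Prod>B\<in>match I b w. mem_sgn S B) = (\<Prod>k\<in>I. mem_sgn S {b k, w k})"
    unfolding match_def by (simp add: prod.reindex[OF inj_on_match[OF assms(2,4)]])
  also have "\<dots> = (\<Prod>k\<in>I. osgn (b k) (w k) * (of_bool (b k \<in> S) - of_bool (w k \<in> S)))"
    using assms(4) by (intro prod.cong refl mem_sgn_osgn) auto
  finally show ?thesis by (simp add: split_sgn_def match_sgn_def prod.distrib mult_ac)
qed

lemma bw_pairing_match:
  fixes n :: nat
  assumes P: "P \<in> bw_pairings K N" and K: "K \<subseteq> N"
    and b: "bij_betw b {1..n} K" and w: "bij_betw w {1..n} (N - K)"
    and th: "\<And>i. i \<in> {1..n} \<Longrightarrow> \<theta> i \<in> {1..n} \<and> w (\<theta> i) = partner P (b i)" "\<And>i. i \<notin> {1..n} \<Longrightarrow> \<theta> i = i"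
  shows "\<theta> permutes {1..n}" "P = match {1..n} b (w \<circ> \<theta>)"
proof -
  let ?I = "{1..n}"
  have PN: "pairing_on N P" using P by (simp add: bw_pairings_def)
  have bK: "b i \<in> K" "b i \<in> N" if "i \<in> ?I" for i using b K that by (auto simp: bij_betw_def)
  have pt: "{b i, w (\<theta> i)} \<in> P" if "i \<in> ?I" for i
    using bw_pairings_partner(1)[OF P bK(2)[OF that] bK(1)[OF that]] th(1)[OF that] by simp
  have inj: "inj_on \<theta> ?I"
  proof (rule inj_onI)
    fix i j assume ij: "i \<in> ?I" "j \<in> ?I" "\<theta> i = \<theta> j"
    have "{w (\<theta> i), b i} \<in> P" "{w (\<theta> i), b j} \<in> P" using pt[OF ij(1)] pt[OF ij(2)] ij(3) by (simp_all add: insert_commute)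
    then have "b i = b j" by (rule pairing_unique[OF PN])
    then show "i = j" by (rule inj_onD[OF bij_betw_imp_inj_on[OF b] _ ij(1,2)])
  qed
  moreover have "\<theta> ` ?I \<subseteq> ?I" using th(1) by auto
  ultimately have "bij_betw \<theta> ?I ?I" by (simp add: bij_betw_def endo_inj_surj)
  then show "\<theta> permutes ?I" using th(2) by (intro bij_imp_permutes)
  show "P = match ?I b (w \<circ> \<theta>)"
  proof (intro equalityI subsetI)
    fix B assume B: "B \<in> P"
    then obtain b' w' where B': "B = {b', w'}" "b' \<in> K" using P unfolding bw_pairings_def by blast
    then obtain k where k: "k \<in> ?I" "b' = b k" using b by (auto simp: bij_betw_def)
    have "w' = w (\<theta> k)" using pairing_unique[OF PN, of "b k" w' "w (\<theta> k)"] B B' k pt by auto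
    then show "B \<in> match ?I b (w \<circ> \<theta>)" using B' k by (auto simp: match_def)
  next
    fix B assume "B \<in> match ?I b (w \<circ> \<theta>)"
    then show "B \<in> P" using pt by (auto simp: match_def)
  qed
qed

text \<open>Permuting the white labels contributes \<open>sign \<theta>\<close>; for increasing
  enumerations the powers of -1 from \<open>match_sgn_strict_mono\<close> and
  \<open>prod_osgn_cut\<close> cancel and leave the position signs of \<open>K\<close>. A separated
  pair gives 1 or -1 according to whether its end in \<open>K\<close> is in \<open>S\<close>. The
  set \<open>K\<close> is free because the result is used for the odd labels as well as for the
  black ones.\<close>

lemma bw_split_sgn:
  fixes n :: nat
  assumes P: "P \<in> bw_pairings K N" and K: "K \<subseteq> N" and N: "finite N"
    and b: "bij_betw b {1..n} K" "strict_mono_on {1..n} b"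
    and w: "bij_betw w {1..n} (N - K)" "strict_mono_on {1..n} w"
    and th: "\<And>i. i \<in> {1..n} \<Longrightarrow> \<theta> i \<in> {1..n} \<and> w (\<theta> i) = partner P (b i)" "\<And>i. i \<notin> {1..n} \<Longrightarrow> \<theta> i = i"
  shows "split_sgn S P = sign \<theta> * (\<Prod>x\<in>K. pos_sgn N x) *
    (if separates S P then \<Prod>x\<in>K. if x \<in> S then 1 else - 1 else 0)"
proof -
  let ?I = "{1..n}"
  have m: "\<theta> permutes ?I" "P = match ?I b (w \<circ> \<theta>)"
    using bw_pairing_match[OF P K b(1) w(1), of \<theta>] th by blast+
  have img: "b ` ?I = K" "w ` ?I = N - K" and inj: "inj_on b ?I" "inj_on w ?I"
    using b w by (auto simp: bij_betw_def)
  have thI: "\<theta> ` ?I = ?I" using m(1) by (rule permutes_image)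
  have wth: "inj_on (w \<circ> \<theta>) ?I" "b ` ?I \<inter> (w \<circ> \<theta>) ` ?I = {}"
  proof -
    show "inj_on (w \<circ> \<theta>) ?I" using inj(2) thI m(1) by (intro comp_inj_on) (auto intro: permutes_inj_on)
    have "(w \<circ> \<theta>) ` ?I = N - K" using thI img by (metis image_comp)
    then show "b ` ?I \<inter> (w \<circ> \<theta>) ` ?I = {}" using img by auto
  qed
  have cardK: "card K = n" using bij_betw_same_card[OF b(1)] by simp
  have "match_sgn ?I b w = (- 1) ^ (\<Sum>k<n. k) * (\<Prod>k\<in>?I. \<Prod>l\<in>?I. osgn (b k) (w l))"
    by (rule match_sgn_strict_mono[OF b(2) w(2)]) (use img in auto)
  also have "(\<Prod>k\<in>?I. \<Prod>l\<in>?I. osgn (b k) (w l)) = (\<Prod>x\<in>K. \<Prod>y\<in>N - K. osgn x y)"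
    unfolding prod.reindex_bij_betw[OF b(1), of "\<lambda>x. \<Prod>l\<in>?I. osgn x (w l)"]
    by (rule prod.cong[OF refl]) (rule prod.reindex_bij_betw[OF w(1)])
  also have "\<dots> = (- 1) ^ (\<Sum>k<n. k) * (\<Prod>x\<in>K. pos_sgn N x)"
    using prod_osgn_cut[OF N K] cardK by simp
  finally have base: "match_sgn ?I b w = (\<Prod>x\<in>K. pos_sgn N x)"
    by (simp add: power_mult_distrib[symmetric] mult.assoc[symmetric])
  have "match_sgn ?I b (w \<circ> \<theta>) = sign \<theta> * (\<Prod>x\<in>K. pos_sgn N x)"
    using match_sgn_permutes[OF _ m(1) inj] img base by auto
  then have "split_sgn S P = sign \<theta> * (\<Prod>x\<in>K. pos_sgn N x) * (\<Prod>k\<in>?I. of_bool (b k \<in> S) - of_bool ((w \<circ> \<theta>) k \<in> S))"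
    using split_sgn_match[OF _ inj(1) wth, of S] m(2) by simp
  also have "(\<Prod>k\<in>?I. of_bool (b k \<in> S) - of_bool ((w \<circ> \<theta>) k \<in> S)) =
     (if separates S P then \<Prod>x\<in>K. if x \<in> S then 1 else - 1 else (0::int))"
  proof (cases "separates S P")
    case True
    have "(b k \<in> S) \<longleftrightarrow> (w \<circ> \<theta>) k \<notin> S" if "k \<in> ?I" for k
    proof -
      have "{b k, (w \<circ> \<theta>) k} \<in> P" using that m(2) by (auto simp: match_def)
      then show ?thesis using True unfolding separates_def by blast
    qed
    then have "(\<Prod>k\<in>?I. of_bool (b k \<in> S) - of_bool ((w \<circ> \<theta>) k \<in> S)) = (\<Prod>k\<in>?I. if b k \<in> S then 1 else (- 1::int))"
      by (intro prod.cong refl) auto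
    then show ?thesis using True prod.reindex_bij_betw[OF b(1), of "\<lambda>x. if x \<in> S then 1 else (- 1::int)"] by simp
  next
    case False
    then obtain i j where ij: "{i, j} \<in> P" "(i \<in> S) = (j \<in> S)" unfolding separates_def by blast
    then obtain k where "k \<in> ?I" "{i, j} = {b k, (w \<circ> \<theta>) k}" using m(2) by (auto simp: match_def)
    then have "of_bool (b k \<in> S) - of_bool ((w \<circ> \<theta>) k \<in> S) = (0::int)" using ij(2) by (auto simp: doubleton_eq_iff)
    then have "\<exists>k\<in>?I. of_bool (b k \<in> S) - of_bool ((w \<circ> \<theta>) k \<in> S) = (0::int)" using \<open>k \<in> ?I\<close> by blast
    then have "(\<Prod>k\<in>?I. of_bool (b k \<in> S) - of_bool ((w \<circ> \<theta>) k \<in> S)) = (0::int)"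
      by (rule prod_zero[OF finite_atLeastAtMost])
    then show ?thesis using False by (simp only: if_False)
  qed
  finally show ?thesis .
qed

section \<open>Termination of the reduction\<close>

text \<open>Concave in the chord length, so that two crossing chords on a circle of \<open>L\<close> points have more energy
  than either pair of opposite sides of their quadrilateral.\<close>
definition chord_energy :: "nat \<Rightarrow> nat set set \<Rightarrow> nat" where
  "chord_energy L P = (\<Sum>B\<in>P. (Max B - Min B) * (L - (Max B - Min B)))"

text \<open>Collects what one application of the rule does: it yields pairings again, lowers the
  energy and respects \<open>split_sgn\<close>.\<close>

lemma uncross_pairing:
  assumes P: "pairing_on N P" and N: "N \<subseteq> {1..L}" and ord: "a < b" "b < c" "c < d"
    and ac: "{a, c} \<in> P" and bd: "{b, d} \<in> P"
  defines "R \<equiv> P - {{a, c}, {b, d}}"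
  shows "pairing_on N (R \<union> {{a, b}, {c, d}})" "pairing_on N (R \<union> {{a, d}, {b, c}})"
    "chord_energy L (R \<union> {{a, b}, {c, d}}) < chord_energy L P"
    "chord_energy L (R \<union> {{a, d}, {b, c}}) < chord_energy L P"
    "split_sgn S P = - split_sgn S (R \<union> {{a, b}, {c, d}}) - split_sgn S (R \<union> {{a, d}, {b, c}})"
proof -
  have finN: "finite N" using N finite_subset by blast
  have abcd: "{a, b, c, d} \<subseteq> N" using pairing_mem[OF P ac] pairing_mem[OF P bd] by auto
  have "\<Union>{{a, c}, {b, d}} = {a, b, c, d}" by auto
  then have R: "pairing_on (N - {a, b, c, d}) R"
    using pairing_on_Diff[OF P, of "{{a, c}, {b, d}}"] ac bd by (simp add: R_def)
  have PR: "P = R \<union> {{a, c}, {b, d}}" using ac bd by (auto simp: R_def)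
  have fin: "finite (N - {a, b, c, d})" "{a, b, c, d} \<inter> (N - {a, b, c, d}) = {}" using finN by auto
  have NN: "N - {a, b, c, d} \<union> {a, b, c, d} = N" using abcd by auto
  have "pairing_on (N - {a, b, c, d} \<union> {a, b, c, d}) (R \<union> {{a, b}, {c, d}})"
    by (rule pairing_on_Un[OF R pairing_on_two]) (use ord in auto)
  then show "pairing_on N (R \<union> {{a, b}, {c, d}})" unfolding NN .
  have "pairing_on (N - {a, b, c, d} \<union> {a, d, b, c}) (R \<union> {{a, d}, {b, c}})"
    by (rule pairing_on_Un[OF R pairing_on_two]) (use ord in auto)
  moreover have "{a, d, b, c} = {a, b, c, d}" by auto
  ultimately show "pairing_on N (R \<union> {{a, d}, {b, c}})" using NN by simp
  show "split_sgn S P = - split_sgn S (R \<union> {{a, b}, {c, d}}) - split_sgn S (R \<union> {{a, d}, {b, c}})"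
    by (subst PR) (rule split_sgn_uncross[OF R fin(1) ord fin(2)])
  have e: "chord_energy L (R \<union> {{p, q}, {r, s}}) = chord_energy L R + ((q - p) * (L - (q - p)) + (s - r) * (L - (s - r)))"
    if "p < q" "r < s" "distinct [p, q, r, s]" "{p, q, r, s} = {a, b, c, d}" for p q r s
  proof -
    have "R \<inter> {{p, q}, {r, s}} = {}" using pairing_onD(2)[OF R] that(4) by fastforce
    moreover have "finite R" using finite_pairing[OF fin(1) R] .
    moreover have "{p, q} \<noteq> {r, s}" using that(3) by (auto simp: doubleton_eq_iff)
    ultimately have "chord_energy L (R \<union> {{p, q}, {r, s}}) = chord_energy L R +
        ((Max {p, q} - Min {p, q}) * (L - (Max {p, q} - Min {p, q})) + (Max {r, s} - Min {r, s}) * (L - (Max {r, s} - Min {r, s})))"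
      unfolding chord_energy_def by (subst sum.union_disjoint) simp_all
    moreover have "Max {p, q} = q" "Min {p, q} = p" "Max {r, s} = s" "Min {r, s} = r" using that(1,2) by (simp_all add: max_def min_def)
    ultimately show ?thesis by simp
  qed
  \<comment> \<open>The four arcs between consecutive ends on the circle of \<open>L\<close> points.
    The closing arc \<open>t\<close> is positive because labels start at 1 and stop at
    \<open>L\<close>.\<close>
  obtain p q r t where gaps: "b = a + p" "c = b + q" "d = c + r" "L = p + q + r + t" "p > 0" "q > 0" "r > 0" "t > 0"
  proof
    show "b = a + (b - a)" "c = b + (c - b)" "d = c + (d - c)" "b - a > 0" "c - b > 0" "d - c > 0" using ord by auto
    have "a \<ge> 1" "d \<le> L" using abcd N by auto
    then show "L = (b - a) + (c - b) + (d - c) + (L - (d - a))" "L - (d - a) > 0" using ord by auto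
  qed
  have E0: "chord_energy L P = chord_energy L R + ((p + q) * (r + t) + (q + r) * (p + t))"
  proof -
    have "{a, c, b, d} = {a, b, c, d}" by auto
    then have "chord_energy L (R \<union> {{a, c}, {b, d}}) = chord_energy L R + ((c - a) * (L - (c - a)) + (d - b) * (L - (d - b)))"
      using ord by (intro e) auto
    moreover have "c - a = p + q" "L - (c - a) = r + t" "d - b = q + r" "L - (d - b) = p + t" using gaps by auto
    ultimately show ?thesis by (subst PR) simp
  qed
  have E1: "chord_energy L (R \<union> {{a, b}, {c, d}}) = chord_energy L R + (p * (q + r + t) + r * (p + q + t))"
  proof -
    have "chord_energy L (R \<union> {{a, b}, {c, d}}) = chord_energy L R + ((b - a) * (L - (b - a)) + (d - c) * (L - (d - c)))"
      using ord by (intro e) auto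
    moreover have "b - a = p" "L - (b - a) = q + r + t" "d - c = r" "L - (d - c) = p + q + t" using gaps by auto
    ultimately show ?thesis by simp
  qed
  have E2: "chord_energy L (R \<union> {{a, d}, {b, c}}) = chord_energy L R + ((p + q + r) * t + q * (p + r + t))"
  proof -
    have "{a, d, b, c} = {a, b, c, d}" by auto
    then have "chord_energy L (R \<union> {{a, d}, {b, c}}) = chord_energy L R + ((d - a) * (L - (d - a)) + (c - b) * (L - (c - b)))"
      using ord by (intro e) auto
    moreover have "d - a = p + q + r" "L - (d - a) = t" "c - b = q" "L - (c - b) = p + r + t" using gaps by auto
    ultimately show ?thesis by simp
  qed
  have lt: "z + x < z + y" if "x + 2 * u = y" "u > 0" for x y z u :: nat using that by simp
  \<comment> \<open>The energy drops by twice the product of two opposite arcs, here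
    \<open>q\<close> and \<open>t\<close>, and \<open>p\<close> and \<open>r\<close> for the other
    resolution.\<close>
  have "p * (q + r + t) + r * (p + q + t) + 2 * (q * t) = (p + q) * (r + t) + (q + r) * (p + t)"
    by (simp add: algebra_simps)
  then show "chord_energy L (R \<union> {{a, b}, {c, d}}) < chord_energy L P"
    unfolding E0 E1 by (rule lt) (use gaps in simp)
  have "(p + q + r) * t + q * (p + r + t) + 2 * (p * r) = (p + q) * (r + t) + (q + r) * (p + t)"
    by (simp add: algebra_simps)
  then show "chord_energy L (R \<union> {{a, d}, {b, c}}) < chord_energy L P"
    unfolding E0 E2 by (rule lt) (use gaps in simp)
qed

text \<open>The linear extension of \<open>split_sgn S\<close> to formal combinations is invariant,
  because \<open>split_sgn S\<close> itself obeys the rule that the step applies.\<close>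

lemma red_step_pairings:
  assumes f: "red_step f g" and supp: "\<And>\<tau>. f \<tau> \<noteq> 0 \<Longrightarrow> pairing_on {1..L} \<tau>"
  shows "g \<tau> \<noteq> 0 \<Longrightarrow> pairing_on {1..L} \<tau>"
    and "(\<Sum>\<tau> | pairing_on {1..L} \<tau>. g \<tau> * split_sgn S \<tau>) = (\<Sum>\<tau> | pairing_on {1..L} \<tau>. f \<tau> * split_sgn S \<tau>)"
proof -
  obtain \<rho> a b c d where ne: "f \<rho> \<noteq> 0" and ord: "a < b" "b < c" "c < d" and ac: "{a, c} \<in> \<rho>" and bd: "{b, d} \<in> \<rho>"
    and g: "g = (\<lambda>\<tau>. f \<tau> - (if \<tau> = \<rho> then f \<rho> else 0)
      - (if \<tau> = \<rho> - {{a, c}, {b, d}} \<union> {{a, b}, {c, d}} then f \<rho> else 0)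
      - (if \<tau> = \<rho> - {{a, c}, {b, d}} \<union> {{a, d}, {b, c}} then f \<rho> else 0))"
    using f unfolding red_step_def Let_def by blast
  define \<rho>1 \<rho>2 where "\<rho>1 = \<rho> - {{a, c}, {b, d}} \<union> {{a, b}, {c, d}}" and "\<rho>2 = \<rho> - {{a, c}, {b, d}} \<union> {{a, d}, {b, c}}"
  have P: "pairing_on {1..L} \<rho>" using supp ne by blast
  note u = uncross_pairing[OF P order_refl ord ac bd, folded \<rho>1_def \<rho>2_def]
  note g = g[folded \<rho>1_def \<rho>2_def]
  show "g \<tau> \<noteq> 0 \<Longrightarrow> pairing_on {1..L} \<tau>"
    using P u(1,2) supp[of \<tau>] unfolding g by (auto split: if_splits)
  let ?P = "{\<tau>. pairing_on {1..L} \<tau>}"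
  have fin: "finite ?P" by (rule finite_pairings) simp
  have one: "(\<Sum>\<tau>\<in>?P. (if \<tau> = \<pi> then f \<rho> else 0) * split_sgn S \<tau>) = f \<rho> * split_sgn S \<pi>" if "pairing_on {1..L} \<pi>" for \<pi>
  proof -
    have "(\<Sum>\<tau>\<in>?P. (if \<tau> = \<pi> then f \<rho> else 0) * split_sgn S \<tau>) = (\<Sum>\<tau>\<in>?P. if \<tau> = \<pi> then f \<rho> * split_sgn S \<tau> else 0)"
      by (intro sum.cong) auto
    then show ?thesis using fin that by simp
  qed
  have "(\<Sum>\<tau>\<in>?P. g \<tau> * split_sgn S \<tau>) = (\<Sum>\<tau>\<in>?P. f \<tau> * split_sgn S \<tau>)
     - f \<rho> * split_sgn S \<rho> - f \<rho> * split_sgn S \<rho>1 - f \<rho> * split_sgn S \<rho>2"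
    unfolding g left_diff_distrib sum_subtractf one[OF P] one[OF u(1)] one[OF u(2)] ..
  also have "split_sgn S \<rho> = - split_sgn S \<rho>1 - split_sgn S \<rho>2" by (rule u(5))
  finally show "(\<Sum>\<tau>\<in>?P. g \<tau> * split_sgn S \<tau>) = (\<Sum>\<tau>\<in>?P. f \<tau> * split_sgn S \<tau>)"
    by (simp add: algebra_simps)
qed

text \<open>A step removes one pairing and adds at most two of smaller energy, so the sum of 3 to the energy drops.\<close>
lemma reduction_terminates:
  assumes "\<And>\<tau>. f \<tau> \<noteq> 0 \<Longrightarrow> pairing_on {1..L} \<tau>"
  shows "\<exists>g. red_step\<^sup>*\<^sup>* f g \<and> (\<forall>\<tau>. g \<tau> \<noteq> 0 \<longrightarrow> planar_pairing \<tau>)"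
  using assms
proof (induction "\<Sum>\<tau> | pairing_on {1..L} \<tau> \<and> f \<tau> \<noteq> 0. (3::nat) ^ chord_energy L \<tau>" arbitrary: f rule: less_induct)
  case less
  show ?case
  proof (cases "\<forall>\<tau>. f \<tau> \<noteq> 0 \<longrightarrow> planar_pairing \<tau>")
    case True
    then show ?thesis by blast
  next
    case False
    then obtain \<rho> where ne: "f \<rho> \<noteq> 0" and "\<not> planar_pairing \<rho>" by blast
    then obtain a b c d where ord: "a < b" "b < c" "c < d" and ac: "{a, c} \<in> \<rho>" and bd: "{b, d} \<in> \<rho>"
      unfolding planar_pairing_def by blast
    define \<rho>1 \<rho>2 where "\<rho>1 = \<rho> - {{a, c}, {b, d}} \<union> {{a, b}, {c, d}}" and "\<rho>2 = \<rho> - {{a, c}, {b, d}} \<union> {{a, d}, {b, c}}"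
    have P: "pairing_on {1..L} \<rho>" using less.prems ne by blast
    note u = uncross_pairing[OF P order_refl ord ac bd, folded \<rho>1_def \<rho>2_def]
    define g where "g = (\<lambda>\<tau>. f \<tau> - (if \<tau> = \<rho> then f \<rho> else 0)
      - (if \<tau> = \<rho>1 then f \<rho> else 0) - (if \<tau> = \<rho>2 then f \<rho> else 0))"
    have step: "red_step f g"
      unfolding red_step_def Let_def
      by (intro exI[of _ \<rho>] exI[of _ a] exI[of _ b] exI[of _ c] exI[of _ d] conjI ne ord ac bd)
        (simp add: g_def \<rho>1_def \<rho>2_def)
    let ?supp = "\<lambda>f::nat set set \<Rightarrow> int. {\<tau>. pairing_on {1..L} \<tau> \<and> f \<tau> \<noteq> 0}"
    let ?w = "\<lambda>\<tau>. (3::nat) ^ chord_energy L \<tau>"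
    have fin: "finite (?supp h)" for h
      by (rule finite_subset[OF _ finite_pairings[of "{1..L}"]]) auto
    have neq: "\<rho> \<noteq> \<rho>1" "\<rho> \<noteq> \<rho>2" using u(3,4) by auto
    \<comment> \<open>Possibly a proper inclusion, since the new coefficients may cancel those
      already present at \<open>\<rho>1\<close> and \<open>\<rho>2\<close>.\<close>
    have sub: "?supp g \<subseteq> (?supp f - {\<rho>}) \<union> {\<rho>1, \<rho>2}"
      using neq by (auto simp: g_def split: if_splits)
    have "sum ?w (?supp g) \<le> sum ?w ((?supp f - {\<rho>}) \<union> {\<rho>1, \<rho>2})"
      by (rule sum_mono2[OF _ sub]) (use fin in auto)
    also have "\<dots> \<le> sum ?w (?supp f - {\<rho>}) + sum ?w {\<rho>1, \<rho>2}"
      using fin by (intro sum_Un_nat[THEN eq_imp_le, THEN le_trans]) auto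
    also have "sum ?w {\<rho>1, \<rho>2} \<le> ?w \<rho>1 + ?w \<rho>2"
      by (cases "\<rho>1 = \<rho>2") auto
    also have "?w \<rho>1 + ?w \<rho>2 < ?w \<rho>"
    proof -
      \<comment> \<open>Base 3 gives strictness: two terms of energy at most \<open>k\<close> weigh
        at most \<open>2 * 3 ^ k\<close>, less than \<open>3 ^ Suc k\<close>; base 2 could give
        equality.\<close>
      obtain k where k: "chord_energy L \<rho> = Suc k" using u(3) by (cases "chord_energy L \<rho>") auto
      have "?w \<rho>1 \<le> 3 ^ k" "?w \<rho>2 \<le> 3 ^ k" using u(3,4) k by (auto intro!: power_increasing)
      moreover have "(0::nat) < 3 ^ k" by simp
      ultimately show ?thesis unfolding k power_Suc by linarith
    qed
    also have "sum ?w (?supp f - {\<rho>}) + ?w \<rho> = sum ?w (?supp f)"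
      using sum.remove[of "?supp f" \<rho> ?w] fin P ne by simp
    finally have "sum ?w (?supp g) < sum ?w (?supp f)" by simp
    then obtain h where "red_step\<^sup>*\<^sup>* g h" "\<forall>\<tau>. h \<tau> \<noteq> 0 \<longrightarrow> planar_pairing \<tau>"
      using less.hyps[of g] red_step_pairings(1)[OF step less.prems] by blast
    then show ?thesis using step by (meson converse_rtranclp_into_rtranclp)
  qed
qed

text \<open>The functional starts with the value \<open>split_sgn S \<rho>\<close> and keeps it
  until the support is planar. This holds for every terminal combination, hence for the chosen one,
  which exists by \<open>reduction_terminates\<close>.\<close>

lemma Pcoef_split_sgn:
  assumes P: "pairing_on {1..L} \<rho>"
  shows "(\<Sum>\<sigma> | pairing_on {1..L} \<sigma> \<and> planar_pairing \<sigma>. Pcoef \<sigma> \<rho> * split_sgn S \<sigma>) = split_sgn S \<rho>"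
proof -
  let ?d = "\<lambda>\<tau>. if \<tau> = \<rho> then 1 else (0::int)" and ?P = "{\<tau>. pairing_on {1..L} \<tau>}"
  define f where "f = (SOME f. red_step\<^sup>*\<^sup>* ?d f \<and> (\<forall>\<tau>. f \<tau> \<noteq> 0 \<longrightarrow> planar_pairing \<tau>))"
  have "\<exists>f. red_step\<^sup>*\<^sup>* ?d f \<and> (\<forall>\<tau>. f \<tau> \<noteq> 0 \<longrightarrow> planar_pairing \<tau>)"
    by (rule reduction_terminates[of _ L]) (use P in \<open>auto split: if_splits\<close>)
  then have f: "red_step\<^sup>*\<^sup>* ?d f" "\<And>\<tau>. f \<tau> \<noteq> 0 \<Longrightarrow> planar_pairing \<tau>"
  proof -
    assume "\<exists>f. red_step\<^sup>*\<^sup>* ?d f \<and> (\<forall>\<tau>. f \<tau> \<noteq> 0 \<longrightarrow> planar_pairing \<tau>)"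
    then have "red_step\<^sup>*\<^sup>* ?d f \<and> (\<forall>\<tau>. f \<tau> \<noteq> 0 \<longrightarrow> planar_pairing \<tau>)"
      unfolding f_def by (rule someI_ex)
    then show "red_step\<^sup>*\<^sup>* ?d f" "\<And>\<tau>. f \<tau> \<noteq> 0 \<Longrightarrow> planar_pairing \<tau>" by blast+
  qed
  have fin: "finite ?P" by (rule finite_pairings) simp
  have "(\<forall>\<tau>. f \<tau> \<noteq> 0 \<longrightarrow> pairing_on {1..L} \<tau>) \<and> (\<Sum>\<tau>\<in>?P. f \<tau> * split_sgn S \<tau>) = split_sgn S \<rho>"
    using f(1)
  proof (induction rule: rtranclp_induct)
    case base
    have "(\<Sum>\<tau>\<in>?P. ?d \<tau> * split_sgn S \<tau>) = (\<Sum>\<tau>\<in>?P. if \<tau> = \<rho> then split_sgn S \<tau> else 0)"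
      by (intro sum.cong) auto
    then show ?case using P fin by simp
  next
    case (step g h)
    then have supp: "\<And>\<tau>. g \<tau> \<noteq> 0 \<Longrightarrow> pairing_on {1..L} \<tau>" by blast
    then show ?case using red_step_pairings[OF step.hyps(2) supp] step.IH by auto
  qed
  then have "split_sgn S \<rho> = (\<Sum>\<tau>\<in>?P. f \<tau> * split_sgn S \<tau>)" by simp
  also have "\<dots> = (\<Sum>\<tau> | pairing_on {1..L} \<tau> \<and> planar_pairing \<tau>. f \<tau> * split_sgn S \<tau>)"
    by (rule sum.mono_neutral_right[OF fin]) (use f(2) in auto)
  finally show ?thesis by (simp add: Pcoef_def f_def)
qed

section \<open>Planar pairings are determined by separating sets\<close>

text \<open>A planar pairing is a bracket word: a closing label belongs to the latest opener still
  unmatched. By induction on \<open>j\<close>, both pairings agree on all pairs closed before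
  \<open>j\<close>.\<close>

lemma planar_openers_mem:
  fixes \<sigma> \<sigma>' :: "nat set set"
  assumes s: "pairing_on N \<sigma>" "planar_pairing \<sigma>" and s': "pairing_on N \<sigma>'" "planar_pairing \<sigma>'"
    and op: "Min ` \<sigma> = Min ` \<sigma>'"
  shows "i < j \<Longrightarrow> {i, j} \<in> \<sigma> \<longleftrightarrow> {i, j} \<in> \<sigma>'"
proof (induction j arbitrary: i rule: less_induct)
  case (less j)
  have opener: "\<exists>k>i. {i, k} \<in> \<pi>" if pi: "pairing_on N \<pi>" "i \<in> Min ` \<pi>" for \<pi> i
  proof -
    obtain B where B: "B \<in> \<pi>" "i = Min B" using pi(2) by auto
    obtain p q where pq: "B = {p, q}" "p \<noteq> q" using card_2_neq[OF pairing_onD(1)[OF pi(1) B(1)]] by blast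
    show ?thesis
    proof (cases "p < q")
      case True
      then show ?thesis using B pq by (intro exI[of _ q]) (simp add: min_def)
    next
      case False
      then show ?thesis using B pq by (intro exI[of _ p]) (simp add: min_def insert_commute)
    qed
  qed
  have mem: "i \<in> Min ` \<pi>" if "{i, k} \<in> \<pi>" "i < k" for \<pi> :: "nat set set" and i k
    using that by (intro image_eqI[of _ _ "{i, k}"]) (auto simp: min_def)
  \<comment> \<open>One implication, for two arbitrary pairings, so that it can be used in both
    directions.\<close>
  have half: "{i, j} \<in> \<pi>'" if p: "pairing_on N \<pi>" "planar_pairing \<pi>" and p': "pairing_on N \<pi>'" "planar_pairing \<pi>'"
    and ops: "Min ` \<pi> = Min ` \<pi>'" and IH: "\<And>k i. k < j \<Longrightarrow> i < k \<Longrightarrow> {i, k} \<in> \<pi> \<longleftrightarrow> {i, k} \<in> \<pi>'"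
    and ij: "{i, j} \<in> \<pi>" for \<pi> \<pi>'
  proof -
    have "j \<in> N" using pairing_mem[OF p(1) ij] by simp
    then obtain i' where i': "{j, i'} \<in> \<pi>'" "i' \<noteq> j" using pairing_ex1[OF p'(1)] by blast
    have "j \<notin> Min ` \<pi>"
    proof
      assume "j \<in> Min ` \<pi>"
      then obtain k where "k > j" "{j, k} \<in> \<pi>" using opener[OF p(1)] by blast
      moreover have "{j, i} \<in> \<pi>" using ij by (simp add: insert_commute)
      ultimately have "k = i" using pairing_unique[OF p(1)] by blast
      then show False using less.prems \<open>k > j\<close> by simp
    qed
    then have i'j: "i' < j" using mem[of j i' \<pi>'] i' ops by (metis linorder_neqE_nat)
    have i'': "{i', j} \<in> \<pi>'" using i'(1) by (simp add: insert_commute)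
    consider "i = i'" | "i < i'" | "i' < i" by linarith
    then show ?thesis
    proof cases
      case 1
      then show ?thesis using i'' by simp
    next
      \<comment> \<open>The later opener \<open>i'\<close> must close before \<open>j\<close> in the
        first pairing to avoid a crossing. By induction it closes there in the second pairing too,
        where its partner is \<open>j\<close>. The third case exchanges the roles.\<close>
      case 2
      obtain k where k: "k > i'" "{i', k} \<in> \<pi>" using opener[OF p(1)] mem[OF i'' i'j] ops by blast
      have "k \<noteq> j"
      proof
        assume "k = j"
        then have "{j, i'} \<in> \<pi>" "{j, i} \<in> \<pi>" using k ij by (simp_all add: insert_commute)
        then show False using pairing_unique[OF p(1)] 2 by blast
      qed
      moreover have "\<not> j < k" using p(2) ij k 2 i'j unfolding planar_pairing_def by blast
      ultimately have "k < j" by simp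
      then have "{i', k} \<in> \<pi>'" using IH k by blast
      then have "k = j" using pairing_unique[OF p'(1)] i'' by blast
      then show ?thesis using \<open>k < j\<close> by simp
    next
      case 3
      obtain k where k: "k > i" "{i, k} \<in> \<pi>'" using opener[OF p'(1)] mem[OF ij less.prems] ops by blast
      have "k \<noteq> j"
      proof
        assume "k = j"
        then have "{j, i} \<in> \<pi>'" using k by (simp add: insert_commute)
        then show False using pairing_unique[OF p'(1)] i'(1) 3 by blast
      qed
      moreover have "\<not> j < k" using p'(2) i'' k 3 less.prems unfolding planar_pairing_def by blast
      ultimately have "k < j" by simp
      then have "{i, k} \<in> \<pi>" using IH k by blast
      then have "k = j" using pairing_unique[OF p(1)] ij by blast
      then show ?thesis using \<open>k < j\<close> by simp
    qed
  qed
  show ?case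
    using half[OF s s' op less.IH] half[OF s' s op[symmetric] less.IH[symmetric]] by blast
qed

lemma planar_eq_if_openers_eq:
  assumes "pairing_on N \<sigma>" "planar_pairing \<sigma>" "pairing_on N \<sigma>'" "planar_pairing \<sigma>'" "Min ` \<sigma> = Min ` \<sigma>'"
  shows "\<sigma> = \<sigma>'"
proof -
  have "B \<in> \<sigma> \<longleftrightarrow> B \<in> \<sigma>'" if B: "card B = 2" for B
  proof -
    obtain i j where "B = {i, j}" "i < j"
      using card_2_neq[OF B] by (metis insert_commute linorder_neqE_nat)
    then show ?thesis using planar_openers_mem[OF assms] by simp
  qed
  then show ?thesis using pairing_onD(1)[OF assms(1)] pairing_onD(1)[OF assms(3)] by blast
qed

lemma separates_card:
  assumes "separates S P" "pairing_on N P" "B \<in> P"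
  shows "card (B \<inter> S) = 1"
proof -
  obtain i j where ij: "B = {i, j}" "i \<noteq> j" using card_2_neq[OF pairing_onD(1)[OF assms(2,3)]] by blast
  then have "(i \<in> S) \<longleftrightarrow> (j \<notin> S)" using assms unfolding separates_def by blast
  then have "B \<inter> S = {i} \<or> B \<inter> S = {j}" using ij by blast
  then show ?thesis by auto
qed

lemma separates_openers:
  assumes "pairing_on N P"
  shows "separates (Min ` P) P"
  unfolding separates_def
proof (intro allI impI)
  have *: "i \<in> Min ` P \<and> j \<notin> Min ` P" if ij: "{i, j} \<in> P" "i < j" for i j
  proof
    show "i \<in> Min ` P" using that by (intro image_eqI[of _ _ "{i, j}"]) (auto simp: min_def)
    show "j \<notin> Min ` P"
    proof
      assume "j \<in> Min ` P"
      then obtain B where B: "B \<in> P" "j = Min B" by auto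
      have "finite B" "B \<noteq> {}" using pairing_onD(1)[OF assms B(1)] by (auto intro: card_ge_0_finite)
      then have "j \<in> B" using B by simp
      then have "B = {i, j}" using pairing_onD(5)[OF assms B(1) ij(1)] by simp
      then have "Min B = i" using ij(2) by (simp add: min_def)
      then show False using B(2) ij(2) by simp
    qed
  qed
  fix i j assume ij: "{i, j} \<in> P"
  then have "{j, i} \<in> P" by (simp add: insert_commute)
  moreover have "i \<noteq> j" using pairing_neq[OF assms ij] .
  ultimately show "(i \<in> Min ` P) = (j \<notin> Min ` P)" using *[of i j] *[of j i] ij by (metis linorder_neqE_nat)
qed

lemma card_openers:
  assumes "pairing_on N P" "finite N"
  shows "2 * card (Min ` P) = card N" "Min ` P \<subseteq> N"
proof -
  have sel: "Min B \<in> B" if "B \<in> P" for B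
    using pairing_onD(1)[OF assms(1) that] by (intro Min_in) (auto intro: card_ge_0_finite)
  have "inj_on Min P"
    by (rule inj_onI) (use sel pairing_onD(5)[OF assms(1)] in metis)
  then have "card (Min ` P) = card P" by (rule card_image)
  moreover have "card (\<Union>P) = sum card P"
    using pairing_onD(1,4)[OF assms(1)] by (intro card_Union_disjoint) (auto intro: card_ge_0_finite)
  moreover have "sum card P = (\<Sum>B\<in>P. 2)" using pairing_onD(1)[OF assms(1)] by (intro sum.cong) auto
  ultimately show "2 * card (Min ` P) = card N" using pairing_onD(3)[OF assms(1)] by simp
  show "Min ` P \<subseteq> N" using sel pairing_onD(2)[OF assms(1)] by blast
qed

text \<open>A separating set takes one label from each pair, and the openers take the smaller one,
  so they minimise the sum of labels, uniquely. This gives the order in which the linear system is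
  triangular.\<close>

lemma separated_openers_le:
  assumes P: "pairing_on N P" and N: "finite N" and O: "O' \<subseteq> N" "separates O' P"
  shows "\<Sum>(Min ` P) \<le> \<Sum>O'" "\<Sum>(Min ` P) = \<Sum>O' \<Longrightarrow> Min ` P = O'"
proof -
  have fin: "finite P" by (rule finite_pairing[OF N P])
  have finB: "finite B" if "B \<in> P" for B using pairing_onD(1)[OF P that] by (auto intro: card_ge_0_finite)
  have sel: "Min B \<in> B" if "B \<in> P" for B
    using pairing_onD(1)[OF P that] by (intro Min_in) (auto intro: card_ge_0_finite)
  have "\<forall>B\<in>P. \<exists>x. B \<inter> O' = {x}"
    using separates_card[OF O(2) P] by (simp add: card_1_singleton_iff)
  from bchoice[OF this] obtain e where e: "B \<inter> O' = {e B}" if "B \<in> P" for B by blast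
  have O': "O' = e ` P"
  proof -
    have "O' = (\<Union>B\<in>P. B \<inter> O')" using O(1) pairing_onD(3)[OF P] by blast
    also have "\<dots> = (\<Union>B\<in>P. {e B})" using e by (intro SUP_cong) auto
    finally show ?thesis by auto
  qed
  have eB: "e B \<in> B" if "B \<in> P" for B using e[OF that] by blast
  have inj: "inj_on e P" "inj_on Min P"
    by (rule inj_onI; use eB sel pairing_onD(5)[OF P] in metis)+
  have sums: "\<Sum>O' = (\<Sum>B\<in>P. e B)" "\<Sum>(Min ` P) = (\<Sum>B\<in>P. Min B)"
    unfolding O' using inj by (simp_all add: sum.reindex)
  have le: "Min B \<le> e B" if "B \<in> P" for B using finB eB that by auto
  show "\<Sum>(Min ` P) \<le> \<Sum>O'" unfolding sums by (rule sum_mono) (rule le)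
  assume eq: "\<Sum>(Min ` P) = \<Sum>O'"
  have "Min B = e B" if B: "B \<in> P" for B
  proof (rule ccontr)
    assume "Min B \<noteq> e B"
    then have "Min B < e B" using le[OF B] by simp
    then have "(\<Sum>B\<in>P. Min B) < (\<Sum>B\<in>P. e B)" using le B by (intro sum_strict_mono_ex1[OF fin]) auto
    then show False using eq sums by simp
  qed
  then show "Min ` P = O'" unfolding O' by (intro image_cong) auto
qed

text \<open>Induction on the sum of the openers. In the equation whose test set is the openers of
  \<open>\<sigma>\<close>, every other separated planar pairing has a strictly smaller sum and
  vanishes by induction.\<close>

lemma planar_separation_unique:
  fixes X :: "nat set set \<Rightarrow> real"
  assumes N: "finite N"
    and sys: "\<And>S. S \<subseteq> N \<Longrightarrow> 2 * card S = card N \<Longrightarrow>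
      (\<Sum>\<sigma> | pairing_on N \<sigma> \<and> planar_pairing \<sigma>. (if separates S \<sigma> then X \<sigma> else 0)) = 0"
    and s: "pairing_on N \<sigma>" "planar_pairing \<sigma>"
  shows "X \<sigma> = 0"
  using s
proof (induction "\<Sum>(Min ` \<sigma>)" arbitrary: \<sigma> rule: less_induct)
  case less
  let ?O = "Min ` \<sigma>" and ?PP = "{\<sigma>. pairing_on N \<sigma> \<and> planar_pairing \<sigma>}"
  have fin: "finite ?PP" by (rule finite_subset[OF _ finite_pairings[OF N]]) auto
  have others: "X \<tau> = 0" if t: "\<tau> \<in> ?PP" "separates ?O \<tau>" "\<tau> \<noteq> \<sigma>" for \<tau>
  proof -
    have tp: "pairing_on N \<tau>" "planar_pairing \<tau>" using t by auto
    note le = separated_openers_le[OF tp(1) N card_openers(2)[OF less.prems(1) N] t(2)]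
    have "Min ` \<tau> \<noteq> ?O" using planar_eq_if_openers_eq[OF tp less.prems] t(3) by blast
    then have "\<Sum>(Min ` \<tau>) < \<Sum>?O" using le by linarith
    then show ?thesis using less.hyps tp by blast
  qed
  have "0 = (\<Sum>\<tau>\<in>?PP. if separates ?O \<tau> then X \<tau> else 0)"
    using sys[OF card_openers(2,1)[OF less.prems(1) N]] by simp
  also have "\<dots> = (\<Sum>\<tau>\<in>?PP. if \<tau> = \<sigma> then X \<tau> else 0)"
    using others separates_openers[OF less.prems(1)] by (intro sum.cong refl) auto
  also have "\<dots> = X \<sigma>" using fin less.prems by simp
  finally show ?case by simp
qed

section \<open>Pairings of double-dimer configurations\<close>

definition label_pairing :: "(nat \<Rightarrow> 'v) \<Rightarrow> nat set \<Rightarrow> ('v \<times> 'v) multiset \<Rightarrow> nat set set" where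
  "label_pairing node A D = {{i, j} |i j. i \<in> A \<and> j \<in> A \<and> i \<noteq> j \<and> dd_conn D (node i) (node j)}"

lemma dd_pairing_eq: "dd_pairing n node D = label_pairing node {1..2*n} D"
  by (simp add: dd_pairing_def label_pairing_def)

lemma label_pairing_iff:
  "{i, j} \<in> label_pairing node A D \<longleftrightarrow> i \<in> A \<and> j \<in> A \<and> i \<noteq> j \<and> dd_conn D (node i) (node j)"
  (is "?L \<longleftrightarrow> ?R")
proof
  assume ?L
  then obtain k l where kl: "{i, j} = {k, l}" "k \<in> A" "l \<in> A" "k \<noteq> l" "dd_conn D (node k) (node l)"
    unfolding label_pairing_def by blast
  then show ?R using dd_conn_sym[OF kl(5)] by (auto simp: doubleton_eq_iff)
qed (auto simp: label_pairing_def)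

section \<open>Planar double-dimer configurations and the Laplace expansion\<close>

locale circular_bip_graph =
  fixes V V1 :: "'v set" and E :: "('v \<times> 'v) set" and n :: nat and node :: "nat \<Rightarrow> 'v"
    and pos :: "'v \<Rightarrow> complex" and \<gamma> :: "'v \<times> 'v \<Rightarrow> real \<Rightarrow> complex"
  assumes bip: "bip_graph V V1 E" and nodes: "nodes_ok V V1 n node"
    and emb: "disk_embedding V E n node pos \<gamma>"
begin

abbreviation N :: "nat set" where "N \<equiv> {1..2*n}"

definition blacks :: "nat set" where "blacks = {k \<in> N. node k \<in> V1}"

lemma node_inj: "inj_on node N" and node_V: "k \<in> N \<Longrightarrow> node k \<in> V" and card_blacks: "card blacks = n"
  using nodes by (auto simp: nodes_ok_def blacks_def)

lemma node_image_V: "A \<subseteq> N \<Longrightarrow> node ` A \<subseteq> V"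
  using node_V by auto

lemma label_partner:
  assumes A: "A \<subseteq> N" and D: "dd_config V E (node ` A) D" and k: "k \<in> A"
  shows "\<exists>!l. l \<in> A \<and> l \<noteq> k \<and> dd_conn D (node k) (node l)"
proof -
  note deg = dd_config_ddeg[OF bip node_image_V[OF A] D]
  have one: "ddeg D v = 1 \<longleftrightarrow> v \<in> node ` A" for v using deg[of v] by auto
  have inj: "inj_on node A" using node_inj A by (rule inj_on_subset)
  have "\<exists>!s. s \<noteq> node k \<and> s \<in> node ` A \<and> dd_conn D (node k) s"
    using ends_and_splits[OF dd_config_bip_degree_le_2[OF bip node_image_V[OF A] D]] k unfolding one by blast
  then obtain s where s: "s \<noteq> node k" "s \<in> node ` A" "dd_conn D (node k) s"
    and uniq: "\<And>t. t \<noteq> node k \<Longrightarrow> t \<in> node ` A \<Longrightarrow> dd_conn D (node k) t \<Longrightarrow> t = s" by blast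
  from s(2) obtain l where l: "l \<in> A" "s = node l" by blast
  show ?thesis
  proof (rule ex1I[of _ l])
    show "l \<in> A \<and> l \<noteq> k \<and> dd_conn D (node k) (node l)" using l s by auto
    fix m assume m: "m \<in> A \<and> m \<noteq> k \<and> dd_conn D (node k) (node m)"
    then have "node m \<noteq> node k" using inj_onD[OF inj] k by blast
    then have "node m = node l" using uniq[of "node m"] m l by blast
    then show "m = l" using inj_onD[OF inj] m l by blast
  qed
qed

lemma pairing_on_label_pairing:
  assumes A: "A \<subseteq> N" and D: "dd_config V E (node ` A) D"
  shows "pairing_on A (label_pairing node A D)"
  unfolding pairing_on_def
proof (intro conjI)
  let ?P = "label_pairing node A D"
  have two: "\<exists>i j. B = {i, j} \<and> {i, j} \<in> ?P" if "B \<in> ?P" for B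
    using that by (auto simp: label_pairing_def)
  show "\<forall>B\<in>?P. card B = 2" by (auto simp: label_pairing_def)
  show "\<Union>?P = A"
  proof
    show "\<Union>?P \<subseteq> A" by (auto simp: label_pairing_def)
    show "A \<subseteq> \<Union>?P"
    proof
      fix k assume k: "k \<in> A"
      then obtain l where "l \<in> A" "l \<noteq> k" "dd_conn D (node k) (node l)" using label_partner[OF A D] by blast
      then have "{k, l} \<in> ?P" using k by (simp add: label_pairing_iff)
      then show "k \<in> \<Union>?P" by blast
    qed
  qed
  have eq: "B = B'" if B: "B \<in> ?P" "B' \<in> ?P" "x \<in> B" "x \<in> B'" for B B' x
  proof -
    have "\<exists>y. B = {x, y}" if "B \<in> ?P" "x \<in> B" for B
      using that two[OF that(1)] by (metis insertE insert_commute singletonD)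
    then obtain y y' where y: "B = {x, y}" "B' = {x, y'}" using B by blast
    then have "y \<in> A \<and> y \<noteq> x \<and> dd_conn D (node x) (node y)" "y' \<in> A \<and> y' \<noteq> x \<and> dd_conn D (node x) (node y')" "x \<in> A"
      using B(1,2) by (simp_all only: label_pairing_iff) auto
    then have "y = y'" using label_partner[OF A D, of x] by blast
    then show ?thesis using y by simp
  qed
  show "pairwise disjnt ?P"
    unfolding pairwise_def disjnt_iff using eq by blast
qed

text \<open>Crossing pairs would be in a single component, giving \<open>a\<close> the two partners
  \<open>b\<close> and \<open>c\<close>.\<close>

lemma planar_label_pairing:
  assumes A: "A \<subseteq> N" and D: "dd_config V E (node ` A) D"
  shows "planar_pairing (label_pairing node A D)"
  unfolding planar_pairing_def
proof
  assume "\<exists>a b c d. a < b \<and> b < c \<and> c < d \<and> {a, c} \<in> label_pairing node A D \<and> {b, d} \<in> label_pairing node A D"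
  then obtain a b c d where ord: "a < b" "b < c" "c < d"
    and ac: "{a, c} \<in> label_pairing node A D" and bd: "{b, d} \<in> label_pairing node A D" by blast
  have mem: "a \<in> A" "b \<in> A" "c \<in> A" "d \<in> A" and conn: "dd_conn D (node a) (node c)" "dd_conn D (node b) (node d)"
    using ac bd by (simp_all only: label_pairing_iff)
  have "set_mset D \<subseteq> E" using D by (simp add: dd_config_def)
  moreover have "1 \<le> a" "d \<le> 2 * n" using mem A by auto
  ultimately have "dd_conn D (node a) (node b)"
    using noncrossing_components[OF bip nodes emb, of D a b c d] ord conn by blast
  then show False using label_partner[OF A D mem(1)] mem conn(1) ord by (metis less_irrefl order_less_trans)
qed

lemma ends_compat_label_pairing:
  assumes A: "A \<subseteq> N" and X: "X \<subseteq> A" and D: "dd_config V E (node ` A) D"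
  shows "ends_compat V1 D (node ` X) \<longleftrightarrow> pairing_compat blacks (label_pairing node A D) X"
proof -
  have one: "ddeg D v = 1 \<longleftrightarrow> v \<in> node ` A" for v
    using dd_config_ddeg[OF bip node_image_V[OF A] D, of v] by auto
  have inj: "inj_on node A" using node_inj A by (rule inj_on_subset)
  have black: "node i \<in> V1 \<longleftrightarrow> i \<in> blacks" if "i \<in> A" for i
    using that A by (auto simp: blacks_def)
  have side: "node i \<in> node ` X \<longleftrightarrow> i \<in> X" if "i \<in> A" for i
    by (rule inj_on_image_mem_iff[OF inj that X])
  have neq: "node i \<noteq> node j \<longleftrightarrow> i \<noteq> j" if "i \<in> A" "j \<in> A" for i j
    using inj_on_eq_iff[OF inj that] by blast
  show ?thesis
  proof
    assume L: "ends_compat V1 D (node ` X)"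
    show "pairing_compat blacks (label_pairing node A D) X"
      unfolding pairing_compat_def label_pairing_iff
    proof (intro allI impI)
      fix i j assume ij: "i \<in> A \<and> j \<in> A \<and> i \<noteq> j \<and> dd_conn D (node i) (node j)"
      then have "node i \<noteq> node j \<and> ddeg D (node i) = 1 \<and> ddeg D (node j) = 1 \<and> dd_conn D (node i) (node j)"
        using neq[of i j] one by simp
      then have "(node i \<in> V1 \<longleftrightarrow> node j \<notin> V1) \<longleftrightarrow> (node i \<in> node ` X \<longleftrightarrow> node j \<in> node ` X)"
        using L unfolding ends_compat_def by blast
      then show "(i \<in> blacks \<longleftrightarrow> j \<notin> blacks) \<longleftrightarrow> (i \<in> X \<longleftrightarrow> j \<in> X)"
        using black side ij by simp
    qed
  next
    assume R: "pairing_compat blacks (label_pairing node A D) X"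
    show "ends_compat V1 D (node ` X)"
      unfolding ends_compat_def
    proof (intro allI impI)
      fix s t assume st: "s \<noteq> t \<and> ddeg D s = 1 \<and> ddeg D t = 1 \<and> dd_conn D s t"
      then obtain i j where ij: "i \<in> A" "j \<in> A" "s = node i" "t = node j" using one by auto
      then have "{i, j} \<in> label_pairing node A D" using st unfolding label_pairing_iff by blast
      then have "(i \<in> blacks \<longleftrightarrow> j \<notin> blacks) \<longleftrightarrow> (i \<in> X \<longleftrightarrow> j \<in> X)"
        using R unfolding pairing_compat_def by blast
      then show "(s \<in> V1 \<longleftrightarrow> t \<notin> V1) \<longleftrightarrow> (s \<in> node ` X \<longleftrightarrow> t \<in> node ` X)"
        using black side ij by simp
    qed
  qed
qed

lemma label_superposition:
  assumes A: "A \<subseteq> N" and X: "X \<subseteq> A"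
  shows "ZD E wt (V - node ` X) * ZD E wt (V - node ` (A - X)) =
    (\<Sum>D\<in>{D. dd_config V E (node ` A) D}. dd_weight wt D * 2 ^ dd_loops V (node ` A) D *
      (if pairing_compat blacks (label_pairing node A D) X then 1 else 0))"
proof -
  have "node ` (A - X) = node ` A - node ` X"
    using inj_on_image_set_diff[OF node_inj, of A X] A X by auto
  then have "ZD E wt (V - node ` X) * ZD E wt (V - node ` (A - X)) =
    (\<Sum>D\<in>{D. dd_config V E (node ` A) D}. dd_weight wt D * 2 ^ dd_loops V (node ` A) D *
      (if ends_compat V1 D (node ` X) then 1 else 0))"
    using superposition[OF bip node_image_V[OF A] image_mono[OF X]] by simp
  also have "\<dots> = (\<Sum>D\<in>{D. dd_config V E (node ` A) D}. dd_weight wt D * 2 ^ dd_loops V (node ` A) D *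
      (if pairing_compat blacks (label_pairing node A D) X then 1 else 0))"
    using ends_compat_label_pairing[OF A X] by (intro sum.cong refl) simp
  finally show ?thesis .
qed

text \<open>Both sides are sums over the configurations with node labels \<open>A\<close>, the left
  with \<open>X = A\<close> and the right with \<open>X = {b, w}\<close>;
  \<open>planar_laplace\<close> compares them configuration by configuration. For four nodes of
  alternating colours this is Kuo condensation.\<close>

lemma ZD_laplace:
  assumes A: "A \<subseteq> N" and b: "b \<in> A" "b \<in> blacks"
  shows "ZD E wt (V - node ` A) * ZD E wt V = (\<Sum>w\<in>A - blacks. of_int (- pos_sgn A b * pos_sgn A w) *
    (ZD E wt (V - {node b, node w}) * ZD E wt (V - node ` (A - {b, w}))))"
proof -
  let ?D = "{D. dd_config V E (node ` A) D}" and ?W = "\<lambda>D. dd_weight wt D * 2 ^ dd_loops V (node ` A) D"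
  let ?c = "\<lambda>D X. if pairing_compat blacks (label_pairing node A D) X then 1 else (0::real)"
  have finA: "finite A" using A finite_subset by blast
  have "(\<Sum>w\<in>A - blacks. of_int (- pos_sgn A b * pos_sgn A w) *
    (ZD E wt (V - {node b, node w}) * ZD E wt (V - node ` (A - {b, w})))) =
    (\<Sum>w\<in>A - blacks. \<Sum>D\<in>?D. ?W D * (of_int (- pos_sgn A b * pos_sgn A w) * ?c D {b, w}))"
  proof (rule sum.cong[OF refl])
    fix w assume "w \<in> A - blacks"
    then have "{b, w} \<subseteq> A" using b by auto
    from label_superposition[OF A this, of wt]
    show "of_int (- pos_sgn A b * pos_sgn A w) * (ZD E wt (V - {node b, node w}) * ZD E wt (V - node ` (A - {b, w}))) =
      (\<Sum>D\<in>?D. ?W D * (of_int (- pos_sgn A b * pos_sgn A w) * ?c D {b, w}))"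
      by (simp add: sum_distrib_left mult_ac)
  qed
  also have "\<dots> = (\<Sum>D\<in>?D. ?W D * (\<Sum>w\<in>A - blacks. of_int (- pos_sgn A b * pos_sgn A w) * ?c D {b, w}))"
    by (subst sum.swap) (simp only: sum_distrib_left)
  also have "\<dots> = (\<Sum>D\<in>?D. ?W D * ?c D A)"
  proof (rule sum.cong[OF refl])
    fix D assume "D \<in> ?D"
    then have D: "dd_config V E (node ` A) D" by simp
    have "(\<Sum>w\<in>A - blacks. of_int (- pos_sgn A b * pos_sgn A w) * ?c D {b, w}) =
      of_int (\<Sum>w\<in>A - blacks. - pos_sgn A b * pos_sgn A w * (if pairing_compat blacks (label_pairing node A D) {b, w} then 1 else 0))"
      unfolding of_int_sum by (intro sum.cong refl) simp
    also have "\<dots> = ?c D A"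
      using planar_laplace[OF pairing_on_label_pairing[OF A D] finA planar_label_pairing[OF A D] b] by simp
    finally show "?W D * (\<Sum>w\<in>A - blacks. of_int (- pos_sgn A b * pos_sgn A w) * ?c D {b, w}) = ?W D * ?c D A" by simp
  qed
  also have "\<dots> = ZD E wt (V - node ` A) * ZD E wt V"
    using label_superposition[OF A order_refl, of wt] by simp
  finally show ?thesis ..
qed

definition Yblock :: "('v \<times> 'v \<Rightarrow> real) \<Rightarrow> nat set \<Rightarrow> real" where
  "Yblock wt B = Ynode V E wt node (Min B) (Max B)"

lemma Yblock_doubleton: "Yblock wt {i, j} = ZD E wt (V - {node i, node j}) / ZD E wt V"
  by (cases "i \<le> j") (auto simp: Yblock_def Ynode_def min_def max_def insert_commute)

text \<open>Dividing \<open>ZD_laplace\<close> by the square of \<open>ZD E wt V\<close> gives the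
  recursion \<open>bw_sum_expand\<close>. Colour balance persists when \<open>b\<close> and
  \<open>w\<close> are removed, and when no black label remains it forces \<open>A\<close> to be
  empty.\<close>

lemma ZD_ratio:
  assumes Z: "ZD E wt V \<noteq> 0" and A: "A \<subseteq> N" "card (A \<inter> blacks) = card (A - blacks)"
  shows "ZD E wt (V - node ` A) / ZD E wt V = bw_sum blacks (Yblock wt) A"
  using A
proof (induction "card A" arbitrary: A rule: less_induct)
  case less
  have finA: "finite A" using less.prems(1) finite_subset by blast
  show ?case
  proof (cases "A \<inter> blacks = {}")
    case True
    then have "A - blacks = {}" using less.prems(2) finA by simp
    then have "A = {}" using True by blast
    then show ?thesis using Z by (simp add: bw_sum_empty)
  next
    case False
    then obtain b where b: "b \<in> A" "b \<in> blacks" by blast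
    have IH: "ZD E wt (V - node ` (A - {b, w})) / ZD E wt V = bw_sum blacks (Yblock wt) (A - {b, w})"
      if w: "w \<in> A - blacks" for w
    proof (rule less.hyps)
      show "card (A - {b, w}) < card A" using finA b by (intro psubset_card_mono) auto
      show "A - {b, w} \<subseteq> N" using less.prems(1) by blast
      have "(A - {b, w}) \<inter> blacks = A \<inter> blacks - {b}" "A - {b, w} - blacks = A - blacks - {w}" using w b by auto
      then show "card ((A - {b, w}) \<inter> blacks) = card (A - {b, w} - blacks)"
        using less.prems(2) finA w b by simp
    qed
    have "ZD E wt (V - node ` A) / ZD E wt V = (ZD E wt (V - node ` A) * ZD E wt V) / (ZD E wt V * ZD E wt V)"
      using Z by simp
    also have "\<dots> = (\<Sum>w\<in>A - blacks. of_int (- pos_sgn A b * pos_sgn A w) *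
      (ZD E wt (V - {node b, node w}) * ZD E wt (V - node ` (A - {b, w}))) / (ZD E wt V * ZD E wt V))"
      unfolding ZD_laplace[OF less.prems(1) b] by (rule sum_divide_distrib)
    also have "\<dots> = (\<Sum>w\<in>A - blacks. of_int (- pos_sgn A b * pos_sgn A w) * Yblock wt {b, w} * bw_sum blacks (Yblock wt) (A - {b, w}))"
    proof (rule sum.cong[OF refl])
      fix w assume "w \<in> A - blacks"
      from IH[OF this, symmetric]
      show "of_int (- pos_sgn A b * pos_sgn A w) *
        (ZD E wt (V - {node b, node w}) * ZD E wt (V - node ` (A - {b, w}))) / (ZD E wt V * ZD E wt V) =
        of_int (- pos_sgn A b * pos_sgn A w) * Yblock wt {b, w} * bw_sum blacks (Yblock wt) (A - {b, w})"
        by (simp add: Yblock_doubleton)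
    qed
    also have "\<dots> = bw_sum blacks (Yblock wt) A" by (rule bw_sum_expand[OF finA b, symmetric])
    finally show ?thesis .
  qed
qed

end

section \<open>Products of signed sums over the two sides of a cut\<close>

lemma osgn_prod_square: "(\<Prod>x\<in>A. \<Prod>y\<in>A'. osgn x y) * (\<Prod>x\<in>A. \<Prod>y\<in>A'. osgn x y) = 1"
  unfolding prod.distrib[symmetric] by simp

text \<open>A pairing of \<open>A\<close> and one of its complement form a pairing of
  \<open>N\<close> without blocks across the cut. By \<open>chi_Un\<close> the signs differ by a
  factor that is common to all such pairings.\<close>

lemma bw_sum_mult:
  assumes N: "finite N" and A: "A \<subseteq> N"
  shows "bw_sum K y A * bw_sum K y (N - A) = (\<Sum>\<rho>\<in>bw_pairings K N.
    if \<forall>B\<in>\<rho>. B \<subseteq> A \<or> B \<inter> A = {} then of_int ((\<Prod>x\<in>A. \<Prod>y\<in>N - A. osgn x y) * chi \<rho>) * (\<Prod>B\<in>\<rho>. y B) else 0)"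
proof -
  let ?e = "\<Prod>x\<in>A. \<Prod>y\<in>N - A. osgn x y" and ?g = "\<lambda>P. of_int (chi P) * (\<Prod>B\<in>P. y B)"
  let ?S = "{\<rho> \<in> bw_pairings K N. \<forall>B\<in>\<rho>. B \<subseteq> A \<or> B \<inter> A = {}}"
  have fin: "finite A" "finite (N - A)" using assms finite_subset by auto
  have "bw_sum K y A * bw_sum K y (N - A) = (\<Sum>(P, Q)\<in>bw_pairings K A \<times> bw_pairings K (N - A). ?g P * ?g Q)"
    by (simp add: bw_sum_def sum_product sum.cartesian_product)
  also have "\<dots> = (\<Sum>\<rho>\<in>?S. of_int (?e * chi \<rho>) * (\<Prod>B\<in>\<rho>. y B))"
  proof (rule sum.reindex_bij_witness[where j = "\<lambda>(P, Q). P \<union> Q" and i = "\<lambda>\<rho>. ({B \<in> \<rho>. B \<subseteq> A}, {B \<in> \<rho>. B \<inter> A = {}})"])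
    fix \<rho> assume r: "\<rho> \<in> ?S"
    then have p: "pairing_on N \<rho>" by (simp add: bw_pairings_def)
    have ne: "B \<noteq> {}" if "B \<in> \<rho>" for B using pairing_onD(1)[OF p that] by auto
    have "\<Union>{B \<in> \<rho>. B \<subseteq> A} = A" "\<Union>{B \<in> \<rho>. B \<inter> A = {}} = N - A"
      using r pairing_onD(3)[OF p] A by blast+
    then have "pairing_on A {B \<in> \<rho>. B \<subseteq> A}" "pairing_on (N - A) {B \<in> \<rho>. B \<inter> A = {}}"
      using pairing_on_subset[OF p, of "{B \<in> \<rho>. B \<subseteq> A}"] pairing_on_subset[OF p, of "{B \<in> \<rho>. B \<inter> A = {}}"] by auto
    then show "({B \<in> \<rho>. B \<subseteq> A}, {B \<in> \<rho>. B \<inter> A = {}}) \<in> bw_pairings K A \<times> bw_pairings K (N - A)"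
      using r by (simp add: bw_pairings_def)
    show "(case ({B \<in> \<rho>. B \<subseteq> A}, {B \<in> \<rho>. B \<inter> A = {}}) of (P, Q) \<Rightarrow> P \<union> Q) = \<rho>"
      using r by auto
  next
    fix a assume a: "a \<in> bw_pairings K A \<times> bw_pairings K (N - A)"
    obtain P Q where PQ: "a = (P, Q)" by (cases a)
    have p: "pairing_on A P" "pairing_on (N - A) Q" and bw: "P \<in> bw_pairings K A" "Q \<in> bw_pairings K (N - A)"
      using a PQ by (auto simp: bw_pairings_def)
    have disj: "A \<inter> (N - A) = {}" by auto
    have sub: "B \<in> P \<Longrightarrow> B \<subseteq> A \<and> B \<noteq> {}" "B \<in> Q \<Longrightarrow> B \<subseteq> N - A \<and> B \<noteq> {}" for B
      using pairing_onD(1,2)[OF p(1)] pairing_onD(1,2)[OF p(2)] by fastforce+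
    have "A \<union> (N - A) = N" using A by auto
    then have "pairing_on N (P \<union> Q)" using pairing_on_Un[OF p disj] by simp
    then show "(case a of (P, Q) \<Rightarrow> P \<union> Q) \<in> ?S"
      using bw PQ sub by (auto simp: bw_pairings_def)
    have "{B \<in> P \<union> Q. B \<subseteq> A} = P" "{B \<in> P \<union> Q. B \<inter> A = {}} = Q" using sub by blast+
    then show "({B \<in> (case a of (P, Q) \<Rightarrow> P \<union> Q). B \<subseteq> A}, {B \<in> (case a of (P, Q) \<Rightarrow> P \<union> Q). B \<inter> A = {}}) = a"
      using PQ by simp
    have "chi (P \<union> Q) = chi P * chi Q * ?e" by (rule chi_Un[OF p(1) fin(1) p(2) fin(2) disj])
    then have "?e * chi (P \<union> Q) = chi P * chi Q" using osgn_prod_square[of "N - A" A] by (simp add: mult_ac)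
    moreover have "(\<Prod>B\<in>P \<union> Q. y B) = (\<Prod>B\<in>P. y B) * (\<Prod>B\<in>Q. y B)"
      using finite_pairing[OF fin(1) p(1)] finite_pairing[OF fin(2) p(2)] sub
      by (intro prod.union_disjoint) blast+
    ultimately show "of_int (?e * chi (case a of (P, Q) \<Rightarrow> P \<union> Q)) * (\<Prod>B\<in>(case a of (P, Q) \<Rightarrow> P \<union> Q). y B) =
      (case a of (P, Q) \<Rightarrow> ?g P * ?g Q)"
      using PQ by (simp add: mult_ac)
  qed
  also have "\<dots> = (\<Sum>\<rho>\<in>bw_pairings K N. if \<forall>B\<in>\<rho>. B \<subseteq> A \<or> B \<inter> A = {} then of_int (?e * chi \<rho>) * (\<Prod>B\<in>\<rho>. y B) else 0)"
    by (rule sum.inter_filter[OF finite_bw_pairings[OF N]])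
  finally show ?thesis .
qed

section \<open>Signs of odd-even and black-white pairings\<close>

lemma pos_sgn_interval:
  assumes "x \<in> {1..L}"
  shows "pos_sgn {1..L} x = (if odd x then 1 else - 1)"
proof -
  have "pos_sgn {1..L} x = (\<Prod>y\<in>{1..L} - {x}. if y < x then - 1 else 1)"
    unfolding pos_sgn_def by (intro prod.cong refl) (auto simp: osgn_def)
  also have "\<dots> = (- 1) ^ card {y \<in> {1..L} - {x}. y < x}" by (rule prod_minus_one_card) simp
  also have "{y \<in> {1..L} - {x}. y < x} = {1..<x}" using assms by auto
  also have "card {1..<x} = x - 1" by simp
  finally show ?thesis using assms by (auto simp: minus_one_power_iff)
qed

lemma sorted_list_enumeration:
  fixes K :: "nat set"
  assumes "finite K"
  shows "bij_betw (\<lambda>i. sorted_list_of_set K ! (i - 1)) {1..card K} K"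
    and "strict_mono_on {1..card K} (\<lambda>i. sorted_list_of_set K ! (i - 1))"
proof -
  let ?l = "sorted_list_of_set K"
  have len: "length ?l = card K" by simp
  have "bij_betw (\<lambda>i. ?l ! i) {..<card K} K"
    using bij_betw_nth[of ?l "{..<length ?l}" "set ?l"] assms by simp
  moreover have "bij_betw (\<lambda>i. i - 1) {1..card K} {..<card K}"
    by (rule bij_betwI[where g = Suc]) auto
  ultimately show "bij_betw (\<lambda>i. ?l ! (i - 1)) {1..card K} K"
    using bij_betw_trans[of "\<lambda>i. i - 1" "{1..card K}" "{..<card K}" "\<lambda>i. ?l ! i" K] by (simp add: o_def)
  show "strict_mono_on {1..card K} (\<lambda>i. ?l ! (i - 1))"
    unfolding strict_mono_on_def
  proof (intro allI impI)
    fix r s assume rs: "r \<in> {1..card K} \<and> s \<in> {1..card K} \<and> r < s"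
    have "sorted_wrt (<) ?l" by simp
    then show "?l ! (r - 1) < ?l ! (s - 1)" by (rule sorted_wrt_nth_less) (use rs len in auto)
  qed
qed

text \<open>In an initial interval the parity of a position is the parity of the label, so
  \<open>planar_pos_sgn\<close> makes the two ends of a pair differ in parity.\<close>

lemma planar_odd_even:
  assumes P: "pairing_on {1..L} P" "planar_pairing P"
  shows "P \<in> bw_pairings {x \<in> {1..L}. odd x} {1..L}"
proof -
  have "\<exists>b w. B = {b, w} \<and> b \<in> {x \<in> {1..L}. odd x} \<and> w \<notin> {x \<in> {1..L}. odd x}" if B: "B \<in> P" for B
  proof -
    obtain i j where ij: "B = {i, j}" using card_2_neq[OF pairing_onD(1)[OF P(1) B]] by blast
    have mem: "i \<in> {1..L}" "j \<in> {1..L}" using pairing_mem[OF P(1)] B ij by blast+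
    have "pos_sgn {1..L} i * pos_sgn {1..L} j = - 1"
      using planar_pos_sgn[OF P(1) _ P(2)] B ij by simp
    then have "odd i \<noteq> odd j" using pos_sgn_interval[OF mem(1)] pos_sgn_interval[OF mem(2)] by (auto split: if_splits)
    then consider "odd i" "even j" | "odd j" "even i" by blast
    then show ?thesis
    proof cases
      case 1
      then show ?thesis using ij mem by (intro exI[of _ i] exI[of _ j]) auto
    next
      case 2
      then show ?thesis using ij mem by (intro exI[of _ j] exI[of _ i]) auto
    qed
  qed
  then show ?thesis using P by (simp add: bw_pairings_def)
qed

lemma odd_labels_bij:
  fixes n :: nat
  shows
  "bij_betw (\<lambda>i. 2 * i - 1) {1..n} {x \<in> {1..2*n}. odd x}"
  "bij_betw (\<lambda>i. 2 * i) {1..n} ({1..2*n} - {x \<in> {1..2*n}. odd x})"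
proof -
  show "bij_betw (\<lambda>i. 2 * i - 1) {1..n} {x \<in> {1..2*n}. odd x}"
    by (rule bij_betwI[where g = "\<lambda>x. (x + 1) div 2"]) (auto elim!: oddE)
  show "bij_betw (\<lambda>i. 2 * i) {1..n} ({1..2*n} - {x \<in> {1..2*n}. odd x})"
    by (rule bij_betwI[where g = "\<lambda>x. x div 2"]) (auto elim!: evenE)
qed

text \<open>\<open>bw_split_sgn\<close> with the odd labels as black ones, enumerated by
  \<open>2 * i - 1\<close> and \<open>2 * i\<close> as in \<open>sign_OE\<close>. Odd labels have
  position sign 1, so no further sign remains.\<close>

lemma split_sgn_odd_even:
  fixes n :: nat
  assumes P: "pairing_on {1..2*n} P" "planar_pairing P"
  defines "Od \<equiv> {x \<in> {1..2*n}. odd x}"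
  shows "split_sgn S P = sign_OE n P * (if separates S P then \<Prod>x\<in>Od. if x \<in> S then 1 else - 1 else 0)"
proof -
  note bw = planar_odd_even[OF P, folded Od_def]
  have "split_sgn S P = sign_OE n P * (\<Prod>x\<in>Od. pos_sgn {1..2*n} x) *
     (if separates S P then \<Prod>x\<in>Od. if x \<in> S then 1 else - 1 else 0)"
    unfolding sign_OE_def
  proof (rule bw_split_sgn[OF bw])
    show "Od \<subseteq> {1..2*n}" "finite {1..2*n}" by (auto simp: Od_def)
    show "bij_betw (\<lambda>i. 2 * i - 1) {1..n} Od" "bij_betw (\<lambda>i. 2 * i) {1..n} ({1..2*n} - Od)"
      unfolding Od_def by (rule odd_labels_bij)+
    show "strict_mono_on {1..n} (\<lambda>i. 2 * i - 1)" "strict_mono_on {1..n} (\<lambda>i::nat. 2 * i)"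
      by (auto simp: strict_mono_on_def)
    fix i assume i: "i \<in> {1..n}"
    then have "2 * i - 1 \<in> {1..2*n}" "2 * i - 1 \<in> Od" by (auto simp: Od_def)
    from bw_pairings_partner(2)[OF bw this]
    have "partner P (2 * i - 1) \<in> {1..2*n}" "even (partner P (2 * i - 1))" by (auto simp: Od_def)
    then show "(if i \<in> {1..n} then partner P (2 * i - 1) div 2 else i) \<in> {1..n} \<and>
       2 * (if i \<in> {1..n} then partner P (2 * i - 1) div 2 else i) = partner P (2 * i - 1)"
      using i by (auto elim!: evenE)
  qed auto
  moreover have "(\<Prod>x\<in>Od. pos_sgn {1..2*n} x) = (\<Prod>x\<in>Od. 1)"
  proof (rule prod.cong[OF refl])
    fix x assume "x \<in> Od"
    then have "x \<in> {1..2*n}" "odd x" by (auto simp: Od_def)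
    then show "pos_sgn {1..2*n} x = 1" using pos_sgn_interval[of x "2*n"] by simp
  qed
  ultimately show ?thesis by simp
qed

context circular_bip_graph
begin

lemma black_white_labels:
  "black_labels V1 n node = sorted_list_of_set blacks"
  "white_labels V1 n node = sorted_list_of_set (N - blacks)"
proof -
  have "{k \<in> {1..2*n}. node k \<notin> V1} = N - blacks" by (auto simp: blacks_def)
  then show "black_labels V1 n node = sorted_list_of_set blacks"
    "white_labels V1 n node = sorted_list_of_set (N - blacks)"
    by (simp_all add: black_labels_def white_labels_def blacks_def)
qed

lemma blacks_subset: "blacks \<subseteq> N" and card_whites: "card (N - blacks) = n"
proof -
  show "blacks \<subseteq> N" by (auto simp: blacks_def)
  moreover from this have "finite blacks" by (rule finite_subset) simp
  ultimately show "card (N - blacks) = n" using card_blacks by (simp add: card_Diff_subset)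
qed

lemma is_bw_pairing_iff: "is_bw_pairing V1 n node P \<longleftrightarrow> P \<in> bw_pairings blacks N"
proof -
  have "(\<exists>b w. B = {b, w} \<and> node b \<in> V1 \<and> node w \<notin> V1) \<longleftrightarrow> (\<exists>b w. B = {b, w} \<and> b \<in> blacks \<and> w \<notin> blacks)"
    if "pairing_on N P" "B \<in> P" for B
  proof -
    have "B \<subseteq> N" by (rule pairing_onD(2)[OF that])
    then show ?thesis unfolding blacks_def by blast
  qed
  then show ?thesis by (auto simp: is_bw_pairing_def is_pairing_iff bw_pairings_def)
qed

text \<open>The same computation for the given colouring; here the position signs of the black
  labels remain and are absorbed later by \<open>cut_sign\<close>.\<close>

lemma split_sgn_black_white:
  assumes P: "P \<in> bw_pairings blacks N"
  shows "split_sgn S P = sign_BW V1 n node P * (\<Prod>x\<in>blacks. pos_sgn N x) *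
    (if separates S P then \<Prod>x\<in>blacks. if x \<in> S then 1 else - 1 else 0)"
  unfolding sign_BW_def black_white_labels
proof (rule bw_split_sgn[OF P blacks_subset])
  let ?b = "\<lambda>i. sorted_list_of_set blacks ! (i - 1)" and ?w = "\<lambda>i. sorted_list_of_set (N - blacks) ! (i - 1)"
  have fin: "finite blacks" "finite (N - blacks)" using blacks_subset finite_subset by auto
  show b: "bij_betw ?b {1..n} blacks" "strict_mono_on {1..n} ?b"
    using sorted_list_enumeration[OF fin(1)] card_blacks by simp_all
  show w: "bij_betw ?w {1..n} (N - blacks)" "strict_mono_on {1..n} ?w"
    using sorted_list_enumeration[OF fin(2)] card_whites by simp_all
  fix i assume i: "i \<in> {1..n}"
  then have "?b i \<in> blacks" by (rule bij_betw_apply[OF b(1)])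
  moreover from this have "?b i \<in> N" using blacks_subset by blast
  ultimately have "partner P (?b i) \<in> N - blacks" using bw_pairings_partner(2)[OF P] by blast
  then have "partner P (?b i) \<in> ?w ` {1..n}" unfolding bij_betw_imp_surj_on[OF w(1)] .
  then obtain j where j: "j \<in> {1..n}" "?w j = partner P (?b i)" by (elim imageE) simp
  \<comment> \<open>The white labels are enumerated bijectively, so the description in
    \<open>sign_BW\<close> denotes the index of the partner.\<close>
  have "\<exists>!j. j \<in> {1..n} \<and> ?w j = partner P (?b i)"
  proof (rule ex1I[of _ j])
    fix k assume k: "k \<in> {1..n} \<and> ?w k = partner P (?b i)"
    then have "?w k = ?w j" using j(2) by simp
    then show "k = j" using inj_onD[OF bij_betw_imp_inj_on[OF w(1)]] k j(1) by blast
  qed (use j in simp)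
  from theI'[OF this] i
  show "(if i \<in> {1..n} then THE j. j \<in> {1..n} \<and> ?w j = partner P (?b i) else i) \<in> {1..n} \<and>
    ?w (if i \<in> {1..n} then THE j. j \<in> {1..n} \<and> ?w j = partner P (?b i) else i) = partner P (?b i)"
    by simp
qed auto

lemma Yprime_eq: "Yprime V E wt node \<rho> = of_int (chi \<rho>) * (\<Prod>B\<in>\<rho>. Yblock wt B)"
  by (simp add: Yprime_def chi_def Yblock_def)

definition planars :: "nat set set set" where
  "planars = {\<sigma>. pairing_on N \<sigma> \<and> planar_pairing \<sigma>}"

lemma finite_planars: "finite planars"
  unfolding planars_def by (rule finite_subset[OF _ finite_pairings[of N]]) auto

section \<open>The linear system for the pairing weights\<close>

text \<open>A pairing connects \<open>S\<close> to its complement iff its black-white pairs, and only those,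
  stay on one side of \<open>cut S\<close>.\<close>
definition cut :: "nat set \<Rightarrow> nat set" where
  "cut S = (blacks - S) \<union> (S - blacks)"

text \<open>Inside \<open>N\<close>, membership in \<open>S\<close> is the exclusive or of being
  black and being in the cut. Hence two ends differ in \<open>S\<close> iff exactly one of colour
  and side differs.\<close>

lemma separates_iff_cut:
  assumes "pairing_on N P"
  shows "separates S P \<longleftrightarrow> pairing_compat blacks P (cut S)"
  unfolding separates_def pairing_compat_def cut_def by blast

text \<open>Superposition with \<open>X = cut S\<close>, where the surviving configurations are
  exactly those whose pairing separates \<open>S\<close>, regrouped by their pairing.\<close>

lemma ZDD_separated_sum:
  assumes S: "S \<subseteq> N"
  shows "(\<Sum>\<sigma>\<in>planars. if separates S \<sigma> then ZDD V E wt n node \<sigma> else 0) =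
    ZD E wt (V - node ` cut S) * ZD E wt (V - node ` (N - cut S))"
proof -
  let ?D = "{D. dd_config V E (node ` N) D}" and ?p = "label_pairing node N"
  let ?W = "\<lambda>D. dd_weight wt D * 2 ^ dd_loops V (node ` N) D"
  have cut: "cut S \<subseteq> N" using S blacks_subset by (auto simp: cut_def)
  have fin: "finite ?D" by (rule finite_dd_configs[OF bip_graph_edges[OF bip]])
  have range: "?p ` ?D \<subseteq> planars"
    using pairing_on_label_pairing[OF order_refl] planar_label_pairing[OF order_refl] by (auto simp: planars_def)
  have "ZD E wt (V - node ` cut S) * ZD E wt (V - node ` (N - cut S)) =
    (\<Sum>D\<in>?D. ?W D * (if pairing_compat blacks (?p D) (cut S) then 1 else 0))"
    by (rule label_superposition[OF order_refl cut])
  also have "\<dots> = (\<Sum>D\<in>?D. if separates S (?p D) then ?W D else 0)"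
    using separates_iff_cut[OF pairing_on_label_pairing[OF order_refl]] by (intro sum.cong refl) simp
  also have "\<dots> = (\<Sum>\<sigma>\<in>planars. \<Sum>D\<in>{D \<in> ?D. ?p D = \<sigma>}. if separates S (?p D) then ?W D else 0)"
    by (rule sum.group[OF fin finite_planars range, symmetric])
  also have "\<dots> = (\<Sum>\<sigma>\<in>planars. if separates S \<sigma> then ZDD V E wt n node \<sigma> else 0)"
  proof (rule sum.cong[OF refl])
    fix \<sigma>
    have "(\<Sum>D\<in>{D \<in> ?D. ?p D = \<sigma>}. if separates S (?p D) then ?W D else 0) =
      (if separates S \<sigma> then (\<Sum>D\<in>{D \<in> ?D. ?p D = \<sigma>}. ?W D) else 0)"
      by (auto intro!: sum.cong sum.neutral)
    also have "(\<Sum>D\<in>{D \<in> ?D. ?p D = \<sigma>}. ?W D) = ZDD V E wt n node \<sigma>"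
      by (simp add: ZDD_def dd_weight_def dd_pairing_eq)
    finally show "(\<Sum>D\<in>{D \<in> ?D. ?p D = \<sigma>}. if separates S (?p D) then ?W D else 0) =
      (if separates S \<sigma> then ZDD V E wt n node \<sigma> else 0)" .
  qed
  finally show ?thesis ..
qed

text \<open>Since \<open>S\<close> and \<open>blacks\<close> both have \<open>n\<close> elements,
  the cut has \<open>2 * card (blacks - S)\<close> elements. As a symmetric difference, its product
  of position signs is that over \<open>blacks\<close> times that over \<open>S\<close>. The latter
  counts the even labels in \<open>S\<close>, which are as many as the odd labels outside
  \<open>S\<close>.\<close>

lemma cut_sign:
  assumes S: "S \<subseteq> N" "card S = n"
  defines "Od \<equiv> {x \<in> N. odd x}"
  shows "(\<Prod>x\<in>cut S. \<Prod>y\<in>N - cut S. osgn x y) =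
    (\<Prod>x\<in>Od. if x \<in> S then 1 else - 1) * (\<Prod>x\<in>blacks. pos_sgn N x) * (\<Prod>x\<in>blacks. if x \<in> S then 1 else - 1)"
proof -
  have fin: "finite S" "finite blacks" "finite Od" using S blacks_subset finite_subset by (auto simp: Od_def)
  have cardOd: "card Od = n" using bij_betw_same_card[OF odd_labels_bij(1)[of n]] by (simp add: Od_def)
  have flip: "(\<Prod>x\<in>X. if x \<in> S then 1 else - 1) = (- 1::int) ^ card (X - S)" if "finite X" for X
  proof -
    have "(\<Prod>x\<in>X. if x \<in> S then 1 else - 1) = (\<Prod>x\<in>X. if x \<notin> S then - 1 else (1::int))"
      by (intro prod.cong) auto
    also have "\<dots> = (- 1) ^ card {x \<in> X. x \<notin> S}" by (rule prod_minus_one_card[OF that])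
    also have "{x \<in> X. x \<notin> S} = X - S" by auto
    finally show ?thesis .
  qed
  have diff: "card (X - S) = card (S - X)" if "finite X" "card X = n" for X
    using card_Diff_subset_Int[of X S] card_Diff_subset_Int[of S X] that S fin by (simp add: Int_commute)
  have cut: "cut S \<subseteq> N" using S blacks_subset by (auto simp: cut_def)
  have card_cut: "card (cut S) = 2 * card (blacks - S)"
    unfolding cut_def using fin diff[OF fin(2) card_blacks] by (subst card_Un_disjoint) auto
  \<comment> \<open>The exponent is \<open>m * (2 * m - 1)\<close>, of the same parity as
    \<open>m\<close>.\<close>
  have tri: "(- 1::int) ^ (\<Sum>k<2 * m. k) = (- 1) ^ m" for m :: nat
    by (induction m) (simp_all add: power_add)
  have "(\<Prod>x\<in>cut S. \<Prod>y\<in>N - cut S. osgn x y) = (- 1) ^ card (blacks - S) * (\<Prod>x\<in>cut S. pos_sgn N x)"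
    using prod_osgn_cut[of N "cut S"] cut card_cut tri by simp
  also have "(\<Prod>x\<in>cut S. pos_sgn N x) = (\<Prod>x\<in>blacks. pos_sgn N x) * (\<Prod>x\<in>S. pos_sgn N x)"
  proof -
    let ?p = "pos_sgn N"
    have h1: "(\<Prod>x\<in>cut S. ?p x) = (\<Prod>x\<in>blacks - S. ?p x) * (\<Prod>x\<in>S - blacks. ?p x)"
      unfolding cut_def using fin by (intro prod.union_disjoint) auto
    have h2: "(\<Prod>x\<in>blacks. ?p x) = (\<Prod>x\<in>blacks - S. ?p x) * (\<Prod>x\<in>blacks \<inter> S. ?p x)"
      using prod.Int_Diff[OF fin(2), of ?p S] by (simp add: mult.commute)
    have h3: "(\<Prod>x\<in>S. ?p x) = (\<Prod>x\<in>blacks \<inter> S. ?p x) * (\<Prod>x\<in>S - blacks. ?p x)"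
      using prod.Int_Diff[OF fin(1), of ?p blacks] by (simp add: Int_commute)
    have h4: "(\<Prod>x\<in>blacks \<inter> S. ?p x) * (\<Prod>x\<in>blacks \<inter> S. ?p x) = 1"
      unfolding prod.distrib[symmetric] by (simp add: pos_sgn_square)
    have cancel: "a * b = (a * q) * (q * b)" if "q * q = 1" for a b q :: int
    proof -
      have "(a * q) * (q * b) = a * (q * q) * b" by (simp only: mult.assoc)
      then show ?thesis using that by simp
    qed
    show ?thesis unfolding h1 h2 h3 by (rule cancel[OF h4])
  qed
  also have "(\<Prod>x\<in>S. pos_sgn N x) = (- 1) ^ card (S - Od)"
  proof -
    have "(\<Prod>x\<in>S. pos_sgn N x) = (\<Prod>x\<in>S. if x \<notin> Od then - 1 else 1)"
    proof (rule prod.cong[OF refl])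
      fix x assume "x \<in> S"
      then have x: "x \<in> N" using S by blast
      then show "pos_sgn N x = (if x \<notin> Od then - 1 else 1)"
        using pos_sgn_interval[OF x] by (simp add: Od_def)
    qed
    also have "\<dots> = (- 1) ^ card {x \<in> S. x \<notin> Od}" by (rule prod_minus_one_card[OF fin(1)])
    also have "{x \<in> S. x \<notin> Od} = S - Od" by auto
    finally show ?thesis .
  qed
  finally show ?thesis
    using flip[OF fin(2)] flip[OF fin(3)] diff[OF fin(3) cardOd] by (simp add: mult_ac)
qed

text \<open>On separated planar pairings \<open>split_sgn S \<sigma>\<close> is
  \<open>sign_OE\<close> times a sign of \<open>S\<close> alone, so the sum reduces by
  \<open>Pcoef_split_sgn\<close> to \<open>split_sgn S \<rho>\<close>. Its factor
  \<open>sign_BW\<close> cancels the one in \<open>QDD\<close>, and \<open>cut_sign\<close>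
  identifies the rest.\<close>

lemma QDD_separated_sum:
  assumes S: "S \<subseteq> N" "card S = n" and \<rho>: "\<rho> \<in> bw_pairings blacks N"
  shows "(\<Sum>\<sigma>\<in>planars. if separates S \<sigma> then QDD V1 n node \<sigma> \<rho> else 0) =
    (if separates S \<rho> then \<Prod>x\<in>cut S. \<Prod>y\<in>N - cut S. osgn x y else 0)"
proof -
  let ?t = "\<lambda>X. \<Prod>x\<in>X. if x \<in> S then 1 else (- 1::int)" and ?Od = "{x \<in> N. odd x}"
  have sq: "?t X * ?t X = 1" for X unfolding prod.distrib[symmetric] by (rule prod.neutral) auto
  have bw2: "sign_BW V1 n node \<rho> * sign_BW V1 n node \<rho> = 1" by (simp add: sign_BW_def)
  have p: "pairing_on N \<rho>" using \<rho> by (simp add: bw_pairings_def)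
  have "(\<Sum>\<sigma>\<in>planars. if separates S \<sigma> then QDD V1 n node \<sigma> \<rho> else 0) =
    (\<Sum>\<sigma>\<in>planars. sign_BW V1 n node \<rho> * ?t ?Od * (Pcoef \<sigma> \<rho> * split_sgn S \<sigma>))"
  proof (rule sum.cong[OF refl])
    fix \<sigma> assume "\<sigma> \<in> planars"
    then have "split_sgn S \<sigma> = sign_OE n \<sigma> * (if separates S \<sigma> then ?t ?Od else 0)"
      using split_sgn_odd_even by (simp add: planars_def)
    then show "(if separates S \<sigma> then QDD V1 n node \<sigma> \<rho> else 0) =
      sign_BW V1 n node \<rho> * ?t ?Od * (Pcoef \<sigma> \<rho> * split_sgn S \<sigma>)"
      using sq[of ?Od] by (simp add: QDD_def mult_ac)
  qed
  also have "\<dots> = sign_BW V1 n node \<rho> * ?t ?Od * split_sgn S \<rho>"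
    using Pcoef_split_sgn[OF p, of S] by (simp add: planars_def sum_distrib_left[symmetric])
  also have "split_sgn S \<rho> = sign_BW V1 n node \<rho> * (\<Prod>x\<in>blacks. pos_sgn N x) * (if separates S \<rho> then ?t blacks else 0)"
    by (rule split_sgn_black_white[OF \<rho>])
  also have "sign_BW V1 n node \<rho> * ?t ?Od * \<dots> =
     (sign_BW V1 n node \<rho> * sign_BW V1 n node \<rho>) * (if separates S \<rho> then ?t ?Od * (\<Prod>x\<in>blacks. pos_sgn N x) * ?t blacks else 0)"
    by (simp add: mult_ac)
  also have "\<dots> = (if separates S \<rho> then \<Prod>x\<in>cut S. \<Prod>y\<in>N - cut S. osgn x y else 0)"
    unfolding bw2 cut_sign[OF S] by simp
  finally show ?thesis .
qed

text \<open>All pairs differ in colour, so compatibility with the cut says that no block straddles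
  it.\<close>

lemma bw_separates_iff:
  assumes "\<rho> \<in> bw_pairings blacks N"
  shows "separates S \<rho> \<longleftrightarrow> (\<forall>B\<in>\<rho>. B \<subseteq> cut S \<or> B \<inter> cut S = {})"
proof -
  have p: "pairing_on N \<rho>" using assms by (simp add: bw_pairings_def)
  have bw: "i \<in> blacks \<longleftrightarrow> j \<notin> blacks" if "{i, j} \<in> \<rho>" for i j
  proof -
    have "\<forall>B\<in>\<rho>. \<exists>b w. B = {b, w} \<and> b \<in> blacks \<and> w \<notin> blacks"
      using assms by (simp add: bw_pairings_def)
    from bspec[OF this that] obtain b w where "{i, j} = {b, w}" "b \<in> blacks" "w \<notin> blacks" by blast
    then show ?thesis by (auto simp: doubleton_eq_iff)
  qed
  show ?thesis
  proof
    assume L: "separates S \<rho>"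
    show "\<forall>B\<in>\<rho>. B \<subseteq> cut S \<or> B \<inter> cut S = {}"
    proof
      fix B assume B: "B \<in> \<rho>"
      then obtain i j where ij: "B = {i, j}" using card_2_neq[OF pairing_onD(1)[OF p B]] by blast
      then have "i \<in> cut S \<longleftrightarrow> j \<in> cut S"
        using L[unfolded separates_iff_cut[OF p] pairing_compat_def] bw B by blast
      then show "B \<subseteq> cut S \<or> B \<inter> cut S = {}" using ij by blast
    qed
  next
    assume R: "\<forall>B\<in>\<rho>. B \<subseteq> cut S \<or> B \<inter> cut S = {}"
    show "separates S \<rho>"
      unfolding separates_iff_cut[OF p] pairing_compat_def
    proof (intro allI impI)
      fix i j assume ij: "{i, j} \<in> \<rho>"
      have "i \<in> cut S \<longleftrightarrow> j \<in> cut S" using bspec[OF R ij] by auto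
      then show "(i \<in> blacks \<longleftrightarrow> j \<notin> blacks) \<longleftrightarrow> (i \<in> cut S \<longleftrightarrow> j \<in> cut S)" using bw[OF ij] by simp
    qed
  qed
qed

text \<open>The left side factors into two ratios over the sides of the cut, each expanded by
  \<open>ZD_ratio\<close>; for this, \<open>card S = n\<close> makes both sides colour-balanced. In
  the product, the sign of the cut is replaced by the sum in
  \<open>QDD_separated_sum\<close>.\<close>

lemma separated_system:
  assumes Z: "ZD E wt V \<noteq> 0" and S: "S \<subseteq> N" "card S = n"
  shows "(\<Sum>\<sigma>\<in>planars. if separates S \<sigma> then ZDD V E wt n node \<sigma> / (ZD E wt V)\<^sup>2 else 0) =
    (\<Sum>\<sigma>\<in>planars. if separates S \<sigma> then
      \<Sum>\<rho>\<in>bw_pairings blacks N. of_int (QDD V1 n node \<sigma> \<rho>) * Yprime V E wt node \<rho> else 0)"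
proof -
  let ?e = "\<Prod>x\<in>cut S. \<Prod>y\<in>N - cut S. osgn x y"
  have fin: "finite S" "finite blacks" using S blacks_subset finite_subset by auto
  have cut: "cut S \<subseteq> N" using S blacks_subset by (auto simp: cut_def)
  have d: "card (blacks - S) = card (S - blacks)"
    using card_Diff_subset_Int[of blacks S] card_Diff_subset_Int[of S blacks] fin card_blacks S by (simp add: Int_commute)
  have "cut S \<inter> blacks = blacks - S" "cut S - blacks = S - blacks" by (auto simp: cut_def)
  then have bal1: "card (cut S \<inter> blacks) = card (cut S - blacks)" using d by simp
  have "(N - cut S) \<inter> blacks = blacks \<inter> S" "N - cut S - blacks = (N - blacks) - (S - blacks)"
    using S blacks_subset by (auto simp: cut_def)
  moreover have "card ((N - blacks) - (S - blacks)) = card (N - blacks) - card (S - blacks)"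
    using S fin by (intro card_Diff_subset) auto
  moreover have "card (blacks - S) = card blacks - card (blacks \<inter> S)" "card (blacks \<inter> S) \<le> card blacks"
    using fin by (auto simp: card_Diff_subset_Int intro: card_mono)
  ultimately have bal2: "card ((N - cut S) \<inter> blacks) = card (N - cut S - blacks)"
    using d card_whites card_blacks by simp
  have "(\<Sum>\<sigma>\<in>planars. if separates S \<sigma> then ZDD V E wt n node \<sigma> / (ZD E wt V)\<^sup>2 else 0) =
    (\<Sum>\<sigma>\<in>planars. (if separates S \<sigma> then ZDD V E wt n node \<sigma> else 0) / (ZD E wt V)\<^sup>2)"
    by (intro sum.cong) auto
  also have "\<dots> = ZD E wt (V - node ` cut S) / ZD E wt V * (ZD E wt (V - node ` (N - cut S)) / ZD E wt V)"
    unfolding sum_divide_distrib[symmetric] ZDD_separated_sum[OF S(1)] by (simp add: power2_eq_square)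
  also have "\<dots> = bw_sum blacks (Yblock wt) (cut S) * bw_sum blacks (Yblock wt) (N - cut S)"
    using ZD_ratio[OF Z cut bal1] ZD_ratio[OF Z _ bal2] by simp
  also have "\<dots> = (\<Sum>\<rho>\<in>bw_pairings blacks N. of_int (if separates S \<rho> then ?e else 0) * Yprime V E wt node \<rho>)"
  proof -
    have "(if \<forall>B\<in>\<rho>. B \<subseteq> cut S \<or> B \<inter> cut S = {} then of_int (?e * chi \<rho>) * (\<Prod>B\<in>\<rho>. Yblock wt B) else 0) =
      of_int (if separates S \<rho> then ?e else 0) * Yprime V E wt node \<rho>" if "\<rho> \<in> bw_pairings blacks N" for \<rho>
      unfolding bw_separates_iff[OF that, symmetric] Yprime_eq by (simp add: mult.assoc)
    then show ?thesis
      unfolding bw_sum_mult[OF finite_atLeastAtMost cut, of blacks "Yblock wt"] by (rule sum.cong[OF refl])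
  qed
  also have "\<dots> = (\<Sum>\<rho>\<in>bw_pairings blacks N. \<Sum>\<sigma>\<in>planars.
      (if separates S \<sigma> then of_int (QDD V1 n node \<sigma> \<rho>) * Yprime V E wt node \<rho> else 0))"
  proof (rule sum.cong[OF refl])
    fix \<rho> assume "\<rho> \<in> bw_pairings blacks N"
    from QDD_separated_sum[OF S this, symmetric]
    have "of_int (if separates S \<rho> then ?e else 0) * Yprime V E wt node \<rho> =
      (\<Sum>\<sigma>\<in>planars. of_int (if separates S \<sigma> then QDD V1 n node \<sigma> \<rho> else 0) * Yprime V E wt node \<rho>)"
      by (simp only: of_int_sum sum_distrib_right)
    also have "\<dots> = (\<Sum>\<sigma>\<in>planars. if separates S \<sigma> then of_int (QDD V1 n node \<sigma> \<rho>) * Yprime V E wt node \<rho> else 0)"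
      by (intro sum.cong) auto
    finally show "of_int (if separates S \<rho> then ?e else 0) * Yprime V E wt node \<rho> =
      (\<Sum>\<sigma>\<in>planars. if separates S \<sigma> then of_int (QDD V1 n node \<sigma> \<rho>) * Yprime V E wt node \<rho> else 0)" .
  qed
  also have "\<dots> = (\<Sum>\<sigma>\<in>planars. \<Sum>\<rho>\<in>bw_pairings blacks N.
      (if separates S \<sigma> then of_int (QDD V1 n node \<sigma> \<rho>) * Yprime V E wt node \<rho> else 0))"
    by (rule sum.swap)
  also have "\<dots> = (\<Sum>\<sigma>\<in>planars. if separates S \<sigma> then
      \<Sum>\<rho>\<in>bw_pairings blacks N. of_int (QDD V1 n node \<sigma> \<rho>) * Yprime V E wt node \<rho> else 0)"
    by (intro sum.cong) auto
  finally show ?thesis .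
qed

text \<open>The difference of the two sides solves the homogeneous triangular system.\<close>

lemma ZDD_ratio_eq:
  assumes Z: "ZD E wt V \<noteq> 0" and s: "pairing_on N \<sigma>" "planar_pairing \<sigma>"
  shows "ZDD V E wt n node \<sigma> / (ZD E wt V)\<^sup>2 =
    (\<Sum>\<rho>\<in>bw_pairings blacks N. of_int (QDD V1 n node \<sigma> \<rho>) * Yprime V E wt node \<rho>)"
proof -
  define L where "L \<sigma> = ZDD V E wt n node \<sigma> / (ZD E wt V)\<^sup>2" for \<sigma>
  define R where "R \<sigma> = (\<Sum>\<rho>\<in>bw_pairings blacks N. of_int (QDD V1 n node \<sigma> \<rho>) * Yprime V E wt node \<rho>)" for \<sigma>
  have "L \<sigma> - R \<sigma> = 0"
  proof (rule planar_separation_unique[of N _ \<sigma>, OF _ _ s])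
    fix S assume S: "S \<subseteq> N" "2 * card S = card N"
    then have "card S = n" by simp
    note eq = separated_system[OF Z S(1) this]
    have "(\<Sum>\<sigma>\<in>planars. if separates S \<sigma> then L \<sigma> - R \<sigma> else 0) =
      (\<Sum>\<sigma>\<in>planars. if separates S \<sigma> then L \<sigma> else 0) - (\<Sum>\<sigma>\<in>planars. if separates S \<sigma> then R \<sigma> else 0)"
      unfolding sum_subtractf[symmetric] by (intro sum.cong) auto
    also have "\<dots> = 0" using eq by (simp only: L_def R_def)
    finally show "(\<Sum>\<sigma> | pairing_on N \<sigma> \<and> planar_pairing \<sigma>. if separates S \<sigma> then L \<sigma> - R \<sigma> else 0) = 0"
      by (simp add: planars_def)
  qed simp
  then show ?thesis by (simp add: L_def R_def)
qed

end

theorem mainTheorem4: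
  fixes V V1 :: "'v set" and E :: "('v \<times> 'v) set" and wt :: "'v \<times> 'v \<Rightarrow> real"
    and n :: nat and node :: "nat \<Rightarrow> 'v"
    and pos :: "'v \<Rightarrow> complex" and \<gamma> :: "'v \<times> 'v \<Rightarrow> real \<Rightarrow> complex"
    and \<sigma> :: "nat set set"
  assumes "bip_graph V V1 E"
    and "nodes_ok V V1 n node"
    and "disk_embedding V E n node pos \<gamma>"
    and "ZD E wt V \<noteq> 0"
    and "is_pairing n \<sigma>" and "planar_pairing \<sigma>"
  shows "ZDD V E wt n node \<sigma> / (ZD E wt V)\<^sup>2 =
    (\<Sum>\<rho>\<in>{\<rho>. is_bw_pairing V1 n node \<rho>}. of_int (QDD V1 n node \<sigma> \<rho>) * Yprime V E wt node \<rho>)"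
proof -
  interpret circular_bip_graph V V1 E n node pos \<gamma>
    using assms(1-3) by unfold_locales
  show ?thesis
    using ZDD_ratio_eq[OF assms(4) _ assms(6)] assms(5) by (simp add: is_pairing_iff is_bw_pairing_iff)
qed

end
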